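(* For $i=1,2$, let $\Gamma_i$ be a finitely generated virtually abelian group, and let $\nu$ be an aperiodic probability measure with finite second moment on $\Gamma_1\times\Gamma_2$ such that the support of $\nu$ generates $\Gamma_1\times\Gamma_2$ as a semigroup. Let $\mu^{(i)}$ be the marginal of $\nu$ on $\Gamma_i$. If $\Gamma_1$ admits no nonzero homomorphism onto $\mathbb{Z}$, then $$\big\|\nu_n-\mu^{(1)}_n\times\mu^{(2)}_n\big\|_{\mathrm{TV}}\to0\quad\text{as }n\to\infty.$$
   Context: A group is virtually abelian if it has an abelian subgroup of finite index. For a probability measure $\nu$ on a countable group, $\nu_n:=\nu^{*n}$ is the $n$-fold convolution power (and similarly $\mu^{(i)}_n$). The total variation distance is $\|\nu-\nu'\|_{\mathrm{TV}}=\max_A|\nu(A)-\nu'(A)|=\tfrac12\|\nu-\nu'\|_1$. The measure $\nu$ is aperiodic if the greatest common divisor of $\{n\ge1:\nu_n(\mathrm{id})>0\}$ is $1$. It has finite second moment if $\sum_g|g|^2\nu(g)<\infty$ for a (equivalently, any) word metric $|\cdot|$ associated with a finite generating set. *)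

theory Defs
  imports
    "HOL-Algebra.Elementary_Groups"
    "HOL-Analysis.Infinite_Sum"
    "HOL-Probability.Probability_Mass_Function"
begin

definition finitely_generated_group :: "('a, 'm) monoid_scheme \<Rightarrow> bool" where
  "finitely_generated_group G \<longleftrightarrow>
     group G \<and> (\<exists>S. finite S \<and> S \<subseteq> carrier G \<and> generate G S = carrier G)"

definition virtually_abelian :: "('a, 'm) monoid_scheme \<Rightarrow> bool" where
  "virtually_abelian G \<longleftrightarrow>
     group G \<and>
     (\<exists>H. subgroup H G \<and> comm_group (G\<lparr>carrier := H\<rparr>) \<and> finite (rcosets\<^bsub>G\<^esub> H))"

(* Products of nonempty words in S, without inverses; the identity belongs to the
   result only if it is itself such a product. *)
inductive_set semigroup_generated :: "('a, 'm) monoid_scheme \<Rightarrow> 'a set \<Rightarrow> 'a set"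
  for G (structure) and S where
  incl: "x \<in> S \<Longrightarrow> x \<in> semigroup_generated G S"
| mult: "x \<in> semigroup_generated G S \<Longrightarrow> y \<in> semigroup_generated G S \<Longrightarrow>
         x \<otimes> y \<in> semigroup_generated G S"

(* Only meaningful for g in the subgroup generated by S; elsewhere LEAST is taken over
   the empty set. *)
definition word_length :: "('a, 'm) monoid_scheme \<Rightarrow> 'a set \<Rightarrow> 'a \<Rightarrow> nat" where
  "word_length G S g =
     (LEAST n. \<exists>ws. length ws = n \<and> set ws \<subseteq> S \<union> (\<lambda>s. inv\<^bsub>G\<^esub> s) ` S \<and>
                    foldr (\<otimes>\<^bsub>G\<^esub>) ws \<one>\<^bsub>G\<^esub> = g)"

(* A probability measure on a countable group G is a pmf whose support lies in carrier G.
   Finitely generated groups are countable, so no measure is lost. *)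

definition convolution :: "('a, 'm) monoid_scheme \<Rightarrow> 'a pmf \<Rightarrow> 'a pmf \<Rightarrow> 'a pmf" where
  "convolution G p q = map_pmf (\<lambda>(x, y). x \<otimes>\<^bsub>G\<^esub> y) (pair_pmf p q)"

primrec conv_power :: "('a, 'm) monoid_scheme \<Rightarrow> 'a pmf \<Rightarrow> nat \<Rightarrow> 'a pmf" where
  "conv_power G p 0 = return_pmf \<one>\<^bsub>G\<^esub>"
| "conv_power G p (Suc n) = convolution G (conv_power G p n) p"

definition aperiodic :: "('a, 'm) monoid_scheme \<Rightarrow> 'a pmf \<Rightarrow> bool" where
  "aperiodic G p \<longleftrightarrow> Gcd {n. n \<ge> 1 \<and> pmf (conv_power G p n) \<one>\<^bsub>G\<^esub> > 0} = 1"

definition finite_second_moment :: "('a, 'm) monoid_scheme \<Rightarrow> 'a pmf \<Rightarrow> bool" where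
  "finite_second_moment G p \<longleftrightarrow>
     (\<exists>S. finite S \<and> S \<subseteq> carrier G \<and> generate G S = carrier G \<and>
          (\<lambda>g. (real (word_length G S g))\<^sup>2 * pmf p g) summable_on carrier G)"

definition tv_dist :: "'a pmf \<Rightarrow> 'a pmf \<Rightarrow> real" where
  "tv_dist p q = (SUP A. \<bar>measure_pmf.prob p A - measure_pmf.prob q A\<bar>)"

end

theory Submission
  imports
    Defs
    "HOL-Algebra.FiniteProduct"
    "HOL-Real_Asymp.Real_Asymp"
begin

text \<open>Let \<open>\<nu>' = \<mu>1 \<times> \<mu>2\<close>. Instead of a local limit theorem, the proof uses a Lindeberg replacement:
  \<open>\<nu>\<close> and \<open>\<nu>'\<close> are exchanged one factor at a time, and \<open>n\<close> errors of size \<open>o(1 / n)\<close> add up to \<open>o(1)\<close>.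

  Choose abelian normal subgroups \<open>N1\<close>, \<open>N2\<close> of finite index. A lazy step on a conjugation-closed
  finite subset of \<open>N1 \<times> N2\<close> is central, and some power of \<open>\<nu>\<close> contains it as a component; hence each
  translation difference by an element of \<open>N1 \<times> N2\<close> costs a factor \<open>O(1 / sqrt n)\<close> in the \<open>n\<close>-step
  walk. Another component of that power is the uniform distribution \<open>\<kappa>\<close> on coset representatives, and
  the exchanged segment may be taken to lie between two copies of \<open>\<kappa>\<close>. As both laws have the same
  marginals, only the mixed second difference in the directions of \<open>N1\<close> and \<open>N2\<close> matters, which is
  \<open>O(1 / n)\<close>. Averaging over \<open>\<kappa>\<close> replaces the \<open>N1\<close>-displacement by the transfer \<open>G1 \<rightarrow> N1\<close>, whose
  values are torsion elements because \<open>G1\<close> has no epimorphism onto the integers; so the second-order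
  term cancels up to third order, and the second moment turns \<open>O(1 / n)\<close> into \<open>o(1 / n)\<close>.\<close>

section \<open>Expectations, mixtures and total variation of probability mass functions\<close>

text \<open>The two copies of \<open>\<kappa>\<close> have different tasks. Summing over the left
  representative collects the displacements in \<open>N1\<close> into the transfer. Summing over the
  right one makes the result insensitive to the base point, which otherwise moves with the left
  representative and would spoil that sum. The mixed difference is additive in each direction to
  leading order, so annihilating its \<open>N1\<close>-direction suffices. \<open>\<kappa>\<close>
  need not be central, so its position cannot be prescribed: the segment between two occurrences has
  random length with geometric tails, and moments along it may grow only polynomially. Nor need
  \<open>N1\<close> and \<open>N2\<close> be central: a translation pushed past earlier factors
  turns into a conjugate, and it is smoothed by the factors on its right. A long tail of unexchanged
  factors is therefore kept behind each exchange, and inversion of the group serves the other end of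
  the walk. Only large powers of \<open>\<nu>\<close> are known to contain the required components.
  Comparison along multiples of \<open>m\<close> and of \<open>m + 1\<close> recovers every
  \<open>n\<close>.\<close>

abbreviation expect :: "'a pmf \<Rightarrow> ('a \<Rightarrow> real) \<Rightarrow> real" where
  "expect p f \<equiv> measure_pmf.expectation p f"

lemma integrable_pmf_bounded:
  fixes f :: "'a \<Rightarrow> real"
  assumes "\<And>x. \<bar>f x\<bar> \<le> M"
  shows "integrable (measure_pmf p) f"
  by (rule measure_pmf.integrable_const_bound[where B = M]) (use assms in auto)

lemma abs_expect_le:
  assumes "\<And>x. x \<in> set_pmf p \<Longrightarrow> \<bar>f x\<bar> \<le> M"
  shows "\<bar>expect p f\<bar> \<le> M"
proof -
  have "integrable (measure_pmf p) f"
    by (rule measure_pmf.integrable_const_bound[where B = M]) (use assms in \<open>auto simp: AE_measure_pmf_iff\<close>)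
  then have "\<bar>expect p f\<bar> \<le> expect p (\<lambda>x. \<bar>f x\<bar>)" "integrable (measure_pmf p) (\<lambda>x. \<bar>f x\<bar>)"
    by auto
  moreover have "expect p (\<lambda>x. \<bar>f x\<bar>) \<le> expect p (\<lambda>_. M)"
    by (rule integral_mono_AE) (use assms calculation in \<open>auto simp: AE_measure_pmf_iff\<close>)
  moreover have "expect p (\<lambda>_. M) = M" by simp
  ultimately show ?thesis by linarith
qed

lemma expect_cong: "(\<And>x. x \<in> set_pmf p \<Longrightarrow> f x = g x) \<Longrightarrow> expect p f = expect p g"
  by (rule integral_cong_AE) (auto simp: AE_measure_pmf_iff)

lemma expect_bind:
  assumes "\<And>x. \<bar>f x\<bar> \<le> M"
  shows "expect (bind_pmf p k) f = expect p (\<lambda>x. expect (k x) f)"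
proof -
  have "0 \<le> M" using abs_ge_zero[of "f undefined"] assms[of undefined] by linarith
  show ?thesis
    unfolding measure_pmf_bind
    by (rule integral_bind[where K = "count_space UNIV" and B = M and B' = 1])
       (use assms \<open>0 \<le> M\<close> in \<open>auto simp: measure_pmf.finite_measure_axioms measure_pmf.emeasure_space_1 
          space_subprob_algebra intro!: prob_space_imp_subprob_space measure_pmf.prob_space_axioms\<close>)
qed

text \<open>The least such \<open>c\<close> is the l1-distance, twice the total variation. Testing
  against bounded functions keeps the bound linear, hence stable under mixtures and under
  convolution on either side.\<close>

definition tv_le :: "'a pmf \<Rightarrow> 'a pmf \<Rightarrow> real \<Rightarrow> bool" where
  "tv_le p q c \<longleftrightarrow> (\<forall>f. (\<forall>x. \<bar>f x\<bar> \<le> 1) \<longrightarrow> \<bar>expect p f - expect q f\<bar> \<le> c)"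

lemma tv_leD: "tv_le p q c \<Longrightarrow> (\<And>x. \<bar>f x\<bar> \<le> 1) \<Longrightarrow> \<bar>expect p f - expect q f\<bar> \<le> c"
  by (auto simp: tv_le_def)

lemma tv_le_trans:
  assumes "tv_le p q c" "tv_le q r d"
  shows "tv_le p r (c + d)"
  unfolding tv_le_def
proof (intro allI impI)
  fix f :: "'a \<Rightarrow> real" assume "\<forall>x. \<bar>f x\<bar> \<le> 1"
  then show "\<bar>expect p f - expect r f\<bar> \<le> c + d"
    using tv_leD[OF assms(1), of f] tv_leD[OF assms(2), of f] by auto
qed

lemma tv_le_sym: "tv_le p q c \<Longrightarrow> tv_le q p c"
  by (simp add: tv_le_def abs_minus_commute)

lemma tv_le_refl: "0 \<le> c \<Longrightarrow> tv_le p p c"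
  by (simp add: tv_le_def)

lemma tv_le_mono: "tv_le p q c \<Longrightarrow> c \<le> d \<Longrightarrow> tv_le p q d"
  unfolding tv_le_def by (meson order_trans)

lemma tv_le_nonneg: "tv_le p q c \<Longrightarrow> 0 \<le> c"
  using tv_leD[of p q c "\<lambda>_. 0"] by simp

lemma tv_le_two: "tv_le p q 2"
  unfolding tv_le_def
proof (intro allI impI)
  fix f :: "'a \<Rightarrow> real" assume "\<forall>x. \<bar>f x\<bar> \<le> 1"
  then show "\<bar>expect p f - expect q f\<bar> \<le> 2"
    using abs_expect_le[of p f 1] abs_expect_le[of q f 1] by auto
qed

lemma tv_le_scaled:
  assumes "tv_le p q c" "\<And>x. \<bar>f x\<bar> \<le> M"
  shows "\<bar>expect p f - expect q f\<bar> \<le> M * c"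
proof (cases "M = 0")
  case True
  then have "f = (\<lambda>_. 0)" using assms(2) by auto
  then show ?thesis using True by simp
next
  case False
  have "0 \<le> M" using abs_ge_zero[of "f undefined"] assms(2)[of undefined] by linarith
  with False have M: "0 < M" by simp
  have "\<bar>expect p (\<lambda>x. f x / M) - expect q (\<lambda>x. f x / M)\<bar> \<le> c"
    by (rule tv_leD[OF assms(1)]) (use assms(2) M in auto)
  then have "\<bar>(expect p f - expect q f) / M\<bar> \<le> c"
    by (simp add: diff_divide_distrib)
  then show ?thesis using M by (simp add: abs_divide field_simps)
qed

lemma tv_le_map: "tv_le p q c \<Longrightarrow> tv_le (map_pmf g p) (map_pmf g q) c"
  by (simp add: tv_le_def)

lemma tv_dist_le:
  assumes "tv_le p q c"
  shows "tv_dist p q \<le> c"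
  unfolding tv_dist_def
proof (rule cSUP_least)
  fix A
  have "\<bar>expect p (indicator A) - expect q (indicator A)\<bar> \<le> c"
    by (rule tv_leD[OF assms]) (auto simp: indicator_def)
  then show "\<bar>measure_pmf.prob p A - measure_pmf.prob q A\<bar> \<le> c" by simp
qed simp

lemma tv_dist_nonneg: "0 \<le> tv_dist p q"
  unfolding tv_dist_def
proof (rule cSUP_upper2[where x = "{}"])
  have "\<bar>measure_pmf.prob p A - measure_pmf.prob q A\<bar> \<le> 1" for A
    using measure_pmf.prob_le_1[of p A] measure_pmf.prob_le_1[of q A]
      measure_nonneg[of "measure_pmf p" A] measure_nonneg[of "measure_pmf q" A] by linarith
  then show "bdd_above (range (\<lambda>A. \<bar>measure_pmf.prob p A - measure_pmf.prob q A\<bar>))"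
    by (intro bdd_aboveI[where M = 1]) auto
qed auto

section \<open>Convex combinations and components of a law\<close>

definition mix_pmf :: "real \<Rightarrow> 'a pmf \<Rightarrow> 'a pmf \<Rightarrow> 'a pmf" where
  "mix_pmf \<epsilon> p q = bind_pmf (bernoulli_pmf \<epsilon>) (\<lambda>b. if b then p else q)"

lemma expect_mix:
  assumes "0 \<le> \<epsilon>" "\<epsilon> \<le> 1" "\<And>x. \<bar>f x\<bar> \<le> M"
  shows "expect (mix_pmf \<epsilon> p q) f = \<epsilon> * expect p f + (1 - \<epsilon>) * expect q f"
  using assms(1,2) by (simp add: mix_pmf_def expect_bind[OF assms(3)])

lemma pmf_mix:
  assumes "0 \<le> \<epsilon>" "\<epsilon> \<le> 1"
  shows "pmf (mix_pmf \<epsilon> p q) x = \<epsilon> * pmf p x + (1 - \<epsilon>) * pmf q x"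
  using assms by (simp add: mix_pmf_def pmf_bind)

lemma map_mix: "map_pmf g (mix_pmf \<epsilon> p q) = mix_pmf \<epsilon> (map_pmf g p) (map_pmf g q)"
  unfolding mix_pmf_def map_bind_pmf by (rule bind_pmf_cong) auto

text \<open>Applied to projections: if the same component is removed with the same weight from two
  laws with equal marginals, the remainders have equal marginals.\<close>

lemma mix_pmf_cancel:
  assumes "0 < \<epsilon>" "\<epsilon> < 1" "mix_pmf \<epsilon> p q = mix_pmf \<epsilon> p q'"
  shows "q = q'"
proof (rule pmf_eqI)
  fix x
  show "pmf q x = pmf q' x"
    using arg_cong[OF assms(3), of "\<lambda>r. pmf r x"] assms(1,2) by (simp add: pmf_mix)
qed

lemma nn_integral_mix:
  assumes "0 \<le> \<epsilon>" "\<epsilon> \<le> 1"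
  shows "(\<integral>\<^sup>+x. f x \<partial>mix_pmf \<epsilon> p q)
    = ennreal \<epsilon> * (\<integral>\<^sup>+x. f x \<partial>p) + ennreal (1 - \<epsilon>) * (\<integral>\<^sup>+x. f x \<partial>q)"
  using assms by (simp add: mix_pmf_def mult.commute)

lemma set_mix:
  assumes "0 < \<epsilon>" "\<epsilon> < 1"
  shows "set_pmf (mix_pmf \<epsilon> p q) = set_pmf p \<union> set_pmf q"
  using assms by (auto simp: mix_pmf_def set_pmf_bernoulli split: if_splits)

text \<open>The normalised remainder has total mass 1 because its mass solves the affine equation
  obtained by summing over all points.\<close>

lemma ex_mix:
  assumes "0 < \<epsilon>" "\<epsilon> < 1" "\<And>x. \<epsilon> * pmf \<kappa> x \<le> pmf p x"
  shows "\<exists>\<eta>. p = mix_pmf \<epsilon> \<kappa> \<eta>"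
proof -
  define g where "g x = (pmf p x - \<epsilon> * pmf \<kappa> x) / (1 - \<epsilon>)" for x
  have g0: "0 \<le> g x" for x using assms by (simp add: g_def)
  have eq: "pmf p x = \<epsilon> * pmf \<kappa> x + (1 - \<epsilon>) * g x" for x
    using assms by (simp add: g_def)
  have "1 = (\<integral>\<^sup>+x. ennreal (pmf p x) \<partial>count_space UNIV)"
    by (simp add: nn_integral_pmf)
  also have "\<dots> = (\<integral>\<^sup>+x. ennreal \<epsilon> * ennreal (pmf \<kappa> x) + ennreal (1 - \<epsilon>) * ennreal (g x) \<partial>count_space UNIV)"
    using assms g0 by (intro nn_integral_cong) (simp add: eq ennreal_mult ennreal_plus)
  also have "\<dots> = ennreal \<epsilon> + ennreal (1 - \<epsilon>) * (\<integral>\<^sup>+x. ennreal (g x) \<partial>count_space UNIV)"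
    by (simp add: nn_integral_add nn_integral_cmult nn_integral_pmf)
  finally have *: "1 = ennreal \<epsilon> + ennreal (1 - \<epsilon>) * (\<integral>\<^sup>+x. ennreal (g x) \<partial>count_space UNIV)" .
  have "(\<integral>\<^sup>+x. ennreal (g x) \<partial>count_space UNIV) = 1"
  proof (cases "(\<integral>\<^sup>+x. ennreal (g x) \<partial>count_space UNIV)")
    case (real r)
    with * have "ennreal 1 = ennreal (\<epsilon> + (1 - \<epsilon>) * r)"
      using assms by (simp add: ennreal_mult' ennreal_plus)
    then have "1 = \<epsilon> + (1 - \<epsilon>) * r"
      using assms real by (subst (asm) ennreal_inj) auto
    then have "(1 - \<epsilon>) * (r - 1) = 0" by (simp add: algebra_simps)
    then show ?thesis using assms real by simp
  next
    case top
    with * assms show ?thesis by (simp add: ennreal_mult_top)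
  qed
  then have "pmf (embed_pmf g) x = g x" for x
    using g0 by (intro pmf_embed_pmf) auto
  then have "p = mix_pmf \<epsilon> \<kappa> (embed_pmf g)"
    using assms by (intro pmf_eqI) (simp add: pmf_mix eq)
  then show ?thesis ..
qed

lemma ex_mix_finite:
  assumes "finite (set_pmf \<kappa>)" "set_pmf \<kappa> \<subseteq> set_pmf p"
  shows "\<exists>\<epsilon>0>0. \<forall>\<epsilon>. 0 < \<epsilon> \<longrightarrow> \<epsilon> < \<epsilon>0 \<longrightarrow> (\<exists>\<eta>. p = mix_pmf \<epsilon> \<kappa> \<eta>)"
proof (intro exI[of _ "min 1 (Min (pmf p ` set_pmf \<kappa>))"] conjI allI impI)
  have pos: "0 < pmf p x" if "x \<in> set_pmf \<kappa>" for x
    using assms(2) that by (auto simp: pmf_positive)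
  then show "0 < min 1 (Min (pmf p ` set_pmf \<kappa>))"
    using assms(1) set_pmf_not_empty[of \<kappa>] by simp
  fix \<epsilon> :: real assume e: "0 < \<epsilon>" "\<epsilon> < min 1 (Min (pmf p ` set_pmf \<kappa>))"
  show "\<exists>\<eta>. p = mix_pmf \<epsilon> \<kappa> \<eta>"
  proof (rule ex_mix)
    fix x
    show "\<epsilon> * pmf \<kappa> x \<le> pmf p x"
    proof (cases "x \<in> set_pmf \<kappa>")
      case True
      then have "Min (pmf p ` set_pmf \<kappa>) \<le> pmf p x" using assms(1) by (intro Min_le) auto
      then have "\<epsilon> \<le> pmf p x" using e by linarith
      moreover have "\<epsilon> * pmf \<kappa> x \<le> \<epsilon> * 1" using e by (intro mult_left_mono) (auto simp: pmf_le_1)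
      ultimately show ?thesis by simp
    qed (simp add: set_pmf_iff)
  qed (use e in auto)
qed

lemma tv_le_mix:
  assumes "0 \<le> \<epsilon>" "\<epsilon> \<le> 1" "tv_le p p' c" "tv_le q q' d"
  shows "tv_le (mix_pmf \<epsilon> p q) (mix_pmf \<epsilon> p' q') (\<epsilon> * c + (1 - \<epsilon>) * d)"
  unfolding tv_le_def
proof (intro allI impI)
  fix f :: "'a \<Rightarrow> real" assume f: "\<forall>x. \<bar>f x\<bar> \<le> 1"
  have "expect (mix_pmf \<epsilon> p q) f - expect (mix_pmf \<epsilon> p' q') f
    = \<epsilon> * (expect p f - expect p' f) + (1 - \<epsilon>) * (expect q f - expect q' f)"
    using assms(1,2) f by (simp add: expect_mix[where M = 1] algebra_simps)
  also have "\<bar>\<dots>\<bar> \<le> \<epsilon> * \<bar>expect p f - expect p' f\<bar> + (1 - \<epsilon>) * \<bar>expect q f - expect q' f\<bar>"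
    using assms(1,2) by (intro order_trans[OF abs_triangle_ineq]) (simp add: abs_mult)
  also have "\<dots> \<le> \<epsilon> * c + (1 - \<epsilon>) * d"
    using assms f by (intro add_mono mult_left_mono) (auto intro: tv_leD)
  finally show "\<bar>expect (mix_pmf \<epsilon> p q) f - expect (mix_pmf \<epsilon> p' q') f\<bar> \<le> \<epsilon> * c + (1 - \<epsilon>) * d" .
qed

section \<open>Convolution powers on a group\<close>

context group
begin

abbreviation conv :: "'a pmf \<Rightarrow> 'a pmf \<Rightarrow> 'a pmf" (infixr "\<star>" 75) where
  "p \<star> q \<equiv> convolution G p q"

abbreviation cpow :: "'a pmf \<Rightarrow> nat \<Rightarrow> 'a pmf" (infixr "^\<star>" 80) where
  "p ^\<star> n \<equiv> conv_power G p n"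

definition supp_on :: "'a pmf \<Rightarrow> bool" where
  "supp_on p \<longleftrightarrow> set_pmf p \<subseteq> carrier G"

lemma supp_onD: "supp_on p \<Longrightarrow> x \<in> set_pmf p \<Longrightarrow> x \<in> carrier G"
  by (auto simp: supp_on_def)

lemma conv_bind: "p \<star> q = bind_pmf p (\<lambda>x. bind_pmf q (\<lambda>y. return_pmf (x \<otimes> y)))"
  by (simp add: convolution_def pair_pmf_def map_bind_pmf)

lemma set_conv: "set_pmf (p \<star> q) = (\<lambda>(x, y). x \<otimes> y) ` (set_pmf p \<times> set_pmf q)"
  by (simp add: convolution_def)

lemma supp_on_conv [simp, intro]: "supp_on p \<Longrightarrow> supp_on q \<Longrightarrow> supp_on (p \<star> q)"
  by (auto simp: supp_on_def set_conv)

lemma supp_on_return [simp]: "supp_on (return_pmf x) \<longleftrightarrow> x \<in> carrier G"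
  by (simp add: supp_on_def)

lemma supp_on_cpow [simp, intro]: "supp_on p \<Longrightarrow> supp_on (p ^\<star> n)"
  by (induction n) auto

lemma supp_on_mixD:
  "0 < \<epsilon> \<Longrightarrow> \<epsilon> < 1 \<Longrightarrow> supp_on (mix_pmf \<epsilon> p q) \<Longrightarrow> supp_on p \<and> supp_on q"
  by (auto simp: supp_on_def set_mix)

lemma conv_assoc:
  assumes "supp_on p" "supp_on q" "supp_on r"
  shows "(p \<star> q) \<star> r = p \<star> q \<star> r"
  unfolding conv_bind bind_assoc_pmf bind_return_pmf
  by (intro bind_pmf_cong refl) (use assms in \<open>auto simp: supp_on_def m_assoc subset_iff\<close>)

lemma conv_one_left [simp]: "supp_on p \<Longrightarrow> return_pmf \<one> \<star> p = p"
  unfolding conv_bind bind_return_pmf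
  by (subst (2) bind_return_pmf'[of p, symmetric], rule bind_pmf_cong) (auto simp: supp_on_def)

lemma conv_one_right [simp]: "supp_on p \<Longrightarrow> p \<star> return_pmf \<one> = p"
  unfolding conv_bind bind_return_pmf
  by (subst (2) bind_return_pmf'[of p, symmetric], rule bind_pmf_cong) (auto simp: supp_on_def)

lemma expect_conv:
  assumes "\<And>x. \<bar>f x\<bar> \<le> M"
  shows "expect (p \<star> q) f = expect p (\<lambda>x. expect q (\<lambda>y. f (x \<otimes> y)))"
  unfolding conv_bind by (simp add: expect_bind[OF assms])

lemma nn_integral_conv:
  "(\<integral>\<^sup>+x. f x \<partial>(p \<star> q)) = (\<integral>\<^sup>+x. \<integral>\<^sup>+y. f (x \<otimes> y) \<partial>q \<partial>p)"
  unfolding conv_bind by simp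

lemma conv_mix_left: "mix_pmf \<epsilon> p q \<star> r = mix_pmf \<epsilon> (p \<star> r) (q \<star> r)"
  unfolding conv_bind mix_pmf_def bind_assoc_pmf by (rule bind_pmf_cong) auto

lemma conv_mix_right: "r \<star> mix_pmf \<epsilon> p q = mix_pmf \<epsilon> (r \<star> p) (r \<star> q)"
  unfolding conv_bind mix_pmf_def bind_assoc_pmf
  by (subst bind_commute_pmf, rule bind_pmf_cong) auto

lemma tv_le_conv_left:
  assumes "tv_le q q' c"
  shows "tv_le (r \<star> q) (r \<star> q') c"
  unfolding tv_le_def
proof (intro allI impI)
  fix f :: "'a \<Rightarrow> real" assume f: "\<forall>x. \<bar>f x\<bar> \<le> 1"
  have int: "integrable (measure_pmf r) (\<lambda>x. expect s (\<lambda>y. f (x \<otimes> y)))" for s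
    by (rule integrable_pmf_bounded[where M = 1]) (use f in \<open>auto intro: abs_expect_le\<close>)
  have "\<bar>expect r (\<lambda>x. expect q (\<lambda>y. f (x \<otimes> y)) - expect q' (\<lambda>y. f (x \<otimes> y)))\<bar> \<le> c"
    by (rule abs_expect_le, rule tv_leD[OF assms]) (use f in auto)
  then show "\<bar>expect (r \<star> q) f - expect (r \<star> q') f\<bar> \<le> c"
    using f by (simp add: expect_conv[where M = 1] int)
qed

lemma tv_le_conv_right:
  assumes "tv_le q q' c"
  shows "tv_le (q \<star> r) (q' \<star> r) c"
  unfolding tv_le_def
proof (intro allI impI)
  fix f :: "'a \<Rightarrow> real" assume f: "\<forall>x. \<bar>f x\<bar> \<le> 1"
  show "\<bar>expect (q \<star> r) f - expect (q' \<star> r) f\<bar> \<le> c"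
    unfolding expect_conv[where M = 1, OF f[rule_format]]
    by (rule tv_leD[OF assms], rule abs_expect_le) (use f in auto)
qed

lemma cpow_one [simp]: "supp_on p \<Longrightarrow> p ^\<star> Suc 0 = p"
  by simp

lemma cpow_add:
  assumes "supp_on p"
  shows "p ^\<star> (m + n) = p ^\<star> m \<star> p ^\<star> n"
  by (induction n) (use assms in \<open>simp_all add: conv_assoc\<close>)

lemma cpow_Suc_left: "supp_on p \<Longrightarrow> p ^\<star> Suc n = p \<star> p ^\<star> n"
  using cpow_add[of p 1 n] by simp

lemma cpow_mult:
  assumes "supp_on p"
  shows "p ^\<star> (m * n) = (p ^\<star> m) ^\<star> n"
  by (induction n) (use assms in \<open>simp_all add: cpow_add add.commute[of m]\<close>)

lemma cpow_commute:
  assumes "supp_on b" "supp_on p" "b \<star> p = p \<star> b"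
  shows "b \<star> p ^\<star> n = p ^\<star> n \<star> b"
proof (induction n)
  case (Suc n)
  have "b \<star> p ^\<star> Suc n = (b \<star> p ^\<star> n) \<star> p"
    using assms(1,2) by (simp add: conv_assoc)
  also have "\<dots> = p ^\<star> n \<star> (b \<star> p)"
    using assms(1,2) by (simp add: Suc conv_assoc)
  finally show ?case
    using assms by (simp add: conv_assoc)
qed (use assms in auto)

end

text \<open>Jensen for the square reduces the claim to a rational inequality. The increment is only
  \<open>\<epsilon> / 2\<close>: convexity of \<open>1 / sqrt\<close> rules out the full increment
  for weights strictly between 0 and 1.\<close>

lemma inverse_sqrt_mixture:
  fixes y \<epsilon> :: real
  assumes "1 \<le> y" "0 \<le> \<epsilon>" "\<epsilon> \<le> 1"
  shows "\<epsilon> * sqrt (1 / (y + 1)) + (1 - \<epsilon>) * sqrt (1 / y) \<le> sqrt (1 / (y + \<epsilon> / 2))"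
proof (rule real_le_rsqrt)
  let ?u = "sqrt (1 / (y + 1))" and ?v = "sqrt (1 / y)"
  have "(\<epsilon> * u + (1 - \<epsilon>) * v)\<^sup>2 \<le> \<epsilon> * u\<^sup>2 + (1 - \<epsilon>) * v\<^sup>2" for u v :: real
  proof -
    have "0 \<le> \<epsilon> * (1 - \<epsilon>) * (u - v)\<^sup>2" using assms by simp
    then show ?thesis by (simp add: power2_eq_square algebra_simps)
  qed
  then have "(\<epsilon> * ?u + (1 - \<epsilon>) * ?v)\<^sup>2 \<le> \<epsilon> * ?u\<^sup>2 + (1 - \<epsilon>) * ?v\<^sup>2" .
  also have "\<dots> = (y + 1 - \<epsilon>) / (y * (y + 1))"
    using assms by (simp add: field_simps)
  also have "\<dots> \<le> 1 / (y + \<epsilon> / 2)"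
  proof -
    have "\<epsilon> * 1 \<le> \<epsilon> * y" using assms by (intro mult_left_mono) auto
    moreover have "0 \<le> \<epsilon> * \<epsilon>" using assms by simp
    moreover have "(y + 1 - \<epsilon>) * (y + \<epsilon> / 2) = y * (y + 1) - (\<epsilon> * y - \<epsilon> + \<epsilon> * \<epsilon>) / 2"
      by (simp add: field_simps)
    ultimately have "(y + 1 - \<epsilon>) * (y + \<epsilon> / 2) \<le> y * (y + 1)"
      by (simp only: diff_le_eq) simp
    then show ?thesis using assms by (simp add: divide_simps split: if_splits)
  qed
  finally show "(\<epsilon> * ?u + (1 - \<epsilon>) * ?v)\<^sup>2 \<le> 1 / (y + \<epsilon> / 2)" .
qed

text \<open>If \<open>b\<close> commutes with \<open>p\<close>, the number of factors \<open>b\<close> in \<open>p ^\<star> r\<close> is binomial, hence of order \<open>r\<close>.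
  The induction runs over \<open>b ^\<star> j \<star> p ^\<star> r\<close> for all \<open>j\<close> simultaneously; the bound is a
  supersolution of the resulting recursion.\<close>

lemma (in group) tv_le_smooth_mix:
  assumes "supp_on a" "supp_on b" "supp_on \<eta>" "p = mix_pmf \<epsilon> b \<eta>" "0 < \<epsilon>" "\<epsilon> < 1"
    and "b \<star> p = p \<star> b" "0 \<le> c"
    and "\<And>j. tv_le (a \<star> b ^\<star> j) (b ^\<star> j) (c * sqrt (1 / real (Suc j)))"
  shows "tv_le (a \<star> p ^\<star> r) (p ^\<star> r) (c * sqrt (2 / \<epsilon>) * sqrt (1 / real (Suc r)))"
proof -
  have p: "supp_on p" using assms by (auto simp: supp_on_def set_mix)
  note supp = p assms(1-3)
  have key: "tv_le (a \<star> b ^\<star> j \<star> p ^\<star> r) (b ^\<star> j \<star> p ^\<star> r) (c * sqrt (1 / (1 + real j + \<epsilon> * real r / 2)))" for j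
  proof (induction r arbitrary: j)
    case 0
    show ?case using assms(9)[of j] supp by (simp add: add.commute)
  next
    case (Suc r)
    let ?y = "1 + real j + \<epsilon> * real r / 2"
    \<comment> \<open>Condition on the last factor: a factor \<open>b\<close> commutes to the front
      and raises \<open>j\<close>, while \<open>\<eta>\<close> stays on the right and is dropped as
      a contraction.\<close>
    have e: "b ^\<star> j \<star> p ^\<star> Suc r = mix_pmf \<epsilon> (b ^\<star> Suc j \<star> p ^\<star> r) (b ^\<star> j \<star> p ^\<star> r \<star> \<eta>)"
    proof -
      have "b ^\<star> j \<star> p ^\<star> Suc r = mix_pmf \<epsilon> (b ^\<star> j \<star> (p ^\<star> r \<star> b)) (b ^\<star> j \<star> p ^\<star> r \<star> \<eta>)"
        by (simp add: conv_mix_right flip: assms(4)) (simp add: assms(4) conv_mix_right)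
      also have "p ^\<star> r \<star> b = b \<star> p ^\<star> r"
        using cpow_commute[of b p r] supp assms(7) by simp
      finally show ?thesis using supp by (simp add: conv_assoc)
    qed
    have 1: "tv_le (a \<star> b ^\<star> Suc j \<star> p ^\<star> r) (b ^\<star> Suc j \<star> p ^\<star> r) (c * sqrt (1 / (?y + 1)))"
      using Suc[of "Suc j"] by (simp add: algebra_simps)
    have 2: "tv_le (a \<star> b ^\<star> j \<star> p ^\<star> r \<star> \<eta>) (b ^\<star> j \<star> p ^\<star> r \<star> \<eta>) (c * sqrt (1 / ?y))"
      using tv_le_conv_right[OF Suc[of j], of \<eta>] supp by (simp add: conv_assoc)
    have "tv_le (a \<star> b ^\<star> j \<star> p ^\<star> Suc r) (b ^\<star> j \<star> p ^\<star> Suc r)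
        (\<epsilon> * (c * sqrt (1 / (?y + 1))) + (1 - \<epsilon>) * (c * sqrt (1 / ?y)))"
      unfolding e conv_mix_right by (rule tv_le_mix[OF _ _ 1 2]) (use assms in auto)
    also have "\<epsilon> * (c * sqrt (1 / (?y + 1))) + (1 - \<epsilon>) * (c * sqrt (1 / ?y))
      = c * (\<epsilon> * sqrt (1 / (?y + 1)) + (1 - \<epsilon>) * sqrt (1 / ?y))" by (simp add: algebra_simps)
    finally show ?case
    proof (rule tv_le_mono)
      have "\<epsilon> * sqrt (1 / (?y + 1)) + (1 - \<epsilon>) * sqrt (1 / ?y) \<le> sqrt (1 / (?y + \<epsilon> / 2))"
        by (rule inverse_sqrt_mixture) (use assms in auto)
      also have "?y + \<epsilon> / 2 = 1 + real j + \<epsilon> * real (Suc r) / 2" by (simp add: algebra_simps)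
      finally show "c * (\<epsilon> * sqrt (1 / (?y + 1)) + (1 - \<epsilon>) * sqrt (1 / ?y))
          \<le> c * sqrt (1 / (1 + real j + \<epsilon> * real (Suc r) / 2))"
        using assms by (intro mult_left_mono) auto
    qed
  qed
  show ?thesis
  proof (rule tv_le_mono)
    show "tv_le (a \<star> p ^\<star> r) (p ^\<star> r) (c * sqrt (1 / (1 + 0 + \<epsilon> * real r / 2)))"
      using key[of 0] supp by simp
    have "1 / (1 + 0 + \<epsilon> * real r / 2) \<le> 2 / \<epsilon> * (1 / real (Suc r))"
    proof -
      have "(1 + 0 + \<epsilon> * real r / 2) \<ge> \<epsilon> * real (Suc r) / 2"
        using assms by (simp add: algebra_simps)
      then have "1 / (1 + 0 + \<epsilon> * real r / 2) \<le> 1 / (\<epsilon> * real (Suc r) / 2)"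
        using assms by (intro divide_left_mono) (auto intro!: mult_pos_pos add_pos_nonneg)
      then show ?thesis by (simp add: field_simps)
    qed
    then have "sqrt (1 / (1 + 0 + \<epsilon> * real r / 2)) \<le> sqrt (2 / \<epsilon>) * sqrt (1 / real (Suc r))"
      unfolding real_sqrt_mult[symmetric] by (rule real_sqrt_le_mono)
    then show "c * sqrt (1 / (1 + 0 + \<epsilon> * real r / 2)) \<le> c * sqrt (2 / \<epsilon>) * sqrt (1 / real (Suc r))"
      using assms unfolding mult.assoc by (intro mult_left_mono)
  qed
qed

text \<open>Absorption identities turn the discrete derivative into the factor
  \<open>2 * (2 * i - n) / n\<close> against symmetric binomial weights with
  \<open>n = Suc j\<close>. The centred variable \<open>2 * i - n\<close> has standard deviation
  \<open>sqrt n\<close>, which gives the decay.\<close>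

lemma binomial_difference_le:
  fixes g :: "nat \<Rightarrow> real"
  assumes "\<And>i. \<bar>g i\<bar> \<le> 1"
  shows "\<bar>\<Sum>i\<le>j. real (j choose i) * (1 / 2) ^ j * (g (Suc i) - g i)\<bar> \<le> 2 * sqrt (1 / real (Suc j))"
proof -
  let ?n = "Suc j"
  \<comment> \<open>Bernstein polynomials at \<open>1 / 2\<close> are the binomial weights; their
    moment identities supply the mean and the variance.\<close>
  let ?B = "\<lambda>i. Bernstein ?n i (1 / 2)"
  have B: "?B i = real (?n choose i) * (1 / 2) ^ ?n" if "i \<le> ?n" for i
    using that by (simp add: Bernstein_def power_add[symmetric] mult.assoc del: power_Suc)
  have id1: "real ?n * real (j choose i) = real (Suc i) * real (?n choose Suc i)" for i
    using Suc_times_binomial[of i j] by (metis of_nat_mult)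
  have id2: "real ?n * real (j choose i) = (real ?n - real i) * real (?n choose i)" if "i \<le> j" for i
  proof -
    have "(?n - i) * (?n choose i) = ?n * (j choose i)"
      using binomial_absorb_comp[of ?n i] by simp
    then show ?thesis using that by (metis of_nat_diff of_nat_mult le_SucI)
  qed
  have "real ?n * (\<Sum>i\<le>j. real (j choose i) * (g (Suc i) - g i))
     = (\<Sum>i\<le>j. real ?n * real (j choose i) * g (Suc i)) - (\<Sum>i\<le>j. real ?n * real (j choose i) * g i)"
    by (simp add: sum_distrib_left sum_subtractf[symmetric] algebra_simps del: of_nat_Suc)
  also have "(\<Sum>i\<le>j. real ?n * real (j choose i) * g (Suc i))
     = (\<Sum>i\<le>j. real (Suc i) * real (?n choose Suc i) * g (Suc i))"
    by (simp only: id1)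
  also have "\<dots> = (\<Sum>i\<le>?n. real i * real (?n choose i) * g i)"
    unfolding sum.atMost_Suc_shift by simp
  also have "(\<Sum>i\<le>j. real ?n * real (j choose i) * g i) = (\<Sum>i\<le>j. (real ?n - real i) * real (?n choose i) * g i)"
    by (intro sum.cong refl) (simp only: id2 atMost_iff)
  also have "\<dots> = (\<Sum>i\<le>?n. (real ?n - real i) * real (?n choose i) * g i)"
    by simp
  also have "(\<Sum>i\<le>?n. real i * real (?n choose i) * g i) - \<dots>
      = (\<Sum>i\<le>?n. real (?n choose i) * (2 * real i - real ?n) * g i)"
    by (simp only: sum_subtractf[symmetric]) (intro sum.cong refl, simp add: algebra_simps)
  finally have "real ?n * (\<Sum>i\<le>j. real (j choose i) * (g (Suc i) - g i))
      = (\<Sum>i\<le>?n. real (?n choose i) * (2 * real i - real ?n) * g i)" .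
  note id3 = this
  have "(\<Sum>i\<le>j. real (j choose i) * (1 / 2) ^ j * (g (Suc i) - g i))
      = (1 / 2) ^ j * (\<Sum>i\<le>j. real (j choose i) * (g (Suc i) - g i))"
    unfolding sum_distrib_left by (intro sum.cong refl) simp
  also have "\<dots> = 2 / real ?n * ((1 / 2) ^ ?n * (real ?n * (\<Sum>i\<le>j. real (j choose i) * (g (Suc i) - g i))))"
    by simp
  also note id3
  also have "(1 / 2) ^ ?n * (\<Sum>i\<le>?n. real (?n choose i) * (2 * real i - real ?n) * g i)
      = (\<Sum>i\<le>?n. ?B i * ((2 * real i - real ?n) * g i))"
    unfolding sum_distrib_left by (intro sum.cong refl) (simp add: B del: of_nat_Suc)
  finally have eq: "(\<Sum>i\<le>j. real (j choose i) * (1 / 2) ^ j * (g (Suc i) - g i))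
      = 2 / real ?n * (\<Sum>i\<le>?n. ?B i * ((2 * real i - real ?n) * g i))" .
  let ?s = "sqrt (real ?n)"
  have B0: "0 \<le> ?B i" for i by (simp add: Bernstein_nonneg)
  have "\<bar>\<Sum>i\<le>?n. ?B i * ((2 * real i - real ?n) * g i)\<bar>
      \<le> (\<Sum>i\<le>?n. ?B i * (((2 * real i - real ?n)\<^sup>2 / ?s + ?s) / 2))"
  proof (rule order_trans[OF sum_abs], rule sum_mono)
    fix i
    define y where "y = 2 * real i - real ?n"
    have "\<bar>y * g i\<bar> \<le> \<bar>y\<bar>" using assms[of i] mult_left_mono[of "\<bar>g i\<bar>" 1 "\<bar>y\<bar>"] by (simp add: abs_mult)
    \<comment> \<open>Weighted AM-GM with weight \<open>sqrt n\<close> bounds the first absolute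
      moment by the second moment.\<close>
    also have "\<bar>y\<bar> \<le> (y\<^sup>2 / ?s + ?s) / 2"
    proof -
      have "0 \<le> (\<bar>y\<bar> - ?s)\<^sup>2" by simp
      then have "2 * \<bar>y\<bar> * ?s \<le> y\<^sup>2 + ?s * ?s" by (simp add: power2_eq_square algebra_simps)
      then have "2 * \<bar>y\<bar> * ?s / ?s \<le> (y\<^sup>2 + ?s * ?s) / ?s" by (intro divide_right_mono) auto
      moreover have "0 < ?s" by simp
      ultimately show ?thesis by (simp add: add_divide_distrib del: real_sqrt_mult_self)
    qed
    finally have "\<bar>y * g i\<bar> \<le> (y\<^sup>2 / ?s + ?s) / 2" .
    then have "?B i * \<bar>y * g i\<bar> \<le> ?B i * ((y\<^sup>2 / ?s + ?s) / 2)"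
      by (rule mult_left_mono[OF _ B0])
    moreover have "\<bar>?B i * (y * g i)\<bar> = ?B i * \<bar>y * g i\<bar>"
      using B0[of i] by (simp add: abs_mult)
    ultimately show "\<bar>?B i * ((2 * real i - real ?n) * g i)\<bar>
      \<le> ?B i * (((2 * real i - real ?n)\<^sup>2 / ?s + ?s) / 2)"
      unfolding y_def by linarith
  qed
  also have "\<dots> = ((\<Sum>i\<le>?n. ?B i * (2 * real i - real ?n)\<^sup>2) / ?s + ?s * (\<Sum>i\<le>?n. ?B i)) / 2"
    unfolding sum_divide_distrib sum_distrib_left sum.distrib[symmetric]
    by (intro sum.cong refl) (simp add: algebra_simps add_divide_distrib)
  also have "(\<Sum>i\<le>?n. ?B i * (2 * real i - real ?n)\<^sup>2) = real ?n"
  proof -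
    have "(\<Sum>i\<le>?n. ?B i * (2 * real i - real ?n)\<^sup>2)
      = 4 * (\<Sum>i\<le>?n. real i * (real i - 1) * ?B i) + (4 - 4 * real ?n) * (\<Sum>i\<le>?n. real i * ?B i)
        + (real ?n)\<^sup>2 * (\<Sum>i\<le>?n. ?B i)"
      unfolding sum_distrib_left sum.distrib[symmetric]
      by (intro sum.cong refl) (simp add: power2_eq_square algebra_simps)
    also have "\<dots> = real ?n"
      unfolding sum_Bernstein sum_k_Bernstein sum_kk_Bernstein
      by (simp add: power2_eq_square field_simps)
    finally show ?thesis .
  qed
  also have "(\<Sum>i\<le>?n. ?B i) = 1" by (rule sum_Bernstein)
  also have "(real ?n / ?s + ?s * 1) / 2 = ?s" by (simp add: real_div_sqrt)
  finally have "\<bar>\<Sum>i\<le>?n. ?B i * ((2 * real i - real ?n) * g i)\<bar> \<le> ?s" .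
  then have "2 / real ?n * \<bar>\<Sum>i\<le>?n. ?B i * ((2 * real i - real ?n) * g i)\<bar> \<le> 2 / real ?n * ?s"
    by (intro mult_left_mono) auto
  also have "2 / real ?n * ?s = 2 * sqrt (1 / real ?n)"
    using sqrt_divide_self_eq[of "real ?n"] by (simp add: real_sqrt_divide inverse_eq_divide del: of_nat_Suc)
  finally show ?thesis unfolding eq abs_mult by simp
qed

section \<open>Lazy walks along a single element\<close>

context group
begin

definition half_step :: "'a \<Rightarrow> 'a pmf" where
  "half_step a = mix_pmf (1 / 2) (return_pmf a) (return_pmf \<one>)"

lemma supp_on_half_step [simp]: "a \<in> carrier G \<Longrightarrow> supp_on (half_step a)"
  by (auto simp: half_step_def supp_on_def set_mix)

lemma half_step_cpow:
  assumes "a \<in> carrier G"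
  shows "half_step a ^\<star> j = map_pmf (\<lambda>i. a [^] i) (binomial_pmf j (1 / 2))"
proof (induction j)
  case 0
  show ?case by (simp add: binomial_pmf_0)
next
  case (Suc j)
  have "half_step a ^\<star> Suc j = bind_pmf (binomial_pmf j (1 / 2)) (\<lambda>k. bind_pmf (bernoulli_pmf (1 / 2))
      (\<lambda>b. return_pmf (a [^] ((if b then 1 else 0) + k))))"
    unfolding conv_power.simps Suc
    unfolding conv_bind half_step_def mix_pmf_def map_pmf_def bind_assoc_pmf bind_return_pmf
    by (intro bind_pmf_cong refl) (use assms in \<open>auto simp: bind_return_pmf\<close>)
  also have "\<dots> = map_pmf (\<lambda>i. a [^] i) (binomial_pmf (Suc j) (1 / 2))"
    by (subst bind_commute_pmf) (simp add: binomial_pmf_Suc map_bind_pmf)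
  finally show ?case .
qed

text \<open>The exponent of \<open>a\<close> is binomial and the extra factor \<open>a\<close>
  shifts it by one. Test functions are pulled back along the powers of \<open>a\<close>, so an
  element of finite order does no harm.\<close>

lemma tv_le_half_step:
  assumes "a \<in> carrier G"
  shows "tv_le (return_pmf a \<star> half_step a ^\<star> j) (half_step a ^\<star> j) (2 * sqrt (1 / real (Suc j)))"
  unfolding tv_le_def
proof (intro allI impI)
  fix f :: "'a \<Rightarrow> real" assume f: "\<forall>x. \<bar>f x\<bar> \<le> 1"
  define g where "g i = f (a [^] (i::nat))" for i
  have E: "expect (half_step a ^\<star> j) h = (\<Sum>i\<le>j. real (j choose i) * (1 / 2) ^ j * h (a [^] i))" for h
    unfolding half_step_cpow[OF assms] integral_map_pmf
    by (subst expectation_binomial_pmf') (auto simp: power_add[symmetric] mult.assoc intro!: sum.cong)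
  have "expect (return_pmf a \<star> half_step a ^\<star> j) f = (\<Sum>i\<le>j. real (j choose i) * (1 / 2) ^ j * g (Suc i))"
    using f assms by (simp add: expect_conv[where M = 1] E g_def nat_pow_Suc2[symmetric] del: nat_pow_Suc)
  moreover have "expect (half_step a ^\<star> j) f = (\<Sum>i\<le>j. real (j choose i) * (1 / 2) ^ j * g i)"
    by (simp add: E g_def)
  ultimately have "expect (return_pmf a \<star> half_step a ^\<star> j) f - expect (half_step a ^\<star> j) f
     = (\<Sum>i\<le>j. real (j choose i) * (1 / 2) ^ j * (g (Suc i) - g i))"
    by (simp add: sum_subtractf[symmetric] algebra_simps)
  also have "\<bar>\<dots>\<bar> \<le> 2 * sqrt (1 / real (Suc j))"
    by (rule binomial_difference_le) (use f in \<open>auto simp: g_def\<close>)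
  finally show "\<bar>expect (return_pmf a \<star> half_step a ^\<star> j) f - expect (half_step a ^\<star> j) f\<bar>
      \<le> 2 * sqrt (1 / real (Suc j))" .
qed

end

section \<open>Normal abelian subgroups of finite index\<close>

text \<open>\<open>rep\<close> chooses one element in each coset of \<open>N\<close>. The choice is
  not normalised: \<open>rep \<one>\<close> may differ from \<open>\<one>\<close>.\<close>

locale transversal = group G for G (structure) +
  fixes N :: "'a set" and rep :: "'a \<Rightarrow> 'a"
  assumes normal_N: "N \<lhd> G"
    and comm_N: "\<lbrakk>a \<in> N; b \<in> N\<rbrakk> \<Longrightarrow> a \<otimes> b = b \<otimes> a"
    and rep_closed [simp, intro]: "x \<in> carrier G \<Longrightarrow> rep x \<in> carrier G"
    and rep_quotient: "x \<in> carrier G \<Longrightarrow> x \<otimes> inv (rep x) \<in> N"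
    and rep_mult_N: "\<lbrakk>x \<in> carrier G; a \<in> N\<rbrakk> \<Longrightarrow> rep (a \<otimes> x) = rep x"
    and finite_rep: "finite (rep ` carrier G)"
begin

abbreviation T :: "'a set" where "T \<equiv> rep ` carrier G"

definition npart :: "'a \<Rightarrow> 'a" where "npart x = x \<otimes> inv (rep x)"

lemma subgroup_N: "subgroup N G"
  using normal_N by (rule normal_imp_subgroup)

lemma N_closed [simp]: "a \<in> N \<Longrightarrow> a \<in> carrier G"
  using subgroup.mem_carrier[OF subgroup_N] .

lemma N_mult [simp]: "a \<in> N \<Longrightarrow> b \<in> N \<Longrightarrow> a \<otimes> b \<in> N"
  using subgroup.m_closed[OF subgroup_N] .

lemma N_inv [simp]: "a \<in> N \<Longrightarrow> inv a \<in> N"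
  using subgroup.m_inv_closed[OF subgroup_N] .

lemma N_one [simp]: "\<one> \<in> N"
  using subgroup.one_closed[OF subgroup_N] .

lemma N_conj [simp]: "y \<in> carrier G \<Longrightarrow> a \<in> N \<Longrightarrow> y \<otimes> a \<otimes> inv y \<in> N"
  using normal_N unfolding normal_inv_iff by blast

lemma T_closed: "t \<in> T \<Longrightarrow> t \<in> carrier G"
  by auto

lemma T_nonempty: "T \<noteq> {}"
  using one_closed by blast

lemma npart_in_N [simp]: "x \<in> carrier G \<Longrightarrow> npart x \<in> N"
  by (simp add: npart_def rep_quotient)

lemma npart_rep [simp]: "x \<in> carrier G \<Longrightarrow> npart x \<otimes> rep x = x"
  by (simp add: npart_def m_assoc)

lemma rep_rep [simp]: "x \<in> carrier G \<Longrightarrow> rep (rep x) = rep x"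
  using rep_mult_N[of "rep x" "npart x"] by simp

lemma npart_T: "t \<in> T \<Longrightarrow> npart t = \<one>"
  by (auto simp: npart_def)

lemma rep_eqD:
  assumes "x \<in> carrier G" "y \<in> carrier G" "rep x = rep y"
  shows "x \<otimes> inv y \<in> N"
proof -
  have "x \<otimes> inv y = npart x \<otimes> inv (npart y)"
  proof -
    have "npart x \<otimes> inv (npart y) = (x \<otimes> inv (rep y)) \<otimes> (rep y \<otimes> inv y)"
      using assms(1,2) by (simp add: npart_def assms(3) inv_mult_group)
    also have "\<dots> = x \<otimes> ((inv (rep y) \<otimes> rep y) \<otimes> inv y)"
      using assms(1,2) by (simp only: m_assoc rep_closed inv_closed m_closed)
    finally show ?thesis using assms(1,2) by simp
  qed
  then show ?thesis using assms by simp
qed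

lemma rep_eqI:
  assumes "x \<in> carrier G" "y \<in> carrier G" "x \<otimes> inv y \<in> N"
  shows "rep x = rep y"
  using rep_mult_N[OF assms(2,3)] assms(1,2) by (simp add: m_assoc)

lemma bij_rep_right:
  assumes "x \<in> carrier G"
  shows "bij_betw (\<lambda>t. rep (t \<otimes> x)) T T"
proof -
  have "inj_on (\<lambda>t. rep (t \<otimes> x)) T"
  proof (rule inj_onI)
    fix t u assume tu: "t \<in> T" "u \<in> T" "rep (t \<otimes> x) = rep (u \<otimes> x)"
    have c: "t \<in> carrier G" "u \<in> carrier G" "rep t = t" "rep u = u" using tu by auto
    have "(t \<otimes> x) \<otimes> inv (u \<otimes> x) \<in> N"
      by (rule rep_eqD) (use tu c assms in auto)
    also have "(t \<otimes> x) \<otimes> inv (u \<otimes> x) = t \<otimes> ((x \<otimes> inv x) \<otimes> inv u)"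
      using c assms by (simp only: inv_mult_group m_assoc inv_closed m_closed)
    finally have "t \<otimes> inv u \<in> N" using c assms by simp
    then have "rep t = rep u" using c(1,2) by (intro rep_eqI) auto
    then show "t = u" using c by simp
  qed
  moreover have "(\<lambda>t. rep (t \<otimes> x)) ` T \<subseteq> T" using assms by auto
  ultimately show ?thesis using finite_rep by (simp add: bij_betw_def endo_inj_surj)
qed

text \<open>Here normality enters: left translation permutes the cosets of \<open>N\<close> because
  conjugation preserves \<open>N\<close>.\<close>

lemma bij_rep_left:
  assumes "x \<in> carrier G"
  shows "bij_betw (\<lambda>t. rep (x \<otimes> t)) T T"
proof -
  have "inj_on (\<lambda>t. rep (x \<otimes> t)) T"
  proof (rule inj_onI)
    fix t u assume tu: "t \<in> T" "u \<in> T" "rep (x \<otimes> t) = rep (x \<otimes> u)"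
    have c: "t \<in> carrier G" "u \<in> carrier G" "rep t = t" "rep u = u" using tu by auto
    have "(x \<otimes> t) \<otimes> inv (x \<otimes> u) \<in> N"
      by (rule rep_eqD) (use tu c assms in auto)
    then have "inv x \<otimes> ((x \<otimes> t) \<otimes> inv (x \<otimes> u)) \<otimes> inv (inv x) \<in> N"
      using assms by (intro N_conj) auto
    also have "inv x \<otimes> ((x \<otimes> t) \<otimes> inv (x \<otimes> u)) \<otimes> inv (inv x) = (inv x \<otimes> x) \<otimes> (t \<otimes> inv u) \<otimes> (inv x \<otimes> x)"
      using c assms by (simp only: inv_mult_group m_assoc inv_closed m_closed inv_inv)
    finally have "t \<otimes> inv u \<in> N" using c assms by simp
    then have "rep t = rep u" using c(1,2) by (intro rep_eqI) auto
    then show "t = u" using c by simp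
  qed
  moreover have "(\<lambda>t. rep (x \<otimes> t)) ` T \<subseteq> T" using assms by auto
  ultimately show ?thesis using finite_rep by (simp add: bij_betw_def endo_inj_surj)
qed

lemma rep_mult: "x \<in> carrier G \<Longrightarrow> y \<in> carrier G \<Longrightarrow> rep (x \<otimes> y) = rep (rep x \<otimes> y)"
  using rep_mult_N[of "rep x \<otimes> y" "npart x"] by (simp add: m_assoc[symmetric])

text \<open>Cocycle rule of the factorisation \<open>x = npart x \<otimes> rep x\<close>. Iterated
  along a word it produces Schreier generators of \<open>N\<close>; multiplied over all
  representatives it makes the transfer a homomorphism.\<close>

lemma npart_mult:
  assumes "x \<in> carrier G" "y \<in> carrier G"
  shows "npart (x \<otimes> y) = npart x \<otimes> npart (rep x \<otimes> y)"
proof -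
  have "npart x \<otimes> npart (rep x \<otimes> y) = (npart x \<otimes> rep x) \<otimes> y \<otimes> inv (rep (x \<otimes> y))"
    using assms unfolding rep_mult[OF assms]
    by (simp add: npart_def[of "rep x \<otimes> y"] m_assoc del: npart_rep)
  also have "\<dots> = npart (x \<otimes> y)" using assms by (simp add: npart_def[of "x \<otimes> y"])
  finally show ?thesis ..
qed

text \<open>\<open>N\<close> is abelian, so the \<open>N\<close>-part of \<open>y\<close> conjugates
  trivially. Hence an element of \<open>N\<close> has at most one conjugate per
  representative.\<close>

lemma conj_eq_rep:
  assumes "y \<in> carrier G" "a \<in> N"
  shows "y \<otimes> a \<otimes> inv y = rep y \<otimes> a \<otimes> inv (rep y)"
proof -
  have c: "npart y \<otimes> (rep y \<otimes> a \<otimes> inv (rep y)) = (rep y \<otimes> a \<otimes> inv (rep y)) \<otimes> npart y"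
    using assms by (intro comm_N) auto
  have "y \<otimes> a \<otimes> inv y = (npart y \<otimes> rep y) \<otimes> a \<otimes> inv (npart y \<otimes> rep y)"
    using assms by simp
  also have "\<dots> = (npart y \<otimes> (rep y \<otimes> a \<otimes> inv (rep y))) \<otimes> inv (npart y)"
    using assms by (simp add: inv_mult_group m_assoc del: npart_rep)
  also have "\<dots> = rep y \<otimes> a \<otimes> inv (rep y)"
    unfolding c using assms by (simp add: m_assoc del: npart_rep)
  finally show ?thesis .
qed

section \<open>The transfer into \<open>N\<close>\<close>

abbreviation NG :: "('a, 'b) monoid_scheme" where "NG \<equiv> G\<lparr>carrier := N\<rparr>"

lemma comm_group_NG: "comm_group NG"
  by (rule group.group_comm_groupI[OF subgroup.subgroup_is_group[OF subgroup_N is_group]])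
     (simp add: comm_N)

definition transfer :: "'a \<Rightarrow> 'a" where
  "transfer x = finprod NG (\<lambda>t. npart (t \<otimes> x)) T"

text \<open>The cocycle rule splits each factor, commutativity of \<open>N\<close> separates the two
  products, and right translation by \<open>x\<close> permutes the representatives in the second
  one.\<close>

lemma transfer_hom: "transfer \<in> hom G NG"
proof (rule homI)
  interpret NG: comm_group NG by (rule comm_group_NG)
  fix x assume x: "x \<in> carrier G"
  then show "transfer x \<in> carrier NG"
    unfolding transfer_def by (intro NG.finprod_closed) auto
  fix y assume y: "y \<in> carrier G"
  have "transfer (x \<otimes> y) = finprod NG (\<lambda>t. npart (t \<otimes> x) \<otimes>\<^bsub>NG\<^esub> npart (rep (t \<otimes> x) \<otimes> y)) T"
    unfolding transfer_def using x y
    by (intro NG.finprod_cong') (auto simp: npart_mult[symmetric] m_assoc[symmetric])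
  also have "\<dots> = transfer x \<otimes>\<^bsub>NG\<^esub> finprod NG (\<lambda>t. npart (rep (t \<otimes> x) \<otimes> y)) T"
    unfolding transfer_def using x y by (intro NG.finprod_multf) auto
  also have "finprod NG (\<lambda>t. npart (rep (t \<otimes> x) \<otimes> y)) T
      = finprod NG (\<lambda>t. npart (t \<otimes> y)) ((\<lambda>t. rep (t \<otimes> x)) ` T)"
    using bij_rep_right[OF x] y by (subst NG.finprod_reindex) (auto simp: bij_betw_def)
  also have "(\<lambda>t. rep (t \<otimes> x)) ` T = T"
    using bij_rep_right[OF x] by (simp add: bij_betw_def)
  finally show "transfer (x \<otimes> y) = transfer x \<otimes>\<^bsub>NG\<^esub> transfer y"
    by (simp only: transfer_def)
qed

end

text \<open>The normal core of the given subgroup is the kernel of the action on its cosets.\<close>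

lemma virtually_abelian_transversal:
  assumes "virtually_abelian G"
  shows "\<exists>N rep. transversal G N rep"
proof -
  interpret group G using assms by (simp add: virtually_abelian_def)
  obtain H where H: "subgroup H G" "comm_group (G\<lparr>carrier := H\<rparr>)" "finite (rcosets\<^bsub>G\<^esub> H)"
    using assms by (auto simp: virtually_abelian_def)
  let ?R = "rcosets\<^bsub>G\<^esub> H"
  have HG: "H \<subseteq> carrier G" using H(1) by (simp add: subgroup.subset)
  have R_sub: "C \<subseteq> carrier G" if "C \<in> ?R" for C
    using that HG by (auto simp: RCOSETS_def r_coset_def)
  have R_act: "C #>\<^bsub>G\<^esub> x \<in> ?R" if "C \<in> ?R" "x \<in> carrier G" for C x
  proof -
    obtain g where g: "g \<in> carrier G" "C = H #>\<^bsub>G\<^esub> g" using \<open>C \<in> ?R\<close> by (auto simp: RCOSETS_def)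
    then have "C #>\<^bsub>G\<^esub> x = H #>\<^bsub>G\<^esub> (g \<otimes>\<^bsub>G\<^esub> x)" using that HG by (simp add: coset_mult_assoc)
    then show ?thesis using that g HG by (simp add: rcosetsI)
  qed
  define N where "N = {x \<in> carrier G. \<forall>C \<in> ?R. C #>\<^bsub>G\<^esub> x = C}"
  \<comment> \<open>\<open>\<phi> x\<close> is the action of \<open>x\<close> on the cosets of
    \<open>H\<close>, restricted so that it lives in a finite space of extensional functions. Its
    fibres are the cosets of \<open>N\<close>, and \<open>rep\<close> picks a point in each.\<close>
  define \<phi> where "\<phi> x = (\<lambda>C \<in> ?R. C #>\<^bsub>G\<^esub> x)" for x
  define rep where "rep x = inv_into (carrier G) \<phi> (\<phi> x)" for x
  have subN: "subgroup N G"
  proof (rule subgroupI)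
    show "N \<subseteq> carrier G" by (auto simp: N_def)
    have "\<one>\<^bsub>G\<^esub> \<in> N" using R_sub by (simp add: N_def)
    then show "N \<noteq> {}" by blast
    fix a assume a: "a \<in> N"
    show "inv\<^bsub>G\<^esub> a \<in> N"
    proof -
      have "C #>\<^bsub>G\<^esub> inv\<^bsub>G\<^esub> a = C" if "C \<in> ?R" for C
      proof -
        have "C #>\<^bsub>G\<^esub> inv\<^bsub>G\<^esub> a = (C #>\<^bsub>G\<^esub> a) #>\<^bsub>G\<^esub> inv\<^bsub>G\<^esub> a" using a that by (simp add: N_def)
        also have "\<dots> = C #>\<^bsub>G\<^esub> (a \<otimes>\<^bsub>G\<^esub> inv\<^bsub>G\<^esub> a)"
          by (rule coset_mult_assoc) (use a R_sub[OF that] in \<open>auto simp: N_def\<close>)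
        also have "\<dots> = C" using a R_sub[OF that] by (simp add: N_def)
        finally show ?thesis .
      qed
      then show ?thesis using a by (simp add: N_def)
    qed
    fix b assume b: "b \<in> N"
    have "C #>\<^bsub>G\<^esub> (a \<otimes>\<^bsub>G\<^esub> b) = C" if "C \<in> ?R" for C
    proof -
      have "(C #>\<^bsub>G\<^esub> a) #>\<^bsub>G\<^esub> b = C #>\<^bsub>G\<^esub> (a \<otimes>\<^bsub>G\<^esub> b)"
        by (rule coset_mult_assoc) (use a b R_sub[OF that] in \<open>auto simp: N_def\<close>)
      then show ?thesis using a b that by (simp add: N_def)
    qed
    then show "a \<otimes>\<^bsub>G\<^esub> b \<in> N" using a b by (simp add: N_def)
  qed
  have norm: "N \<lhd> G"
    unfolding normal_inv_iff
  proof (intro conjI ballI subN)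
    fix x h assume x: "x \<in> carrier G" and h: "h \<in> N"
    have "C #>\<^bsub>G\<^esub> (x \<otimes>\<^bsub>G\<^esub> h \<otimes>\<^bsub>G\<^esub> inv\<^bsub>G\<^esub> x) = C" if C: "C \<in> ?R" for C
    proof -
      have "C #>\<^bsub>G\<^esub> (x \<otimes>\<^bsub>G\<^esub> h \<otimes>\<^bsub>G\<^esub> inv\<^bsub>G\<^esub> x) = ((C #>\<^bsub>G\<^esub> x) #>\<^bsub>G\<^esub> h) #>\<^bsub>G\<^esub> inv\<^bsub>G\<^esub> x"
        using x h R_sub[OF C] R_sub[OF R_act[OF C x]]
        by (simp only: coset_mult_assoc m_assoc N_def mem_Collect_eq m_closed inv_closed)
      also have "\<dots> = (C #>\<^bsub>G\<^esub> x) #>\<^bsub>G\<^esub> inv\<^bsub>G\<^esub> x"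
        using h R_act[OF C x] by (simp add: N_def)
      also have "\<dots> = C" using x R_sub[OF C] by (simp add: coset_mult_assoc)
      finally show ?thesis .
    qed
    then show "x \<otimes>\<^bsub>G\<^esub> h \<otimes>\<^bsub>G\<^esub> inv\<^bsub>G\<^esub> x \<in> N" using x h by (simp add: N_def)
  qed
  have H_R: "H \<in> ?R" using rcosetsI[OF HG one_closed] HG by simp
  \<comment> \<open>Fixing the coset \<open>H\<close> already forces an element into
    \<open>H\<close>, so \<open>N\<close> inherits commutativity.\<close>
  have N_H: "N \<subseteq> H"
  proof
    fix x assume x: "x \<in> N"
    then have "H #>\<^bsub>G\<^esub> x = H" using H_R by (simp add: N_def)
    moreover have "x \<in> H #>\<^bsub>G\<^esub> x" by (rule rcos_self[OF _ H(1)]) (use x in \<open>simp add: N_def\<close>)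
    ultimately show "x \<in> H" by simp
  qed
  have rep_in: "rep x \<in> carrier G" "\<phi> (rep x) = \<phi> x" if "x \<in> carrier G" for x
    unfolding rep_def using inv_into_into[of "\<phi> x" \<phi> "carrier G"] f_inv_into_f[of "\<phi> x" \<phi> "carrier G"] that
    by blast+
  have \<phi>_eq: "\<phi> x = \<phi> y \<longleftrightarrow> (\<forall>C\<in>?R. C #>\<^bsub>G\<^esub> x = C #>\<^bsub>G\<^esub> y)" for x y
  proof
    assume e: "\<phi> x = \<phi> y"
    show "\<forall>C\<in>?R. C #>\<^bsub>G\<^esub> x = C #>\<^bsub>G\<^esub> y"
    proof
      fix C assume "C \<in> ?R"
      then show "C #>\<^bsub>G\<^esub> x = C #>\<^bsub>G\<^esub> y" using fun_cong[OF e, of C] by (simp add: \<phi>_def)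
    qed
  next
    assume "\<forall>C\<in>?R. C #>\<^bsub>G\<^esub> x = C #>\<^bsub>G\<^esub> y"
    then show "\<phi> x = \<phi> y" unfolding \<phi>_def by (intro restrict_ext) blast
  qed
  have "transversal G N rep"
  proof (intro transversal.intro transversal_axioms.intro)
    show "Group.group G" by (rule is_group)
    show "N \<lhd> G" by (rule norm)
    show "a \<otimes>\<^bsub>G\<^esub> b = b \<otimes>\<^bsub>G\<^esub> a" if "a \<in> N" "b \<in> N" for a b
      using comm_groupE(4)[OF H(2), of a b] subsetD[OF N_H that(1)] subsetD[OF N_H that(2)] by simp
    fix x assume x: "x \<in> carrier G"
    show "rep x \<in> carrier G" by (rule rep_in[OF x])
    have "C #>\<^bsub>G\<^esub> (x \<otimes>\<^bsub>G\<^esub> inv\<^bsub>G\<^esub> rep x) = C" if C: "C \<in> ?R" for C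
    proof -
      have "C #>\<^bsub>G\<^esub> x = C #>\<^bsub>G\<^esub> rep x" using rep_in(2)[OF x] C by (auto simp: \<phi>_eq)
      moreover have "C #>\<^bsub>G\<^esub> (x \<otimes>\<^bsub>G\<^esub> inv\<^bsub>G\<^esub> rep x) = (C #>\<^bsub>G\<^esub> x) #>\<^bsub>G\<^esub> inv\<^bsub>G\<^esub> rep x"
        by (rule coset_mult_assoc[symmetric]) (use x rep_in[OF x] R_sub[OF C] in auto)
      moreover have "(C #>\<^bsub>G\<^esub> rep x) #>\<^bsub>G\<^esub> inv\<^bsub>G\<^esub> rep x = C #>\<^bsub>G\<^esub> (rep x \<otimes>\<^bsub>G\<^esub> inv\<^bsub>G\<^esub> rep x)"
        by (rule coset_mult_assoc) (use rep_in[OF x] R_sub[OF C] in auto)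
      ultimately show ?thesis using rep_in[OF x] R_sub[OF C] by simp
    qed
    then show "x \<otimes>\<^bsub>G\<^esub> inv\<^bsub>G\<^esub> rep x \<in> N" using x rep_in[OF x] by (simp add: N_def)
    fix a assume a: "a \<in> N"
    have "C #>\<^bsub>G\<^esub> (a \<otimes>\<^bsub>G\<^esub> x) = C #>\<^bsub>G\<^esub> x" if "C \<in> ?R" for C
    proof -
      have "(C #>\<^bsub>G\<^esub> a) #>\<^bsub>G\<^esub> x = C #>\<^bsub>G\<^esub> (a \<otimes>\<^bsub>G\<^esub> x)"
        by (rule coset_mult_assoc) (use a x R_sub[OF that] in \<open>auto simp: N_def\<close>)
      moreover have "C #>\<^bsub>G\<^esub> a = C" using a that by (simp add: N_def)
      ultimately show ?thesis by simp
    qed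
    then have "\<phi> (a \<otimes>\<^bsub>G\<^esub> x) = \<phi> x" by (simp add: \<phi>_eq)
    then show "rep (a \<otimes>\<^bsub>G\<^esub> x) = rep x" by (simp add: rep_def)
  next
    have "\<phi> ` carrier G \<subseteq> ?R \<rightarrow>\<^sub>E ?R"
      unfolding \<phi>_def by (intro image_subsetI restrict_PiE_iff[THEN iffD2] ballI R_act)
    then have "finite (\<phi> ` carrier G)" by (rule finite_subset) (rule finite_PiE[OF H(3)], rule H(3))
    then have "finite (inv_into (carrier G) \<phi> ` \<phi> ` carrier G)" by simp
    then show "finite (rep ` carrier G)" by (simp add: image_image rep_def)
  qed
  then show ?thesis by blast
qed

lemma DirProd_transversal:
  assumes "transversal G N rep" "transversal H M rep'"
  shows "transversal (G \<times>\<times> H) (N \<times> M) (map_prod rep rep')"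
proof -
  interpret A: transversal G N rep by fact
  interpret B: transversal H M rep' by fact
  have grp: "group (G \<times>\<times> H)" by (rule DirProd_group) (rule A.is_group B.is_group)+
  show ?thesis
  proof (intro transversal.intro grp transversal_axioms.intro)
    show "N \<times> M \<lhd> G \<times>\<times> H"
      unfolding group.normal_inv_iff[OF grp]
      using DirProd_subgroups[OF A.is_group A.subgroup_N B.is_group B.subgroup_N]
      by (auto simp: inv_DirProd[OF A.is_group B.is_group])
    have "map_prod rep rep' ` carrier (G \<times>\<times> H) \<subseteq> A.T \<times> B.T" by auto
    then show "finite (map_prod rep rep' ` carrier (G \<times>\<times> H))"
      using A.finite_rep B.finite_rep by (blast intro: finite_subset finite_cartesian_product)
    show "a \<otimes>\<^bsub>G \<times>\<times> H\<^esub> b = b \<otimes>\<^bsub>G \<times>\<times> H\<^esub> a" if "a \<in> N \<times> M" "b \<in> N \<times> M" for a b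
      using that A.comm_N[of "fst a" "fst b"] B.comm_N[of "snd a" "snd b"]
      by (auto simp: mult_DirProd')
    fix x assume x: "x \<in> carrier (G \<times>\<times> H)"
    then show "map_prod rep rep' x \<in> carrier (G \<times>\<times> H)" by auto
    from x obtain y z where yz: "x = (y, z)" "y \<in> carrier G" "z \<in> carrier H" by auto
    show "x \<otimes>\<^bsub>G \<times>\<times> H\<^esub> inv\<^bsub>G \<times>\<times> H\<^esub> map_prod rep rep' x \<in> N \<times> M"
      using A.rep_quotient B.rep_quotient yz by (simp add: inv_DirProd[OF A.is_group B.is_group])
    show "map_prod rep rep' (a \<otimes>\<^bsub>G \<times>\<times> H\<^esub> x) = map_prod rep rep' x" if "a \<in> N \<times> M" for a
      using that A.rep_mult_N[of y "fst a"] B.rep_mult_N[of z "snd a"] yz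
      by (auto simp: mult_DirProd')
  qed
qed

text \<open>Exact length and no inverse letters: smoothing will be known for translations by letters
  of \<open>S\<close>, a set that need not be closed under inversion. Where word length calls for
  inverses, \<open>sym_set\<close> adds them.\<close>

inductive word :: "('a, 'm) monoid_scheme \<Rightarrow> 'a set \<Rightarrow> nat \<Rightarrow> 'a \<Rightarrow> bool" for G (structure) and S where
  word_Nil: "word G S 0 \<one>"
| word_Cons: "s \<in> S \<Longrightarrow> word G S n a \<Longrightarrow> word G S (Suc n) (s \<otimes> a)"

text \<open>\<open>K\<close> is a submonoid containing the letters, on which \<open>f\<close> is
  multiplicative. This form covers homomorphisms as well as the embeddings of the two factors into
  the product.\<close>

lemma word_map:
  assumes "word G S n a" "f ` S \<subseteq> S'" "S \<subseteq> K"
    and "\<And>x y. x \<in> K \<Longrightarrow> y \<in> K \<Longrightarrow> f (x \<otimes>\<^bsub>G\<^esub> y) = f x \<otimes>\<^bsub>H\<^esub> f y" "f \<one>\<^bsub>G\<^esub> = \<one>\<^bsub>H\<^esub>"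
    and "\<And>x y. x \<in> K \<Longrightarrow> y \<in> K \<Longrightarrow> x \<otimes>\<^bsub>G\<^esub> y \<in> K" "\<one>\<^bsub>G\<^esub> \<in> K"
  shows "word H S' n (f a) \<and> a \<in> K"
  using assms(1)
proof induction
  case word_Nil
  then show ?case using assms by (auto intro: word.intros)
next
  case (word_Cons s n a)
  then have "s \<in> K" "f s \<in> S'" using assms by auto
  then show ?case using word_Cons assms by (auto intro: word.intros)
qed

context group
begin

lemma word_closed: "word G S n a \<Longrightarrow> S \<subseteq> carrier G \<Longrightarrow> a \<in> carrier G"
  by (induction rule: word.induct) auto

lemma word_mult:
  assumes "word G S n a" "word G S m b" "S \<subseteq> carrier G"
  shows "word G S (n + m) (a \<otimes> b)"
  using assms(1)
proof induction
  case word_Nil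
  then show ?case using assms word_closed[OF assms(2,3)] by simp
next
  case (word_Cons s n a)
  then have "(s \<otimes> a) \<otimes> b = s \<otimes> (a \<otimes> b)"
    using assms(3) word_closed[OF assms(2,3)] word_closed[OF word_Cons(2) assms(3)]
    by (intro m_assoc) auto
  then show ?case using word.word_Cons[OF word_Cons(1,3)] by simp
qed

lemma word_singleton: "s \<in> S \<Longrightarrow> S \<subseteq> carrier G \<Longrightarrow> word G S 1 s"
  using word_Cons[OF _ word_Nil, of s S G] by auto

lemma word_foldr: "word G S n a \<longleftrightarrow> (\<exists>ws. length ws = n \<and> set ws \<subseteq> S \<and> foldr (\<otimes>) ws \<one> = a)"
proof
  assume "word G S n a"
  then show "\<exists>ws. length ws = n \<and> set ws \<subseteq> S \<and> foldr (\<otimes>) ws \<one> = a"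
  proof induction
    case (word_Cons s n a)
    then obtain ws where "length ws = n" "set ws \<subseteq> S" "foldr (\<otimes>) ws \<one> = a" by auto
    then show ?case using word_Cons by (intro exI[of _ "s # ws"]) auto
  qed auto
next
  have "set ws \<subseteq> S \<Longrightarrow> word G S (length ws) (foldr (\<otimes>) ws \<one>)" for ws
    by (induction ws) (auto intro: word.intros)
  then show "\<exists>ws. length ws = n \<and> set ws \<subseteq> S \<and> foldr (\<otimes>) ws \<one> = a \<Longrightarrow> word G S n a" by auto
qed

abbreviation sym_set :: "'a set \<Rightarrow> 'a set" where "sym_set S \<equiv> S \<union> (\<lambda>s. inv s) ` S"

lemma word_inv:
  assumes "word G (sym_set S) n a" "S \<subseteq> carrier G"
  shows "word G (sym_set S) n (inv a)"
  using assms(1)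
proof induction
  case word_Nil
  then show ?case by (simp add: word.intros)
next
  case (word_Cons s n a)
  have S: "sym_set S \<subseteq> carrier G" using assms(2) by auto
  have "inv s \<in> sym_set S" using word_Cons(1) assms(2) by auto
  then have "word G (sym_set S) (n + 1) (inv a \<otimes> inv s)"
    by (intro word_mult[OF word_Cons(3) word_singleton S] S)
  moreover have "inv (s \<otimes> a) = inv a \<otimes> inv s"
    by (rule inv_mult_group) (use word_closed[OF word_Cons(2) S] word_Cons(1) S in auto)
  ultimately show ?case by simp
qed

lemma word_length_eq: "word_length G S g = (LEAST n. word G (sym_set S) n g)"
  unfolding word_length_def word_foldr ..

lemma ex_word:
  assumes "g \<in> generate G S" "S \<subseteq> carrier G"
  shows "\<exists>n. word G (sym_set S) n g"
proof -
  have S: "sym_set S \<subseteq> carrier G" using assms(2) by auto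
  show ?thesis
    using assms(1)
  proof induction
    case one
    show ?case by (rule exI, rule word_Nil)
  next
    case (incl h)
    then have "h \<in> sym_set S" by simp
    from word_singleton[OF this S] show ?case ..
  next
    case (inv h)
    then have "inv h \<in> sym_set S" by simp
    from word_singleton[OF this S] show ?case ..
  next
    case (eng h1 h2)
    then obtain n m where "word G (sym_set S) n h1" "word G (sym_set S) m h2" by auto
    from word_mult[OF this S] show ?case ..
  qed
qed

lemma word_word_length:
  assumes "g \<in> generate G S" "S \<subseteq> carrier G"
  shows "word G (sym_set S) (word_length G S g) g"
  unfolding word_length_eq using ex_word[OF assms] by (rule LeastI_ex)

lemma word_length_le: "word G (sym_set S) n g \<Longrightarrow> word_length G S g \<le> n"
  unfolding word_length_eq by (rule Least_le)

lemma word_length_mult: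
  assumes "S \<subseteq> carrier G" "generate G S = carrier G" "x \<in> carrier G" "y \<in> carrier G"
  shows "word_length G S (x \<otimes> y) \<le> word_length G S x + word_length G S y"
proof (rule word_length_le, rule word_mult)
  show "sym_set S \<subseteq> carrier G" using assms(1) by auto
qed (use assms in \<open>auto intro!: word_word_length\<close>)

lemma word_length_inv:
  assumes "S \<subseteq> carrier G" "generate G S = carrier G" "x \<in> carrier G"
  shows "word_length G S (inv x) \<le> word_length G S x"
  using assms by (intro word_length_le word_inv word_word_length) auto

end

text \<open>Reidemeister-Schreier: reading a word emits one factor
  \<open>npart (t \<otimes> s)\<close> per letter, so length in \<open>N\<close> is at most word
  length up to a constant. Closing these factors under conjugation keeps them finite in number, by
  \<open>conj_eq_rep\<close>.\<close>

lemma (in transversal) ex_conj_closed_generators: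
  assumes X: "finite X" "X \<subseteq> carrier G" "generate G X = carrier G"
  shows "\<exists>S C. finite S \<and> S \<subseteq> N \<and> (\<forall>y\<in>carrier G. \<forall>s\<in>S. y \<otimes> s \<otimes> inv y \<in> S) \<and>
    (\<forall>x\<in>carrier G. \<exists>n \<le> C + word_length G X x. word G S n (npart x))"
proof -
  define A where "A = (\<lambda>(t, x). npart (t \<otimes> x)) ` (T \<times> sym_set X)"
  have A: "finite A" "A \<subseteq> N" using X finite_rep by (auto simp: A_def)
  define S where "S = (\<lambda>(t, a). t \<otimes> a \<otimes> inv t) ` (T \<times> A)"
  have S: "finite S" "S \<subseteq> N" using A finite_rep by (auto simp: S_def)
  have conjS: "y \<otimes> a \<otimes> inv y \<in> S" if "y \<in> carrier G" "a \<in> A" for y a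
  proof -
    have "a \<in> N" using A(2) that(2) by auto
    from conj_eq_rep[OF that(1) this] show ?thesis
      unfolding S_def by (intro image_eqI[of _ _ "(rep y, a)"]) (use that in auto)
  qed
  have A_S: "A \<subseteq> S"
  proof
    fix a assume a: "a \<in> A"
    then have "a \<in> carrier G" using A(2) by auto
    then show "a \<in> S" using conjS[OF one_closed a] by simp
  qed
  have 1: "y \<otimes> s \<otimes> inv y \<in> S" if "y \<in> carrier G" "s \<in> S" for y s
  proof -
    obtain t a where ta: "t \<in> T" "a \<in> A" "s = t \<otimes> a \<otimes> inv t" using \<open>s \<in> S\<close> by (auto simp: S_def)
    have c: "t \<in> carrier G" "a \<in> carrier G" using ta A(2) by auto
    have "y \<otimes> s \<otimes> inv y = (y \<otimes> t) \<otimes> a \<otimes> inv (y \<otimes> t)"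
      unfolding ta(3) using that(1) c by (simp add: inv_mult_group m_assoc)
    then show ?thesis using conjS[OF m_closed[OF that(1) c(1)] ta(2)] by simp
  qed
  \<comment> \<open>The starting representative is arbitrary because each letter moves it.\<close>
  have 2: "t \<in> T \<Longrightarrow> word G S n (npart (t \<otimes> x))" if "word G (sym_set X) n x" for t x n
    using that
  proof (induction arbitrary: t)
    case word_Nil
    have "t \<otimes> \<one> = t" "npart t = \<one>" using T_closed[OF word_Nil] npart_T[OF word_Nil] by auto
    then show ?case using word.word_Nil by simp
  next
    case (word_Cons s n x)
    have X': "sym_set X \<subseteq> carrier G" using X by auto
    have s: "s \<in> carrier G" "x \<in> carrier G" "t \<in> carrier G"
      using word_Cons(1,4) X' word_closed[OF word_Cons(2) X'] by auto
    have "npart (t \<otimes> (s \<otimes> x)) = npart (t \<otimes> s) \<otimes> npart (rep (t \<otimes> s) \<otimes> x)"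
      using s by (simp add: npart_mult[symmetric] m_assoc)
    moreover have "npart (t \<otimes> s) \<in> A" unfolding A_def
      by (rule image_eqI[of _ _ "(t, s)"]) (use word_Cons(1,4) in auto)
    then have "npart (t \<otimes> s) \<in> S" using A_S by auto
    moreover have "rep (t \<otimes> s) \<in> T" using s by auto
    then have "word G S n (npart (rep (t \<otimes> s) \<otimes> x))" by (rule word_Cons(3))
    ultimately show ?case by (simp add: word.word_Cons)
  qed
  \<comment> \<open>Rewriting starts at a representative, whereas \<open>x\<close> is read from
    \<open>\<one>\<close>. Prefixing \<open>inv t0\<close> repairs this and costs the additive
    constant.\<close>
  define t0 where "t0 = rep \<one>"
  have t0: "t0 \<in> T" "t0 \<in> carrier G" by (auto simp: t0_def)
  have 3: "\<exists>n \<le> word_length G X (inv t0) + word_length G X x. word G S n (npart x)" if x: "x \<in> carrier G" for x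
  proof (intro exI conjI)
    show "word_length G X (inv t0 \<otimes> x) \<le> word_length G X (inv t0) + word_length G X x"
      by (rule word_length_mult[OF X(2,3)]) (use t0 x in auto)
    have "word G S (word_length G X (inv t0 \<otimes> x)) (npart (t0 \<otimes> (inv t0 \<otimes> x)))"
      by (rule 2[OF word_word_length t0(1)]) (use X t0 x in auto)
    then show "word G S (word_length G X (inv t0 \<otimes> x)) (npart x)"
      using t0 x by (simp add: m_assoc[symmetric])
  qed
  show ?thesis
    using S 1 3 by (intro exI[of _ S] exI[of _ "word_length G X (inv t0)"]) auto
qed

section \<open>Homomorphisms to the integers and the transfer\<close>

context comm_group
begin

text \<open>The value at \<open>s\<close> may be forced to be the fraction \<open>B / A\<close>;
  multiplying the function by \<open>A\<close> keeps it integral. \<open>compat\<close> says that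
  both prescriptions agree on the powers of \<open>s\<close> inside \<open>K\<close>.\<close>

lemma extend_additive_fn:
  fixes \<phi> :: "'a \<Rightarrow> int" and A B :: int
  assumes K: "subgroup K G" and s: "s \<in> carrier G"
    and add: "\<And>x y. x \<in> K \<Longrightarrow> y \<in> K \<Longrightarrow> \<phi> (x \<otimes> y) = \<phi> x + \<phi> y"
    and compat: "\<And>m::int. s [^] m \<in> K \<Longrightarrow> A * \<phi> (s [^] m) = m * B"
  shows "\<exists>K' \<phi>'. subgroup K' G \<and> insert s K \<subseteq> K' \<and>
    (\<forall>x\<in>K'. \<forall>y\<in>K'. \<phi>' (x \<otimes> y) = \<phi>' x + \<phi>' y) \<and> (\<forall>x\<in>K. \<phi>' x = A * \<phi> x) \<and> \<phi>' s = (B::int)"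
proof -
  have KG: "x \<in> carrier G" if "x \<in> K" for x using subgroup.mem_carrier[OF K that] .
  have K1: "\<one> \<in> K" using K by (rule subgroup.one_closed)
  have \<phi>1: "\<phi> \<one> = 0" using add[OF K1 K1] by simp
  define K' where "K' = {y. \<exists>k\<in>K. \<exists>i::int. y = k \<otimes> s [^] i}"
  define \<phi>' where "\<phi>' y = (SOME v. \<exists>k\<in>K. \<exists>i::int. y = k \<otimes> s [^] i \<and> v = A * \<phi> k + i * B)" for y
  have wd: "A * \<phi> k + i * B = A * \<phi> l + j * B"
    if "k \<in> K" "l \<in> K" "k \<otimes> s [^] i = l \<otimes> s [^] j" for k l and i j :: int
  proof -
    have c: "k \<in> carrier G" "l \<in> carrier G" using that KG by auto
    have "s [^] (i - j) = s [^] i \<otimes> inv (s [^] j)" using s by (rule int_pow_diff)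
    also have "s [^] i = inv k \<otimes> (l \<otimes> s [^] j)"
      using that(3) c s by (metis inv_solve_left int_pow_closed m_closed)
    also have "inv k \<otimes> (l \<otimes> s [^] j) \<otimes> inv (s [^] j) = inv k \<otimes> l"
      using c s by (simp add: m_assoc)
    finally have e: "s [^] (i - j) = inv k \<otimes> l" .
    then have inK: "s [^] (i - j) \<in> K"
      using that subgroup.m_inv_closed[OF K] subgroup.m_closed[OF K] by simp
    have "k \<otimes> s [^] (i - j) = l" unfolding e using c by (simp add: m_assoc[symmetric])
    then have "\<phi> l = \<phi> k + \<phi> (s [^] (i - j))" using add[OF that(1) inK] by simp
    then have "A * \<phi> l = A * \<phi> k + (i - j) * B" using compat[OF inK] by (simp add: distrib_left)
    then show ?thesis by (simp add: algebra_simps)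
  qed
  have \<phi>': "\<phi>' (k \<otimes> s [^] i) = A * \<phi> k + i * B" if "k \<in> K" for k and i :: int
    unfolding \<phi>'_def
  proof (rule someI2)
    show "\<exists>l\<in>K. \<exists>j. k \<otimes> s [^] i = l \<otimes> s [^] j \<and> A * \<phi> k + i * B = A * \<phi> l + j * B"
      using that by blast
  next
    fix v assume "\<exists>l\<in>K. \<exists>j. k \<otimes> s [^] i = l \<otimes> s [^] j \<and> v = A * \<phi> l + j * B"
    then obtain l j where "l \<in> K" "k \<otimes> s [^] i = l \<otimes> s [^] j" "v = A * \<phi> l + j * B" by blast
    then show "v = A * \<phi> k + i * B" using wd[OF that, of l i j] by simp
  qed
  have mult: "(k \<otimes> s [^] i) \<otimes> (l \<otimes> s [^] j) = (k \<otimes> l) \<otimes> s [^] (i + j)"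
    if "k \<in> K" "l \<in> K" for k l and i j :: int
    using that[THEN KG] s by (simp add: int_pow_mult m_ac)
  have K'I: "k \<otimes> s [^] i \<in> K'" if "k \<in> K" for k and i :: int using that by (auto simp: K'_def)
  show ?thesis
  proof (intro exI conjI ballI)
    show "subgroup K' G"
    proof (rule subgroupI)
      show "K' \<subseteq> carrier G" using s KG by (auto simp: K'_def)
      show "K' \<noteq> {}" using K'I[OF K1] by blast
      fix a assume "a \<in> K'"
      then obtain k i where a: "k \<in> K" "a = k \<otimes> s [^] (i::int)" by (auto simp: K'_def)
      have "inv a = inv k \<otimes> s [^] (- i)"
        using a KG s by (simp add: inv_mult int_pow_neg)
      then show "inv a \<in> K'" using K'I[OF subgroup.m_inv_closed[OF K a(1)]] by simp
      fix b assume "b \<in> K'"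
      then obtain l j where b: "l \<in> K" "b = l \<otimes> s [^] (j::int)" by (auto simp: K'_def)
      show "a \<otimes> b \<in> K'"
        unfolding a b mult[OF a(1) b(1)] by (rule K'I) (rule subgroup.m_closed[OF K a(1) b(1)])
    qed
    show "insert s K \<subseteq> K'"
    proof
      fix x assume "x \<in> insert s K"
      then show "x \<in> K'" using K'I[OF K1, of 1] K'I[of x 0] KG s by auto
    qed
    fix x y assume "x \<in> K'" "y \<in> K'"
    then obtain k i l j where "k \<in> K" "x = k \<otimes> s [^] (i::int)" "l \<in> K" "y = l \<otimes> s [^] (j::int)"
      by (auto simp: K'_def)
    then show "\<phi>' (x \<otimes> y) = \<phi>' x + \<phi>' y"
      by (simp add: mult \<phi>' subgroup.m_closed[OF K] add algebra_simps)
  next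
    fix x assume "x \<in> K"
    then show "\<phi>' x = A * \<phi> x" using \<phi>'[of x 0] KG by simp
  next
    show "\<phi>' s = B" using \<phi>'[OF K1, of 1] s \<phi>1 by simp
  qed
qed

lemma additive_fn_int_pow:
  fixes \<phi> :: "'a \<Rightarrow> int"
  assumes "subgroup K G" "\<And>x y. x \<in> K \<Longrightarrow> y \<in> K \<Longrightarrow> \<phi> (x \<otimes> y) = \<phi> x + \<phi> y" "x \<in> K"
  shows "\<phi> (x [^] (n::int)) = n * \<phi> x"
proof -
  have e: "x [^] n = x [^]\<^bsub>G\<lparr>carrier := K\<rparr>\<^esub> n" by (rule int_pow_consistent[OF assms(1,3)])
  interpret group_hom "G\<lparr>carrier := K\<rparr>" integer_group \<phi>
    using assms(2) by (intro group_hom.intro group_hom_axioms.intro homI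
        subgroup.subgroup_is_group[OF assms(1) is_group]) auto
  show ?thesis unfolding e using hom_int_pow[of x n] assms(3) by simp
qed

text \<open>Elementary form of the injectivity of the rationals: \<open>b\<close> is sent to 1 and
  the elements of \<open>Y\<close> are adjoined one by one, clearing denominators. All multipliers
  are nonzero, so the value at \<open>b\<close> survives.\<close>

lemma ex_additive_fn:
  assumes "finite Y" "Y \<subseteq> carrier G" "b \<in> carrier G" "\<And>k::nat. 0 < k \<Longrightarrow> b [^] k \<noteq> \<one>"
  shows "\<exists>K (\<phi> :: 'a \<Rightarrow> int). subgroup K G \<and> insert b Y \<subseteq> K \<and>
    (\<forall>x\<in>K. \<forall>y\<in>K. \<phi> (x \<otimes> y) = \<phi> x + \<phi> y) \<and> \<phi> b \<noteq> 0"
  using assms(1,2)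
proof induction
  case empty
  have "m = 0" if "b [^] m \<in> {\<one>}" for m :: int
  proof (rule ccontr)
    assume "m \<noteq> 0"
    then have "0 < nat \<bar>m\<bar>" by simp
    moreover have "b [^] nat \<bar>m\<bar> = \<one>"
    proof (cases "0 \<le> m")
      case True
      then have "b [^] nat \<bar>m\<bar> = b [^] m" by (simp add: int_pow_int[symmetric])
      then show ?thesis using that by simp
    next
      case False
      then have "b [^] nat \<bar>m\<bar> = b [^] (- m)" by (simp add: int_pow_int[symmetric])
      then show ?thesis using that assms(3) by (simp add: int_pow_neg)
    qed
    ultimately show False using assms(4) by blast
  qed
  then have "\<exists>K' (\<phi>' :: 'a \<Rightarrow> int). subgroup K' G \<and> insert b {\<one>} \<subseteq> K' \<and>
    (\<forall>x\<in>K'. \<forall>y\<in>K'. \<phi>' (x \<otimes> y) = \<phi>' x + \<phi>' y) \<and> (\<forall>x\<in>{\<one>}. \<phi>' x = 1 * 0) \<and> \<phi>' b = 1"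
    by (intro extend_additive_fn assms triv_subgroup) auto
  then obtain K and \<phi> :: "'a \<Rightarrow> int" where "subgroup K G" "insert b {\<one>} \<subseteq> K"
    "\<forall>x\<in>K. \<forall>y\<in>K. \<phi> (x \<otimes> y) = \<phi> x + \<phi> y" "\<phi> b = 1" by blast
  then show ?case by (intro exI[of _ K] exI[of _ \<phi>]) auto
next
  case (insert s Y)
  then obtain K and \<phi> :: "'a \<Rightarrow> int" where K: "subgroup K G" "insert b Y \<subseteq> K"
    and add: "\<And>x y. x \<in> K \<Longrightarrow> y \<in> K \<Longrightarrow> \<phi> (x \<otimes> y) = \<phi> x + \<phi> y" and b: "\<phi> b \<noteq> 0"
    by (metis insert_subset)
  have s: "s \<in> carrier G" using insert by simp
  \<comment> \<open>Either a nonzero power \<open>s [^] j\<close> lies in \<open>K\<close>, which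
    dictates \<open>A = j\<close> and \<open>B = \<phi> (s [^] j)\<close>, or the value at
    \<open>s\<close> is free and 0 is taken.\<close>
  have "\<exists>A B. A \<noteq> 0 \<and> (\<forall>m::int. s [^] m \<in> K \<longrightarrow> A * \<phi> (s [^] m) = m * B)"
  proof (cases "\<exists>j::int. j \<noteq> 0 \<and> s [^] j \<in> K")
    case True
    then obtain j :: int where j: "j \<noteq> 0" "s [^] j \<in> K" by blast
    have "j * \<phi> (s [^] m) = m * \<phi> (s [^] j)" if "s [^] m \<in> K" for m :: int
    proof -
      have "j * \<phi> (s [^] m) = \<phi> ((s [^] m) [^] j)"
        using additive_fn_int_pow[OF K(1) add that] by simp
      also have "(s [^] m) [^] j = (s [^] j) [^] m" using s by (simp add: int_pow_pow mult.commute)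
      also have "\<phi> \<dots> = m * \<phi> (s [^] j)" using additive_fn_int_pow[OF K(1) add j(2)] by simp
      finally show ?thesis .
    qed
    with j show ?thesis by blast
  next
    case False
    have "\<phi> \<one> = 0" using add[of \<one> \<one>] subgroup.one_closed[OF K(1)] by simp
    then have "1 * \<phi> (s [^] m) = m * 0" if "s [^] m \<in> K" for m :: int
      using False that by (cases "m = 0") auto
    then show ?thesis by (intro exI[of _ 1] exI[of _ 0]) auto
  qed
  then obtain A B where A: "A \<noteq> 0" "\<And>m::int. s [^] m \<in> K \<Longrightarrow> A * \<phi> (s [^] m) = m * B" by blast
  obtain K' \<phi>' where K': "subgroup K' G" "insert s K \<subseteq> K'" 
    "\<forall>x\<in>K'. \<forall>y\<in>K'. \<phi>' (x \<otimes> y) = \<phi>' x + \<phi>' y" "\<forall>x\<in>K. \<phi>' x = A * \<phi> x"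
    using extend_additive_fn[OF K(1) s add A(2)] by blast
  then show ?case using K(2) b A(1) by (intro exI[of _ K'] exI[of _ \<phi>']) auto
qed

end

text \<open>The image consists of the multiples of its least positive value \<open>d\<close>;
  division by \<open>d\<close> makes the homomorphism onto.\<close>

lemma epi_of_nonzero_hom:
  assumes "group G" "h \<in> hom G integer_group" "x \<in> carrier G" "h x \<noteq> 0"
  shows "\<exists>h'. h' \<in> epi G integer_group"
proof -
  interpret group_hom G integer_group h
    using assms by (intro group_hom.intro group_hom_axioms.intro) auto
  have pow: "h (y [^]\<^bsub>G\<^esub> (n::int)) = n * h y" if "y \<in> carrier G" for y n
    using hom_int_pow[OF that, of n] by simp
  have add: "h (y \<otimes>\<^bsub>G\<^esub> z) = h y + h z" if "y \<in> carrier G" "z \<in> carrier G" for y z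
    using hom_mult[OF that] by simp
  define P where "P n \<longleftrightarrow> 0 < n \<and> (\<exists>g\<in>carrier G. h g = int n)" for n
  have "P (nat \<bar>h x\<bar>)"
  proof (cases "0 < h x")
    case True
    then show ?thesis using assms(3) by (auto simp: P_def)
  next
    case False
    then have "h (x [^]\<^bsub>G\<^esub> (-1::int)) = int (nat \<bar>h x\<bar>)" using pow[OF assms(3), of "-1"] assms(4) by simp
    moreover have "x [^]\<^bsub>G\<^esub> (-1::int) \<in> carrier G" using assms(3) by (rule G.int_pow_closed)
    ultimately show ?thesis using assms(4) unfolding P_def by fastforce
  qed
  then have d: "P (LEAST n. P n)" by (rule LeastI)
  define d where "d = int (LEAST n. P n)"
  obtain g where g: "g \<in> carrier G" "h g = d" and dpos: "0 < d" using d by (auto simp: P_def d_def)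
  have dvd: "d dvd h y" if y: "y \<in> carrier G" for y
  proof -
    define r where "r = h y mod d"
    have r: "0 \<le> r" "r < d" using dpos by (auto simp: r_def)
    have "h (y \<otimes>\<^bsub>G\<^esub> g [^]\<^bsub>G\<^esub> (- (h y div d))) = h y - (h y div d) * d"
      using y g pow add by simp
    also have "\<dots> = r" by (simp add: r_def minus_div_mult_eq_mod)
    finally have e: "h (y \<otimes>\<^bsub>G\<^esub> g [^]\<^bsub>G\<^esub> (- (h y div d))) = r" .
    have "\<not> P (nat r)"
    proof (rule not_less_Least)
      show "nat r < (LEAST n. P n)" using r by (simp add: d_def)
    qed
    moreover have "y \<otimes>\<^bsub>G\<^esub> g [^]\<^bsub>G\<^esub> (- (h y div d)) \<in> carrier G" using y g(1) by simp
    ultimately have "\<not> 0 < r" using e r(1) unfolding P_def by (metis nat_0_le zero_less_nat_eq)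
    then have "r = 0" using r(1) by simp
    then show ?thesis by (simp add: r_def dvd_eq_mod_eq_0)
  qed
  have "(\<lambda>y. h y div d) \<in> epi G integer_group"
    unfolding epi_def mem_Collect_eq
  proof
    show "(\<lambda>y. h y div d) \<in> hom G integer_group"
      by (rule homI) (use dvd add in \<open>auto simp: div_plus_div_distrib_dvd_left\<close>)
    have "n \<in> (\<lambda>y. h y div d) ` carrier G" for n
      by (rule image_eqI[of _ _ "g [^]\<^bsub>G\<^esub> n"]) (use g pow dpos in auto)
    then show "(\<lambda>y. h y div d) ` carrier G = carrier integer_group" by auto
  qed
  then show ?thesis by blast
qed

text \<open>A finitely generated group without epimorphism onto the integers has only finite abelian
  images, because an element of infinite order in such an image is detected by a rational-valued
  homomorphism.\<close>

lemma hom_torsion_of_no_epi: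
  assumes "finitely_generated_group G" "\<not> (\<exists>h. h \<in> epi G integer_group)"
    and "comm_group H" "V \<in> hom G H"
  shows "\<exists>k>0. \<forall>x\<in>carrier G. V x [^]\<^bsub>H\<^esub> (k::nat) = \<one>\<^bsub>H\<^esub>"
proof -
  interpret H: comm_group H by fact
  interpret G: group G using assms(1) by (simp add: finitely_generated_group_def)
  interpret V: group_hom G H V
    using assms by (intro group_hom.intro group_hom_axioms.intro G.is_group H.is_group)
  obtain X where X: "finite X" "X \<subseteq> carrier G" "generate G X = carrier G"
    using assms(1) by (auto simp: finitely_generated_group_def)
  have fin: "\<exists>k>0. V x [^]\<^bsub>H\<^esub> (k::nat) = \<one>\<^bsub>H\<^esub>" if x: "x \<in> X" for x
  proof (rule ccontr)
    assume no: "\<not> ?thesis"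
    have "\<exists>K (\<phi> :: _ \<Rightarrow> int). subgroup K H \<and> insert (V x) (V ` X) \<subseteq> K \<and>
      (\<forall>x\<in>K. \<forall>y\<in>K. \<phi> (x \<otimes>\<^bsub>H\<^esub> y) = \<phi> x + \<phi> y) \<and> \<phi> (V x) \<noteq> 0"
    proof (rule H.ex_additive_fn)
      show "finite (V ` X)" using X by simp
      show "V ` X \<subseteq> carrier H" "V x \<in> carrier H" using X x by auto
      show "V x [^]\<^bsub>H\<^esub> k \<noteq> \<one>\<^bsub>H\<^esub>" if "0 < k" for k :: nat using no that by blast
    qed
    then obtain K and \<phi> :: "_ \<Rightarrow> int" where K: "subgroup K H" "insert (V x) (V ` X) \<subseteq> K"
      and add: "\<And>x y. x \<in> K \<Longrightarrow> y \<in> K \<Longrightarrow> \<phi> (x \<otimes>\<^bsub>H\<^esub> y) = \<phi> x + \<phi> y" and nz: "\<phi> (V x) \<noteq> 0"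
      by blast
    \<comment> \<open>\<open>\<phi>\<close> is additive only on \<open>K\<close>. As
      \<open>K\<close> contains the images of the generators, it contains the whole image of
      \<open>V\<close>.\<close>
    have VK: "V y \<in> K" if "y \<in> generate G X" for y
      using that
    proof induction
      case one
      then show ?case using subgroup.one_closed[OF K(1)] by simp
    next
      case (incl h)
      then show ?case using K(2) by auto
    next
      case (inv h)
      then have "V h \<in> K" "h \<in> carrier G" using K(2) X by auto
      then show ?case using subgroup.m_inv_closed[OF K(1)] by simp
    next
      case (eng h1 h2)
      then have "h1 \<in> carrier G" "h2 \<in> carrier G" using X by auto
      then show ?case using eng subgroup.m_closed[OF K(1)] by simp
    qed
    have "(\<lambda>y. \<phi> (V y)) \<in> hom G integer_group"
      by (rule homI) (use VK X add in auto)
    moreover have "x \<in> carrier G" using x X by auto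
    ultimately show False
      using epi_of_nonzero_hom[OF G.is_group, of "\<lambda>y. \<phi> (V y)" x] nz assms(2) by blast
  qed
  then have "\<exists>k. \<forall>x\<in>X. k x > 0 \<and> V x [^]\<^bsub>H\<^esub> (k x :: nat) = \<one>\<^bsub>H\<^esub>" by (intro bchoice ballI)
  then obtain k where k: "\<And>x. x \<in> X \<Longrightarrow> k x > 0 \<and> V x [^]\<^bsub>H\<^esub> (k x :: nat) = \<one>\<^bsub>H\<^esub>" by blast
  \<comment> \<open>A common multiple of the exponents at the generators; commutativity of
    \<open>H\<close> carries it over to products.\<close>
  define e where "e = prod k X"
  have gen: "V x [^]\<^bsub>H\<^esub> e = \<one>\<^bsub>H\<^esub>" if x: "x \<in> X" for x
  proof -
    have "e = k x * prod k (X - {x})" using x X(1) by (simp add: e_def prod.remove)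
    moreover have "V x \<in> carrier H" using x X by auto
    ultimately show ?thesis using k[OF x] by (simp add: H.nat_pow_pow[symmetric])
  qed
  have "V y [^]\<^bsub>H\<^esub> e = \<one>\<^bsub>H\<^esub>" if "y \<in> generate G X" for y
    using that
  proof induction
    case (inv h)
    then have "h \<in> carrier G" using X by auto
    then show ?case using gen[OF inv] by (simp add: H.nat_pow_inv)
  next
    case (eng h1 h2)
    then have "h1 \<in> carrier G" "h2 \<in> carrier G" using X by auto
    then show ?case using eng by (simp add: H.nat_pow_distrib)
  qed (use gen in auto)
  moreover have "e > 0" using k X(1) by (simp add: e_def prod_pos)
  ultimately show ?thesis using X(3) by auto
qed

lemma (in transversal) transfer_torsion:
  assumes "finitely_generated_group G" "\<not> (\<exists>h. h \<in> epi G integer_group)"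
  shows "\<exists>k>0. \<forall>x\<in>carrier G. transfer x [^]\<^bsub>NG\<^esub> (k::nat) = \<one>"
  using hom_torsion_of_no_epi[OF assms comm_group_NG transfer_hom] by simp

section \<open>Smoothing\<close>

context group
begin

lemma conv_commute:
  assumes "\<And>x y. x \<in> set_pmf p \<Longrightarrow> y \<in> set_pmf q \<Longrightarrow> x \<otimes> y = y \<otimes> x"
  shows "p \<star> q = q \<star> p"
proof -
  have "p \<star> q = bind_pmf p (\<lambda>x. bind_pmf q (\<lambda>y. return_pmf (y \<otimes> x)))"
    unfolding conv_bind by (intro bind_pmf_cong refl arg_cong[where f = return_pmf] assms)
  also have "\<dots> = q \<star> p" unfolding conv_bind by (rule bind_commute_pmf)
  finally show ?thesis .
qed

text \<open>Conjugation by \<open>x\<close> permutes \<open>S\<close>, so for uniform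
  \<open>s\<close> the products \<open>x \<otimes> s\<close> and \<open>s \<otimes> x\<close> have
  the same law.\<close>

lemma conv_pmf_of_set_commute:
  assumes S: "finite S" "S \<noteq> {}" "S \<subseteq> carrier G" and p: "supp_on p"
    and conj: "\<And>y s. y \<in> carrier G \<Longrightarrow> s \<in> S \<Longrightarrow> y \<otimes> s \<otimes> inv y \<in> S"
  shows "pmf_of_set S \<star> p = p \<star> pmf_of_set S"
proof -
  have eq: "map_pmf (\<lambda>s. x \<otimes> s) (pmf_of_set S) = map_pmf (\<lambda>s. s \<otimes> x) (pmf_of_set S)"
    if x: "x \<in> carrier G" for x
  proof -
    have "inj_on (\<lambda>s. x \<otimes> s) S"
      using x S(3) by (intro inj_on_subset[OF _ S(3)] inj_on_cmult)
    moreover have "inj_on (\<lambda>s. s \<otimes> x) S"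
      using x S(3) by (intro inj_on_subset[OF _ S(3)] inj_on_multc)
    moreover have "(\<lambda>s. x \<otimes> s) ` S = (\<lambda>s. s \<otimes> x) ` S"
    proof (intro equalityI image_subsetI)
      fix s assume s: "s \<in> S"
      then have sc: "s \<in> carrier G" using S by auto
      have "x \<otimes> s = (x \<otimes> s \<otimes> inv x) \<otimes> x" using x sc by (simp add: m_assoc)
      then show "x \<otimes> s \<in> (\<lambda>s. s \<otimes> x) ` S" using conj[OF x s] by blast
      have "s \<otimes> x = x \<otimes> (inv x \<otimes> s \<otimes> inv (inv x))" using x sc by (simp add: m_assoc[symmetric])
      then show "s \<otimes> x \<in> (\<lambda>s. x \<otimes> s) ` S" using conj[OF inv_closed[OF x] s] by blast
    qed
    ultimately show ?thesis using S by (simp add: map_pmf_of_set_inj)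
  qed
  have "p \<star> pmf_of_set S = bind_pmf p (\<lambda>x. map_pmf (\<lambda>s. x \<otimes> s) (pmf_of_set S))"
    by (simp add: conv_bind map_pmf_def)
  also have "\<dots> = bind_pmf p (\<lambda>x. map_pmf (\<lambda>s. s \<otimes> x) (pmf_of_set S))"
    by (intro bind_pmf_cong refl eq supp_onD[OF p])
  also have "\<dots> = pmf_of_set S \<star> p"
    unfolding conv_bind map_pmf_def by (rule bind_commute_pmf)
  finally show ?thesis by simp
qed

text \<open>A conjugation-closed \<open>S\<close> makes the lazy uniform step on \<open>S\<close> central, so a binomial number
  of such steps can be split off from the walk.\<close>

lemma tv_le_smooth:
  assumes S: "finite S" "S \<subseteq> carrier G"
    and conj: "\<And>y s. y \<in> carrier G \<Longrightarrow> s \<in> S \<Longrightarrow> y \<otimes> s \<otimes> inv y \<in> S"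
    and comm: "\<And>s t. s \<in> S \<Longrightarrow> t \<in> S \<Longrightarrow> s \<otimes> t = t \<otimes> s"
    and p: "supp_on p" "insert \<one> S \<subseteq> set_pmf p"
  shows "\<exists>C\<ge>0. \<forall>s\<in>S. \<forall>r. tv_le (return_pmf s \<star> p ^\<star> r) (p ^\<star> r) (C * sqrt (1 / real (Suc r)))"
proof (cases "S = {}")
  case False
  define \<beta> where "\<beta> = mix_pmf (1 / 2) (pmf_of_set S) (return_pmf \<one>)"
  have set_\<beta>: "set_pmf \<beta> = insert \<one> S" using S(1) False by (auto simp: \<beta>_def set_mix)
  have supp: "supp_on \<beta>" using set_\<beta> S(2) by (auto simp: supp_on_def)
  have "pmf_of_set S \<star> p = p \<star> pmf_of_set S"
    by (rule conv_pmf_of_set_commute[OF S(1) False S(2) p(1) conj])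
  then have \<beta>p: "\<beta> \<star> p = p \<star> \<beta>"
    using p(1) by (simp add: \<beta>_def conv_mix_left conv_mix_right)
  obtain \<epsilon>0 where "\<epsilon>0 > 0" "\<forall>\<epsilon>. 0 < \<epsilon> \<longrightarrow> \<epsilon> < \<epsilon>0 \<longrightarrow> (\<exists>\<eta>. p = mix_pmf \<epsilon> \<beta> \<eta>)"
    using ex_mix_finite[of \<beta> p] set_\<beta> S(1) p(2) by auto
  then have "\<exists>\<eta>. p = mix_pmf (min \<epsilon>0 1 / 2) \<beta> \<eta>" by auto
  moreover define \<epsilon> where "\<epsilon> = min \<epsilon>0 1 / 2"
  ultimately obtain \<eta> where \<eta>: "p = mix_pmf \<epsilon> \<beta> \<eta>" by auto
  have \<epsilon>: "0 < \<epsilon>" "\<epsilon> < 1" using \<open>\<epsilon>0 > 0\<close> by (auto simp: \<epsilon>_def)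
  have \<eta>_supp: "supp_on \<eta>" using supp_on_mixD[OF \<epsilon>, of \<beta> \<eta>] p(1) \<eta> by simp
  have ex: "\<exists>C\<ge>0. \<forall>r. tv_le (return_pmf a \<star> p ^\<star> r) (p ^\<star> r) (C * sqrt (1 / real (Suc r)))"
    if a: "a \<in> S" for a
  proof -
    have ac: "a \<in> carrier G" using a S(2) by auto
    have set_h: "set_pmf (half_step a) = {a, \<one>}" by (auto simp: half_step_def set_mix)
    obtain \<delta>0 where "\<delta>0 > 0" "\<forall>\<epsilon>. 0 < \<epsilon> \<longrightarrow> \<epsilon> < \<delta>0 \<longrightarrow> (\<exists>\<eta>. \<beta> = mix_pmf \<epsilon> (half_step a) \<eta>)"
      using ex_mix_finite[of "half_step a" \<beta>] set_h set_\<beta> a by auto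
    then have "\<exists>\<eta>. \<beta> = mix_pmf (min \<delta>0 1 / 2) (half_step a) \<eta>" by auto
    moreover define \<delta> where "\<delta> = min \<delta>0 1 / 2"
    ultimately obtain \<beta>' where \<beta>': "\<beta> = mix_pmf \<delta> (half_step a) \<beta>'" by auto
    have \<delta>: "0 < \<delta>" "\<delta> < 1" using \<open>\<delta>0 > 0\<close> by (auto simp: \<delta>_def)
    have \<beta>'_supp: "supp_on \<beta>'" using supp_on_mixD[OF \<delta>, of "half_step a" \<beta>'] supp \<beta>' by simp
    \<comment> \<open>A lazy step along \<open>a\<close> commutes with \<open>\<beta>\<close> but in
      general not with \<open>p\<close>. Hence two stages: decay for powers of
      \<open>\<beta>\<close>, then for powers of \<open>p\<close>, with which \<open>\<beta>\<close>
      commutes.\<close>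
    have comm_h: "half_step a \<star> \<beta> = \<beta> \<star> half_step a"
    proof (rule conv_commute)
      fix x y assume "x \<in> set_pmf (half_step a)" "y \<in> set_pmf \<beta>"
      then have "x \<in> insert \<one> S" "y \<in> insert \<one> S" using set_h set_\<beta> a by auto
      then show "x \<otimes> y = y \<otimes> x" using comm S(2) by auto
    qed
    have "tv_le (return_pmf a \<star> \<beta> ^\<star> j) (\<beta> ^\<star> j) (2 * sqrt (2 / \<delta>) * sqrt (1 / real (Suc j)))" for j
      by (rule tv_le_smooth_mix[OF _ _ \<beta>'_supp \<beta>' \<delta> comm_h _ tv_le_half_step[OF ac]]) (use ac in auto)
    then have "tv_le (return_pmf a \<star> p ^\<star> r) (p ^\<star> r) (2 * sqrt (2 / \<delta>) * sqrt (2 / \<epsilon>) * sqrt (1 / real (Suc r)))" for r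
      by (intro tv_le_smooth_mix[OF _ supp \<eta>_supp \<eta> \<epsilon> \<beta>p]) (use ac \<delta> in auto)
    then show ?thesis using \<epsilon> \<delta> by (intro exI[of _ "2 * sqrt (2 / \<delta>) * sqrt (2 / \<epsilon>)"]) auto
  qed
  then have "\<exists>C. \<forall>a\<in>S. C a \<ge> 0 \<and> (\<forall>r. tv_le (return_pmf a \<star> p ^\<star> r) (p ^\<star> r) (C a * sqrt (1 / real (Suc r))))"
    by (intro bchoice) blast
  then obtain C where C: "\<And>a. a \<in> S \<Longrightarrow> C a \<ge> 0"
    "\<And>a r. a \<in> S \<Longrightarrow> tv_le (return_pmf a \<star> p ^\<star> r) (p ^\<star> r) (C a * sqrt (1 / real (Suc r)))" by blast
  show ?thesis
  proof (intro exI[of _ "sum C S"] conjI ballI allI)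
    show "0 \<le> sum C S" using C(1) by (rule sum_nonneg)
    fix a r assume a: "a \<in> S"
    have "C a \<le> sum C S" by (rule member_le_sum) (use a C S in auto)
    then show "tv_le (return_pmf a \<star> p ^\<star> r) (p ^\<star> r) (sum C S * sqrt (1 / real (Suc r)))"
      by (intro tv_le_mono[OF C(2)[OF a]] mult_right_mono) auto
  qed
qed (auto intro: exI[of _ 0])

text \<open>The bound is real so that multiples of the weight of a group element can serve directly
  as lengths.\<close>

definition short :: "'a set \<Rightarrow> real \<Rightarrow> 'a \<Rightarrow> bool" where
  "short S b a \<longleftrightarrow> (\<exists>n. real n \<le> b \<and> word G S n a)"

lemma short_closed: "short S b a \<Longrightarrow> S \<subseteq> carrier G \<Longrightarrow> a \<in> carrier G"
  by (auto simp: short_def intro: word_closed)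

lemma short_nonneg: "short S b a \<Longrightarrow> 0 \<le> b"
  unfolding short_def by (meson of_nat_0_le_iff order_trans)

lemma short_mono: "short S b a \<Longrightarrow> b \<le> b' \<Longrightarrow> short S b' a"
  unfolding short_def by (meson order_trans)

lemma short_one: "short S 0 \<one>"
  unfolding short_def using word_Nil by force

lemma short_mult:
  assumes "short S b a" "short S b' a'" "S \<subseteq> carrier G"
  shows "short S (b + b') (a \<otimes> a')"
proof -
  obtain n m where "real n \<le> b" "word G S n a" "real m \<le> b'" "word G S m a'"
    using assms by (auto simp: short_def)
  then show ?thesis unfolding short_def
    using word_mult[of S n a m a'] assms(3) by (intro exI[of _ "n + m"]) auto
qed

definition diffop :: "'a \<Rightarrow> ('a \<Rightarrow> real) \<Rightarrow> 'a \<Rightarrow> real" where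
  "diffop a h y = h (a \<otimes> y) - h y"

definition avop :: "'a pmf \<Rightarrow> ('a \<Rightarrow> real) \<Rightarrow> 'a \<Rightarrow> real" where
  "avop q f y = expect q (\<lambda>x. f (y \<otimes> x))"

lemma avop_restrict:
  assumes "supp_on q" "y \<in> carrier G" "\<And>x. x \<in> carrier G \<Longrightarrow> f x = g x"
  shows "avop q f y = avop q g y"
  unfolding avop_def by (rule expect_cong) (use assms supp_onD in auto)

lemma avop_bounded:
  assumes "supp_on q" "y \<in> carrier G" "\<And>x. x \<in> carrier G \<Longrightarrow> \<bar>f x\<bar> \<le> M"
  shows "\<bar>avop q f y\<bar> \<le> M"
  unfolding avop_def by (rule abs_expect_le) (use assms supp_onD in auto)

lemma avop_conv:
  assumes "supp_on q" "supp_on q'" "y \<in> carrier G" "\<And>x. x \<in> carrier G \<Longrightarrow> \<bar>f x\<bar> \<le> M"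
  shows "avop q (avop q' f) y = avop (q \<star> q') f y"
proof -
  \<comment> \<open>Cut-off outside the carrier: \<open>expect_conv\<close> asks for a bound on the
    whole type, while \<open>f\<close> is controlled on the group only.\<close>
  define g where "g x = (if x \<in> carrier G then f x else 0)" for x
  have "0 \<le> M" using assms(3,4) abs_ge_zero order_trans by blast
  then have gM: "\<bar>g x\<bar> \<le> M" for x using assms(4) by (simp add: g_def)
  have "avop (q \<star> q') f y = avop (q \<star> q') g y"
    using assms by (intro avop_restrict) (auto simp: g_def)
  also have "\<dots> = expect q (\<lambda>x. expect q' (\<lambda>z. g (y \<otimes> (x \<otimes> z))))"
    unfolding avop_def by (rule expect_conv) (rule gM)
  also have "\<dots> = avop q (avop q' f) y"
    unfolding avop_def
    by (intro expect_cong) (use assms supp_onD in \<open>simp add: g_def m_assoc\<close>)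
  finally show ?thesis ..
qed

lemma avop_diffop:
  assumes "supp_on q" "y \<in> carrier G" "a \<in> carrier G" "\<And>x. x \<in> carrier G \<Longrightarrow> \<bar>f x\<bar> \<le> M"
  shows "diffop a (avop q f) y = avop q (diffop a f) y"
proof -
  define g where "g x = (if x \<in> carrier G then f x else 0)" for x
  have "0 \<le> M" using assms(3,4) abs_ge_zero order_trans by blast
  then have gM: "\<bar>g x\<bar> \<le> M" for x using assms(4) by (simp add: g_def)
  have int: "integrable (measure_pmf q) (\<lambda>x. g (z \<otimes> x))" for z
    by (rule integrable_pmf_bounded) (rule gM)
  have "diffop a (avop q f) y = expect q (\<lambda>x. g ((a \<otimes> y) \<otimes> x)) - expect q (\<lambda>x. g (y \<otimes> x))"
    unfolding diffop_def avop_def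
    by (intro arg_cong2[of _ _ _ _ "(-)"] expect_cong) (use assms supp_onD in \<open>auto simp: g_def\<close>)
  also have "\<dots> = expect q (\<lambda>x. g ((a \<otimes> y) \<otimes> x) - g (y \<otimes> x))"
    by (simp add: int)
  also have "\<dots> = avop q (diffop a f) y"
    unfolding avop_def diffop_def
    by (intro expect_cong) (use assms supp_onD in \<open>auto simp: g_def m_assoc\<close>)
  finally show ?thesis .
qed

text \<open>A letter pushed past \<open>y\<close> becomes a conjugate, again in \<open>S\<close>,
  which \<open>q\<close> absorbs at cost \<open>c\<close>. A word telescopes into its letters,
  whence the factor \<open>b\<close>.\<close>

lemma diffop_avop_bound:
  assumes S: "S \<subseteq> carrier G" and conj: "\<And>y s. y \<in> carrier G \<Longrightarrow> s \<in> S \<Longrightarrow> y \<otimes> s \<otimes> inv y \<in> S"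
    and q: "supp_on q" "\<And>s. s \<in> S \<Longrightarrow> tv_le (return_pmf s \<star> q) q c"
    and f: "\<And>x. x \<in> carrier G \<Longrightarrow> \<bar>f x\<bar> \<le> M"
    and c: "0 \<le> c" and "short S b a" "y \<in> carrier G"
  shows "\<bar>diffop a (avop q f) y\<bar> \<le> b * c * M"
proof -
  define g where "g x = (if x \<in> carrier G then f x else 0)" for x
  have M: "0 \<le> M" using assms(8) f abs_ge_zero order_trans by blast
  then have gM: "\<bar>g x\<bar> \<le> M" for x using f by (simp add: g_def)
  have base: "\<bar>diffop s (avop q f) y\<bar> \<le> M * c" if s: "s \<in> S" and y: "y \<in> carrier G" for s y
  proof -
    have sc: "s \<in> carrier G" using s S by auto
    define s' where "s' = inv y \<otimes> s \<otimes> inv (inv y)"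
    have s': "s' \<in> S" unfolding s'_def by (rule conj) (use y s in auto)
    then have s'c: "s' \<in> carrier G" using S by auto
    have sy: "s \<otimes> y = y \<otimes> s'" using y sc by (simp add: s'_def m_assoc[symmetric])
    have "\<bar>expect (return_pmf s' \<star> q) (\<lambda>x. g (y \<otimes> x)) - expect q (\<lambda>x. g (y \<otimes> x))\<bar> \<le> M * c"
      by (rule tv_le_scaled[OF q(2)[OF s']]) (rule gM)
    also have "expect (return_pmf s' \<star> q) (\<lambda>x. g (y \<otimes> x)) = expect q (\<lambda>x. g (y \<otimes> (s' \<otimes> x)))"
      by (subst expect_conv[where M = M]) (auto simp: gM)
    also have "\<dots> = avop q f (s \<otimes> y)"
      unfolding avop_def sy
      by (intro expect_cong) (use y s'c supp_onD[OF q(1)] in \<open>auto simp: g_def m_assoc\<close>)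
    also have "expect q (\<lambda>x. g (y \<otimes> x)) = avop q f y"
      unfolding avop_def
      by (intro expect_cong) (use y supp_onD[OF q(1)] in \<open>auto simp: g_def\<close>)
    finally show ?thesis by (simp add: diffop_def)
  qed
  obtain n where n: "real n \<le> b" "word G S n a" using assms(7) by (auto simp: short_def)
  have "\<bar>diffop a (avop q f) y\<bar> \<le> real n * (M * c)"
    using n(2)
  proof induction
    case word_Nil
    then show ?case using assms(8) by (simp add: diffop_def)
  next
    case (word_Cons s n a)
    have ac: "a \<in> carrier G" using word_closed[OF word_Cons(2) S] .
    have sc: "s \<in> carrier G" using word_Cons(1) S by auto
    have "diffop (s \<otimes> a) (avop q f) y = diffop s (avop q f) (a \<otimes> y) + diffop a (avop q f) y"
      using ac sc assms(8) by (simp add: diffop_def m_assoc)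
    moreover have "\<bar>diffop s (avop q f) (a \<otimes> y)\<bar> \<le> M * c"
      by (rule base) (use word_Cons(1) ac assms(8) in auto)
    ultimately show ?case using word_Cons(3) by (simp add: distrib_right)
  qed
  also have "\<dots> \<le> b * (M * c)" using n(1) M c by (intro mult_right_mono) auto
  finally show ?thesis by (simp add: mult_ac)
qed

text \<open>Left differences commute with right convolution, so splitting a power of \<open>q\<close> into three equal
  parts lets each part absorb one difference.\<close>

definition smooth3 :: "'a set \<Rightarrow> real \<Rightarrow> ('a \<Rightarrow> real) \<Rightarrow> bool" where
  "smooth3 S c h \<longleftrightarrow>
    (\<forall>b1 a1. short S b1 a1 \<longrightarrow> (\<forall>y\<in>carrier G. \<bar>diffop a1 h y\<bar> \<le> b1 * c)) \<and>
    (\<forall>b1 a1 b2 a2. short S b1 a1 \<longrightarrow> short S b2 a2 \<longrightarrow>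
      (\<forall>y\<in>carrier G. \<bar>diffop a1 (diffop a2 h) y\<bar> \<le> b1 * b2 * c ^ 2)) \<and>
    (\<forall>b1 a1 b2 a2 b3 a3. short S b1 a1 \<longrightarrow> short S b2 a2 \<longrightarrow> short S b3 a3 \<longrightarrow>
      (\<forall>y\<in>carrier G. \<bar>diffop a1 (diffop a2 (diffop a3 h)) y\<bar> \<le> b1 * b2 * b3 * c ^ 3))"

lemma diffop_cong: "(\<And>x. x \<in> carrier G \<Longrightarrow> f x = g x) \<Longrightarrow> a \<in> carrier G \<Longrightarrow> y \<in> carrier G \<Longrightarrow> diffop a f y = diffop a g y"
  by (simp add: diffop_def)

text \<open>Each difference moves inside one copy of \<open>q\<close>; the differenced inner
  function, already small, is the test function for the next copy.\<close>

lemma smooth3_avop: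
  assumes S: "S \<subseteq> carrier G" and conj: "\<And>y s. y \<in> carrier G \<Longrightarrow> s \<in> S \<Longrightarrow> y \<otimes> s \<otimes> inv y \<in> S"
    and q: "supp_on q" "\<And>s. s \<in> S \<Longrightarrow> tv_le (return_pmf s \<star> q) q c"
    and f: "\<And>x. x \<in> carrier G \<Longrightarrow> \<bar>f x\<bar> \<le> 1"
    and c: "0 \<le> c"
  shows "smooth3 S c (avop q (avop q (avop q f)))"
proof -
  have B: "\<bar>diffop a (avop q g) y\<bar> \<le> b * c * M"
    if "\<And>x. x \<in> carrier G \<Longrightarrow> \<bar>g x\<bar> \<le> M" "short S b a" "y \<in> carrier G" for a b y g M
    by (rule diffop_avop_bound[of S q c g M b a y, OF S]) (fact conj q c that)+
  let ?f1 = "avop q f"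
  let ?f2 = "avop q ?f1"
  have f1: "\<bar>?f1 x\<bar> \<le> 1" if "x \<in> carrier G" for x by (rule avop_bounded[OF q(1) that f])
  have f2: "\<bar>?f2 x\<bar> \<le> 1" if "x \<in> carrier G" for x by (rule avop_bounded[OF q(1) that f1])
  have d1: "\<bar>diffop a (avop q g) y\<bar> \<le> b * c"
    if "\<And>x. x \<in> carrier G \<Longrightarrow> \<bar>g x\<bar> \<le> 1" "short S b a" "y \<in> carrier G" for a b y g
    using B[of g 1 b a y] that by simp
  have d2: "\<bar>diffop a (diffop a' (avop q (avop q g))) y\<bar> \<le> b * b' * c ^ 2"
    if g: "\<And>x. x \<in> carrier G \<Longrightarrow> \<bar>g x\<bar> \<le> 1" and s: "short S b a" "short S b' a'" and y: "y \<in> carrier G" for a b a' b' y g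
  proof -
    have cl: "a \<in> carrier G" "a' \<in> carrier G" using s short_closed S by auto
    have g1: "\<bar>avop q g x\<bar> \<le> 1" if "x \<in> carrier G" for x by (rule avop_bounded[OF q(1) that g])
    have "diffop a (diffop a' (avop q (avop q g))) y = diffop a (avop q (diffop a' (avop q g))) y"
      using cl y g1 by (intro diffop_cong avop_diffop[OF q(1)]) auto
    also have "\<bar>\<dots>\<bar> \<le> b * c * (b' * c)"
      by (rule B[OF d1[OF g s(2)] s(1) y])
    finally show ?thesis by (simp add: power2_eq_square mult_ac)
  qed
  have d3: "\<bar>diffop a (diffop a' (diffop a'' (avop q ?f2))) y\<bar> \<le> b * b' * b'' * c ^ 3"
    if s: "short S b a" "short S b' a'" "short S b'' a''" and y: "y \<in> carrier G" for a b a' b' a'' b'' y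
  proof -
    have cl: "a \<in> carrier G" "a' \<in> carrier G" "a'' \<in> carrier G" using s short_closed S by auto
    have bd: "\<bar>diffop a'' ?f2 x\<bar> \<le> b'' * c" if "x \<in> carrier G" for x
      by (rule d1[OF f1 s(3) that])
    have "diffop a (diffop a' (diffop a'' (avop q ?f2))) y = diffop a (avop q (diffop a' (diffop a'' ?f2))) y"
    proof (rule diffop_cong[OF _ cl(1) y])
      fix x assume x: "x \<in> carrier G"
      have "diffop a' (diffop a'' (avop q ?f2)) x = diffop a' (avop q (diffop a'' ?f2)) x"
        using cl x f2 by (intro diffop_cong avop_diffop[OF q(1)]) auto
      also have "\<dots> = avop q (diffop a' (diffop a'' ?f2)) x"
        by (rule avop_diffop[OF q(1) x cl(2) bd])
      finally show "diffop a' (diffop a'' (avop q ?f2)) x = avop q (diffop a' (diffop a'' ?f2)) x" .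
    qed
    also have "\<bar>\<dots>\<bar> \<le> b * c * (b' * b'' * c ^ 2)"
      by (rule B[OF d2[OF f s(2,3)] s(1) y])
    finally show ?thesis by (simp add: power2_eq_square power3_eq_cube mult_ac)
  qed
  show ?thesis
    unfolding smooth3_def by (intro conjI allI impI ballI d1[OF f2] d2[OF f1] d3)
qed

end

section \<open>Averages over coset representatives in a product\<close>

lemma abs_expect_le_nn_integral:
  assumes "\<And>x. x \<in> set_pmf p \<Longrightarrow> \<bar>D x\<bar> \<le> k * \<phi> x" "0 \<le> k" "0 \<le> B"
    and "(\<integral>\<^sup>+x. ennreal (\<phi> x) \<partial>p) \<le> ennreal B"
  shows "\<bar>expect p D\<bar> \<le> k * B"
proof (cases "integrable (measure_pmf p) D")
  case True
  have "ennreal \<bar>expect p D\<bar> \<le> (\<integral>\<^sup>+x. ennreal \<bar>D x\<bar> \<partial>p)"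
    using integral_norm_bound_ennreal[OF True] by simp
  also have "\<dots> \<le> (\<integral>\<^sup>+x. ennreal k * ennreal (\<phi> x) \<partial>p)"
  proof (rule nn_integral_mono_AE, unfold AE_measure_pmf_iff, rule ballI)
    fix x assume "x \<in> set_pmf p"
    then show "ennreal \<bar>D x\<bar> \<le> ennreal k * ennreal (\<phi> x)"
      using assms(1)[of x] assms(2) by (simp add: ennreal_mult'[symmetric] ennreal_leI)
  qed
  also have "\<dots> = ennreal k * (\<integral>\<^sup>+x. ennreal (\<phi> x) \<partial>p)" by (rule nn_integral_cmult) simp
  also have "\<dots> \<le> ennreal k * ennreal B" by (intro mult_left_mono assms) simp
  also have "\<dots> = ennreal (k * B)" using assms by (simp add: ennreal_mult)
  finally show ?thesis using assms by (simp add: ennreal_le_iff)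
next
  \<comment> \<open>The Bochner integral of a non-integrable function is 0 by convention.\<close>
  case False
  then show ?thesis using assms by (simp add: not_integrable_integral_eq)
qed

text \<open>Left translation by \<open>x\<close> permutes the cosets, so the two sums differ only by
  the displacements \<open>npart (x \<otimes> t)\<close> inside \<open>N\<close>.\<close>

lemma (in transversal) coset_sum_shift:
  assumes g: "\<And>a b y. short S b a \<Longrightarrow> y \<in> carrier G \<Longrightarrow> \<bar>g (a \<otimes> y) - g y\<bar> \<le> b * c"
    and x: "x \<in> carrier G" and k: "\<And>t. t \<in> T \<Longrightarrow> short S k (npart (x \<otimes> t))"
  shows "\<bar>(\<Sum>t\<in>T. g (x \<otimes> t)) - (\<Sum>t\<in>T. g t)\<bar> \<le> real (card T) * (k * c)"
proof -
  have "(\<Sum>t\<in>T. g t) = (\<Sum>t\<in>T. g (rep (x \<otimes> t)))"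
    using sum.reindex_bij_betw[OF bij_rep_left[OF x], of g] by simp
  then have "(\<Sum>t\<in>T. g (x \<otimes> t)) - (\<Sum>t\<in>T. g t)
      = (\<Sum>t\<in>T. g (npart (x \<otimes> t) \<otimes> rep (x \<otimes> t)) - g (rep (x \<otimes> t)))"
    using x by (auto simp: sum_subtractf[symmetric] intro!: sum.cong)
  also have "\<bar>\<dots>\<bar> \<le> (\<Sum>t\<in>T. k * c)"
    by (rule order_trans[OF sum_abs], rule sum_mono, rule g[OF k]) (use x in auto)
  finally show ?thesis by simp
qed

text \<open>\<open>w\<close> stands for one plus word length, and \<open>C\<close> converts it into
  length over \<open>S\<close>. The exponent \<open>e\<close> is where the absence of epimorphisms
  from \<open>G1\<close> onto the integers enters.\<close>

locale two_transversals =
  A: transversal G1 N1 rep1 + B: transversal G2 N2 rep2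
  for G1 :: "('a, 'm) monoid_scheme" and N1 rep1 and G2 :: "('b, 'n) monoid_scheme" and N2 rep2 +
  fixes S :: "('a \<times> 'b) set" and w :: "'a \<times> 'b \<Rightarrow> real" and C :: real and e :: nat
  assumes S_N: "S \<subseteq> N1 \<times> N2"
    and w_ge_1: "x \<in> carrier (G1 \<times>\<times> G2) \<Longrightarrow> 1 \<le> w x"
    and w_mult: "\<lbrakk>x \<in> carrier (G1 \<times>\<times> G2); y \<in> carrier (G1 \<times>\<times> G2)\<rbrakk>
      \<Longrightarrow> w (x \<otimes>\<^bsub>G1 \<times>\<times> G2\<^esub> y) \<le> w x + w y"
    and short_npart1: "x \<in> carrier (G1 \<times>\<times> G2) \<Longrightarrow> group.short (G1 \<times>\<times> G2) S (C * w x) (A.npart (fst x), \<one>\<^bsub>G2\<^esub>)"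
    and short_npart2: "x \<in> carrier (G1 \<times>\<times> G2) \<Longrightarrow> group.short (G1 \<times>\<times> G2) S (C * w x) (\<one>\<^bsub>G1\<^esub>, B.npart (snd x))"
    and e_pos: "0 < e"
    and transfer_e: "z \<in> carrier G1 \<Longrightarrow> A.transfer z [^]\<^bsub>A.NG\<^esub> e = \<one>\<^bsub>G1\<^esub>"
begin

abbreviation G :: "('a \<times> 'b) monoid" where "G \<equiv> G1 \<times>\<times> G2"

sublocale P: transversal "G1 \<times>\<times> G2" "N1 \<times> N2" "map_prod rep1 rep2"
  by (rule DirProd_transversal[OF A.transversal_axioms B.transversal_axioms])

lemma T_prod: "P.T = A.T \<times> B.T"
  by (auto simp: image_iff)

lemma npart_prod: "x \<in> carrier G \<Longrightarrow> P.npart x = (A.npart (fst x), B.npart (snd x))"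
  by (cases x) (simp add: P.npart_def A.npart_def B.npart_def inv_DirProd[OF A.is_group B.is_group])

lemma S_carrier: "S \<subseteq> carrier G"
  using S_N by auto

lemma C_nonneg: "0 \<le> C"
proof -
  have "0 \<le> C * w \<one>\<^bsub>G\<^esub>" by (rule P.short_nonneg[OF short_npart1]) (rule P.one_closed)
  moreover have "1 \<le> w \<one>\<^bsub>G\<^esub>" by (rule w_ge_1) (rule P.one_closed)
  ultimately show ?thesis by (simp add: zero_le_mult_iff)
qed

definition W :: real where "W = Max (w ` P.T)"

lemma w_le_W: "t \<in> P.T \<Longrightarrow> w t \<le> W"
  unfolding W_def by (intro Max_ge) (use P.finite_rep in auto)

lemma W_ge_1: "1 \<le> W"
  using w_ge_1[OF P.rep_closed[OF P.one_closed]] w_le_W[of "map_prod rep1 rep2 \<one>\<^bsub>G\<^esub>"] P.one_closed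
  by fastforce

lemma w_mult_T:
  assumes "x \<in> carrier G" "t \<in> P.T"
  shows "w (t \<otimes>\<^bsub>G\<^esub> x) \<le> (1 + W) * w x" "w (x \<otimes>\<^bsub>G\<^esub> t) \<le> (1 + W) * w x"
proof -
  have t: "t \<in> carrier G" by (rule P.T_closed[OF assms(2)])
  have "W * 1 \<le> W * w x" using W_ge_1 w_ge_1[OF assms(1)] by (intro mult_left_mono) auto
  moreover have "w (t \<otimes>\<^bsub>G\<^esub> x) \<le> W + w x" "w (x \<otimes>\<^bsub>G\<^esub> t) \<le> w x + W"
    using w_mult[OF t assms(1)] w_mult[OF assms(1) t] w_le_W[OF assms(2)] by auto
  ultimately show "w (t \<otimes>\<^bsub>G\<^esub> x) \<le> (1 + W) * w x" "w (x \<otimes>\<^bsub>G\<^esub> t) \<le> (1 + W) * w x"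
    by (auto simp: distrib_right)
qed

lemma short_npart: "x \<in> carrier G \<Longrightarrow> P.short S (2 * C * w x) (P.npart x)"
  using P.short_mult[OF short_npart1[of x] short_npart2[of x] S_carrier]
  by (auto simp: npart_prod mult.assoc)

text \<open>For \<open>h y = E f (y \<otimes> Y)\<close> with \<open>Y\<close> the later part of the walk, \<open>JS h x\<close> is, up to normalisation, the
  expectation of \<open>f\<close> when \<open>x\<close> stands between two uniform representatives. The terms subtracted in
  \<open>DS\<close> depend on one component of \<open>x\<close> only, so they do not distinguish laws with equal marginals.\<close>

definition HS :: "('a \<times> 'b \<Rightarrow> real) \<Rightarrow> 'a \<times> 'b \<Rightarrow> real" where
  "HS h y = (\<Sum>t\<in>P.T. h (y \<otimes>\<^bsub>G\<^esub> t))"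

definition JS :: "('a \<times> 'b \<Rightarrow> real) \<Rightarrow> 'a \<times> 'b \<Rightarrow> real" where
  "JS h x = (\<Sum>t\<in>P.T. HS h (t \<otimes>\<^bsub>G\<^esub> x))"

definition DS :: "('a \<times> 'b \<Rightarrow> real) \<Rightarrow> 'a \<times> 'b \<Rightarrow> real" where
  "DS h x = JS h x - JS h (fst x, \<one>\<^bsub>G2\<^esub>) - JS h (\<one>\<^bsub>G1\<^esub>, snd x) + JS h \<one>\<^bsub>G\<^esub>"

text \<open>For exchanged segments that have a \<open>\<kappa>\<close> on their right only.\<close>

lemma HS_first_order:
  assumes "P.smooth3 S c h" "x \<in> carrier G" "0 \<le> c"
  shows "\<bar>HS h x - HS h \<one>\<^bsub>G\<^esub>\<bar> \<le> real (card P.T) * (2 * C * (1 + W) * w x * c)"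
proof -
  have "\<bar>(\<Sum>t\<in>P.T. h (x \<otimes>\<^bsub>G\<^esub> t)) - (\<Sum>t\<in>P.T. h t)\<bar> \<le> real (card P.T) * ((2 * C * (1 + W) * w x) * c)"
  proof (rule P.coset_sum_shift[OF _ assms(2)])
    fix a b y assume "P.short S b a" "y \<in> carrier G"
    then show "\<bar>h (a \<otimes>\<^bsub>G\<^esub> y) - h y\<bar> \<le> b * c"
      using assms(1) unfolding P.smooth3_def P.diffop_def by blast
  next
    fix t assume t: "t \<in> P.T"
    have "x \<otimes>\<^bsub>G\<^esub> t \<in> carrier G" by (rule P.m_closed[OF assms(2) P.T_closed[OF t]])
    from short_npart[OF this] show "P.short S (2 * C * (1 + W) * w x) (P.npart (x \<otimes>\<^bsub>G\<^esub> t))"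
    proof (rule P.short_mono)
      show "2 * C * w (x \<otimes>\<^bsub>G\<^esub> t) \<le> 2 * C * (1 + W) * w x"
        using mult_left_mono[OF w_mult_T(2)[OF assms(2) t], of "2 * C"] C_nonneg by (simp add: mult.assoc)
    qed
  qed
  moreover have "HS h \<one>\<^bsub>G\<^esub> = (\<Sum>t\<in>P.T. h t)"
    unfolding HS_def by (intro sum.cong refl arg_cong[where f = h] P.l_one P.T_closed)
  ultimately show ?thesis by (simp add: HS_def)
qed

text \<open>Differences along commuting elements add up, except for second differences. The error
  involves each pair of factors once, hence at most the square of the total length.\<close>

lemma finprod_diffop:
  assumes "finite I" "\<And>i. i \<in> I \<Longrightarrow> a i \<in> N1" "\<And>i. i \<in> I \<Longrightarrow> P.short S (b i) (a i, \<one>\<^bsub>G2\<^esub>)"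
    and y: "y \<in> carrier G" and D: "0 \<le> D"
    and g: "\<And>b1 a1 b2 a2. P.short S b1 a1 \<Longrightarrow> P.short S b2 a2 \<Longrightarrow> \<bar>P.diffop a1 (P.diffop a2 g) y\<bar> \<le> b1 * b2 * D"
  shows "P.short S (sum b I) (finprod A.NG a I, \<one>\<^bsub>G2\<^esub>) \<and>
    \<bar>(\<Sum>i\<in>I. P.diffop (a i, \<one>\<^bsub>G2\<^esub>) g y) - P.diffop (finprod A.NG a I, \<one>\<^bsub>G2\<^esub>) g y\<bar> \<le> (sum b I)\<^sup>2 * D"
  using assms(1-3)
proof (induction I rule: finite_induct)
  case empty
  interpret NG: comm_group A.NG by (rule A.comm_group_NG)
  have "P.diffop (\<one>\<^bsub>G1\<^esub>, \<one>\<^bsub>G2\<^esub>) g y = 0"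
    using P.l_one[OF y] by (simp add: P.diffop_def)
  then show ?case using P.short_one by simp
next
  case (insert i I)
  interpret NG: comm_group A.NG by (rule A.comm_group_NG)
  let ?F = "finprod A.NG a I" and ?f = "(finprod A.NG a I, \<one>\<^bsub>G2\<^esub>)" and ?u = "(a i, \<one>\<^bsub>G2\<^esub>)"
  have IH: "P.short S (sum b I) ?f"
    "\<bar>(\<Sum>i\<in>I. P.diffop (a i, \<one>\<^bsub>G2\<^esub>) g y) - P.diffop ?f g y\<bar> \<le> (sum b I)\<^sup>2 * D"
    using insert by auto
  have u: "P.short S (b i) ?u" "a i \<in> N1" using insert by auto
  have F: "?F \<in> N1" using NG.finprod_closed[of a I] insert by auto
  have "finprod A.NG a (insert i I) = a i \<otimes>\<^bsub>G1\<^esub> ?F"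
    using NG.finprod_insert[OF insert(1,2), of a] insert(4) by auto
  then have prod: "(finprod A.NG a (insert i I), \<one>\<^bsub>G2\<^esub>) = ?u \<otimes>\<^bsub>G\<^esub> ?f" by simp
  have comm: "?u \<otimes>\<^bsub>G\<^esub> ?f = ?f \<otimes>\<^bsub>G\<^esub> ?u" using A.comm_N[OF u(2) F] by simp
  have cl: "?u \<in> carrier G" "?f \<in> carrier G" using u F by auto
  have s: "sum b (insert i I) = b i + sum b I" using insert by simp
  have b0: "0 \<le> b i" "0 \<le> sum b I" using P.short_nonneg[OF u(1)] P.short_nonneg[OF IH(1)] .
  have "(?u \<otimes>\<^bsub>G\<^esub> ?f) \<otimes>\<^bsub>G\<^esub> y = ?f \<otimes>\<^bsub>G\<^esub> (?u \<otimes>\<^bsub>G\<^esub> y)"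
    unfolding comm by (rule P.m_assoc[OF cl(2,1) y])
  then have "P.diffop (?u \<otimes>\<^bsub>G\<^esub> ?f) g y = P.diffop ?u (P.diffop ?f g) y + P.diffop ?u g y + P.diffop ?f g y"
    by (simp add: P.diffop_def)
  moreover have "(\<Sum>j\<in>insert i I. P.diffop (a j, \<one>\<^bsub>G2\<^esub>) g y) = P.diffop ?u g y + (\<Sum>j\<in>I. P.diffop (a j, \<one>\<^bsub>G2\<^esub>) g y)"
    using insert by simp
  ultimately have "\<bar>(\<Sum>j\<in>insert i I. P.diffop (a j, \<one>\<^bsub>G2\<^esub>) g y) - P.diffop (?u \<otimes>\<^bsub>G\<^esub> ?f) g y\<bar>
      \<le> (sum b I)\<^sup>2 * D + b i * sum b I * D"
    using IH(2) g[OF u(1) IH(1)] by linarith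
  also have "\<dots> = ((sum b I)\<^sup>2 + b i * sum b I) * D" by (simp add: distrib_right)
  also have "\<dots> \<le> (sum b (insert i I))\<^sup>2 * D"
    unfolding s using b0 D by (intro mult_right_mono) (auto simp: power2_eq_square algebra_simps)
  finally have "\<bar>(\<Sum>j\<in>insert i I. P.diffop (a j, \<one>\<^bsub>G2\<^esub>) g y) - P.diffop (?u \<otimes>\<^bsub>G\<^esub> ?f) g y\<bar>
      \<le> (sum b (insert i I))\<^sup>2 * D" .
  moreover have "P.short S (sum b (insert i I)) (?u \<otimes>\<^bsub>G\<^esub> ?f)"
    unfolding s by (rule P.short_mult[OF u(1) IH(1) S_carrier])
  ultimately show ?case unfolding prod by blast
qed

text \<open>The product of the \<open>npart (t \<otimes> x)\<close> over all representatives \<open>t\<close> is the transfer of \<open>x\<close>, a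
  torsion element; hence the first-order terms of the average cancel up to second order.\<close>

lemma sum_transfer_diffop:
  assumes x: "x \<in> carrier G1" and y: "y \<in> carrier G" and D: "0 \<le> D"
    and b: "\<And>t. t \<in> A.T \<Longrightarrow> P.short S b (A.npart (t \<otimes>\<^bsub>G1\<^esub> x), \<one>\<^bsub>G2\<^esub>)"
    and g: "\<And>b1 a1 b2 a2. P.short S b1 a1 \<Longrightarrow> P.short S b2 a2 \<Longrightarrow> \<bar>P.diffop a1 (P.diffop a2 g) y\<bar> \<le> b1 * b2 * D"
  shows "\<bar>\<Sum>t\<in>A.T. P.diffop (A.npart (t \<otimes>\<^bsub>G1\<^esub> x), \<one>\<^bsub>G2\<^esub>) g y\<bar> \<le> 2 * (real e * real (card A.T) * b)\<^sup>2 * D"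
proof -
  interpret NG: comm_group A.NG by (rule A.comm_group_NG)
  let ?n = "real (card A.T)"
  let ?V = "A.transfer x"
  have npart_N: "A.npart (t \<otimes>\<^bsub>G1\<^esub> x) \<in> N1" if "t \<in> A.T" for t
    using that x by auto
  have 1: "P.short S (\<Sum>t\<in>A.T. b) (?V, \<one>\<^bsub>G2\<^esub>) \<and>
    \<bar>(\<Sum>t\<in>A.T. P.diffop (A.npart (t \<otimes>\<^bsub>G1\<^esub> x), \<one>\<^bsub>G2\<^esub>) g y) - P.diffop (?V, \<one>\<^bsub>G2\<^esub>) g y\<bar> \<le> (\<Sum>t\<in>A.T. b)\<^sup>2 * D"
    unfolding A.transfer_def by (rule finprod_diffop[OF A.finite_rep npart_N b y D g])
  have V: "?V \<in> N1" using A.transfer_hom x by (auto simp: hom_def)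
  \<comment> \<open>The same additivity for \<open>e\<close> equal factors: \<open>e\<close> times
    the difference along the transfer value is nearly the difference along its \<open>e\<close>-th
    power, which is the identity.\<close>
  have 2: "P.short S (\<Sum>i<e. ?n * b) (finprod A.NG (\<lambda>_. ?V) {..<e}, \<one>\<^bsub>G2\<^esub>) \<and>
    \<bar>(\<Sum>i<e. P.diffop (?V, \<one>\<^bsub>G2\<^esub>) g y) - P.diffop (finprod A.NG (\<lambda>_. ?V) {..<e}, \<one>\<^bsub>G2\<^esub>) g y\<bar> \<le> (\<Sum>i<e. ?n * b)\<^sup>2 * D"
    by (rule finprod_diffop[OF _ _ _ y D g]) (use 1 V in auto)
  have "finprod A.NG (\<lambda>_. ?V) {..<e} = ?V [^]\<^bsub>A.NG\<^esub> e"
    using NG.finprod_const[of ?V "{..<e}"] V by simp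
  also have "\<dots> = \<one>\<^bsub>G1\<^esub>" by (rule transfer_e[OF x])
  finally have "P.diffop (finprod A.NG (\<lambda>_. ?V) {..<e}, \<one>\<^bsub>G2\<^esub>) g y = 0"
    using P.l_one[OF y] by (simp add: P.diffop_def)
  then have "real e * \<bar>P.diffop (?V, \<one>\<^bsub>G2\<^esub>) g y\<bar> \<le> (real e * ?n * b)\<^sup>2 * D"
    using 2 by (simp add: abs_mult mult.assoc)
  moreover have "1 * \<bar>P.diffop (?V, \<one>\<^bsub>G2\<^esub>) g y\<bar> \<le> real e * \<bar>P.diffop (?V, \<one>\<^bsub>G2\<^esub>) g y\<bar>"
    using e_pos by (intro mult_right_mono) auto
  \<comment> \<open>Brings the error of the first comparison to the size of the second, whence the
    factor 2.\<close>
  moreover have "(?n * b)\<^sup>2 * D \<le> (real e * ?n * b)\<^sup>2 * D"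
  proof -
    have "1 * (?n * b)\<^sup>2 \<le> (real e)\<^sup>2 * (?n * b)\<^sup>2" using e_pos by (intro mult_right_mono) auto
    then show ?thesis using D by (intro mult_right_mono) (auto simp: power_mult_distrib mult_ac)
  qed
  ultimately show ?thesis using 1 by (simp add: mult.assoc) linarith
qed

lemma diffop_HS:
  assumes "a \<in> carrier G" "b \<in> carrier G" "y \<in> carrier G"
  shows "P.diffop a (P.diffop b (HS h)) y = (\<Sum>t\<in>P.T. P.diffop a (P.diffop b h) (y \<otimes>\<^bsub>G\<^esub> t))"
proof -
  have eq: "b \<otimes>\<^bsub>G\<^esub> (a \<otimes>\<^bsub>G\<^esub> y) \<otimes>\<^bsub>G\<^esub> t = b \<otimes>\<^bsub>G\<^esub> (a \<otimes>\<^bsub>G\<^esub> (y \<otimes>\<^bsub>G\<^esub> t))" "a \<otimes>\<^bsub>G\<^esub> y \<otimes>\<^bsub>G\<^esub> t = a \<otimes>\<^bsub>G\<^esub> (y \<otimes>\<^bsub>G\<^esub> t)"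
    "b \<otimes>\<^bsub>G\<^esub> y \<otimes>\<^bsub>G\<^esub> t = b \<otimes>\<^bsub>G\<^esub> (y \<otimes>\<^bsub>G\<^esub> t)" if "t \<in> P.T" for t
    using assms P.T_closed[OF that] by (simp_all only: P.m_assoc P.m_closed)
  have "P.diffop a (P.diffop b (HS h)) y = (\<Sum>t\<in>P.T. h (b \<otimes>\<^bsub>G\<^esub> (a \<otimes>\<^bsub>G\<^esub> y) \<otimes>\<^bsub>G\<^esub> t) - h (a \<otimes>\<^bsub>G\<^esub> y \<otimes>\<^bsub>G\<^esub> t)
      - (h (b \<otimes>\<^bsub>G\<^esub> y \<otimes>\<^bsub>G\<^esub> t) - h (y \<otimes>\<^bsub>G\<^esub> t)))"
    unfolding P.diffop_def HS_def sum_subtractf ..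
  also have "\<dots> = (\<Sum>t\<in>P.T. P.diffop a (P.diffop b h) (y \<otimes>\<^bsub>G\<^esub> t))"
    unfolding P.diffop_def by (intro sum.cong refl) (simp only: eq)
  finally show ?thesis .
qed

text \<open>In a term that lacks a coordinate of \<open>x\<close>, the sum over all representatives
  \<open>t\<close> may be reindexed by \<open>rep (t \<otimes> x)\<close> in that coordinate. The
  four terms of \<open>DS\<close> then are the corners of a mixed second difference.\<close>

lemma DS_eq:
  assumes x: "x1 \<in> carrier G1" "x2 \<in> carrier G2"
  shows "DS h (x1, x2) = (\<Sum>t1\<in>A.T. \<Sum>t2\<in>B.T. P.diffop (A.npart (t1 \<otimes>\<^bsub>G1\<^esub> x1), \<one>\<^bsub>G2\<^esub>)
      (P.diffop (\<one>\<^bsub>G1\<^esub>, B.npart (t2 \<otimes>\<^bsub>G2\<^esub> x2)) (HS h)) (rep1 (t1 \<otimes>\<^bsub>G1\<^esub> x1), rep2 (t2 \<otimes>\<^bsub>G2\<^esub> x2)))"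
proof -
  let ?H = "HS h"
  let ?r1 = "\<lambda>t. rep1 (t \<otimes>\<^bsub>G1\<^esub> x1)" and ?r2 = "\<lambda>t. rep2 (t \<otimes>\<^bsub>G2\<^esub> x2)"
  have R1: "(\<Sum>t\<in>A.T. \<phi> (?r1 t)) = (\<Sum>t\<in>A.T. \<phi> t)" for \<phi> :: "'a \<Rightarrow> real"
    by (rule sum.reindex_bij_betw[OF A.bij_rep_right[OF x(1)]])
  have R2: "(\<Sum>t\<in>B.T. \<phi> (?r2 t)) = (\<Sum>t\<in>B.T. \<phi> t)" for \<phi> :: "'b \<Rightarrow> real"
    by (rule sum.reindex_bij_betw[OF B.bij_rep_right[OF x(2)]])
  have J: "JS h (y1, y2) = (\<Sum>t1\<in>A.T. \<Sum>t2\<in>B.T. ?H (t1 \<otimes>\<^bsub>G1\<^esub> y1, t2 \<otimes>\<^bsub>G2\<^esub> y2))" for y1 y2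
    unfolding JS_def T_prod by (simp add: sum.cartesian_product case_prod_beta mult_DirProd')
  have one1: "t \<otimes>\<^bsub>G1\<^esub> \<one>\<^bsub>G1\<^esub> = t" if "t \<in> A.T" for t by (rule A.r_one[OF A.T_closed[OF that]])
  have one2: "t \<otimes>\<^bsub>G2\<^esub> \<one>\<^bsub>G2\<^esub> = t" if "t \<in> B.T" for t by (rule B.r_one[OF B.T_closed[OF that]])
  have H2: "(\<Sum>t2\<in>B.T. ?H (z, t2 \<otimes>\<^bsub>G2\<^esub> \<one>\<^bsub>G2\<^esub>)) = (\<Sum>t2\<in>B.T. ?H (z, ?r2 t2))" for z
    unfolding R2[of "\<lambda>r. ?H (z, r)"] by (intro sum.cong refl) (simp only: one2)
  have J10: "JS h (x1, \<one>\<^bsub>G2\<^esub>) = (\<Sum>t1\<in>A.T. \<Sum>t2\<in>B.T. ?H (t1 \<otimes>\<^bsub>G1\<^esub> x1, ?r2 t2))"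
    unfolding J by (simp only: H2)
  have J01: "JS h (\<one>\<^bsub>G1\<^esub>, x2) = (\<Sum>t1\<in>A.T. \<Sum>t2\<in>B.T. ?H (?r1 t1, t2 \<otimes>\<^bsub>G2\<^esub> x2))"
    unfolding J R1[of "\<lambda>r. \<Sum>t2\<in>B.T. ?H (r, t2 \<otimes>\<^bsub>G2\<^esub> x2)"] by (intro sum.cong refl) (simp only: one1)
  have J00: "JS h \<one>\<^bsub>G\<^esub> = (\<Sum>t1\<in>A.T. \<Sum>t2\<in>B.T. ?H (?r1 t1, ?r2 t2))"
    unfolding one_DirProd J R1[of "\<lambda>r. \<Sum>t2\<in>B.T. ?H (r, ?r2 t2)"]
    by (simp only: H2) (intro sum.cong refl, simp only: one1)
  have "P.diffop (A.npart (t1 \<otimes>\<^bsub>G1\<^esub> x1), \<one>\<^bsub>G2\<^esub>) (P.diffop (\<one>\<^bsub>G1\<^esub>, B.npart (t2 \<otimes>\<^bsub>G2\<^esub> x2)) ?H) (?r1 t1, ?r2 t2)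
    = ?H (t1 \<otimes>\<^bsub>G1\<^esub> x1, t2 \<otimes>\<^bsub>G2\<^esub> x2) - ?H (t1 \<otimes>\<^bsub>G1\<^esub> x1, ?r2 t2) - (?H (?r1 t1, t2 \<otimes>\<^bsub>G2\<^esub> x2) - ?H (?r1 t1, ?r2 t2))"
    if "t1 \<in> A.T" "t2 \<in> B.T" for t1 t2
  proof -
    have "t1 \<otimes>\<^bsub>G1\<^esub> x1 \<in> carrier G1" "t2 \<otimes>\<^bsub>G2\<^esub> x2 \<in> carrier G2"
      using A.T_closed[OF that(1)] B.T_closed[OF that(2)] x by auto
    then show ?thesis by (simp add: P.diffop_def)
  qed
  then have "(\<Sum>t1\<in>A.T. \<Sum>t2\<in>B.T. P.diffop (A.npart (t1 \<otimes>\<^bsub>G1\<^esub> x1), \<one>\<^bsub>G2\<^esub>)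
      (P.diffop (\<one>\<^bsub>G1\<^esub>, B.npart (t2 \<otimes>\<^bsub>G2\<^esub> x2)) ?H) (?r1 t1, ?r2 t2))
    = (\<Sum>t1\<in>A.T. \<Sum>t2\<in>B.T. ?H (t1 \<otimes>\<^bsub>G1\<^esub> x1, t2 \<otimes>\<^bsub>G2\<^esub> x2) - ?H (t1 \<otimes>\<^bsub>G1\<^esub> x1, ?r2 t2)
        - (?H (?r1 t1, t2 \<otimes>\<^bsub>G2\<^esub> x2) - ?H (?r1 t1, ?r2 t2)))"
    by (intro sum.cong refl)
  then show ?thesis
    unfolding DS_def fst_conv snd_conv J10 J01 J00 J[of x1 x2] sum_subtractf by linarith
qed

text \<open>\<open>c\<^sup>2 * \<Phi> c u\<close> is the smaller of the second-order bound \<open>(c * u)\<^sup>2\<close> and the third-order bound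
  \<open>(c * u) ^ 3\<close>; its expectation is \<open>o(c\<^sup>2)\<close> under a second moment.\<close>

definition \<Phi> :: "real \<Rightarrow> real \<Rightarrow> real" where "\<Phi> c u = u\<^sup>2 * min 1 (c * u)"

text \<open>The second-order bound is immediate from \<open>DS_eq\<close>. For the third-order bound
  the base point is first freed from \<open>t1\<close> and \<open>t2\<close>, at the price of third
  differences; what remains is a transfer sum in \<open>t1\<close>.\<close>

lemma DS_bound:
  obtains K where "0 \<le> K" "\<And>c h x. \<lbrakk>P.smooth3 S c h; 0 \<le> c; x \<in> carrier G\<rbrakk>
    \<Longrightarrow> \<bar>DS h x\<bar> \<le> (real (card P.T))\<^sup>2 * (K * c\<^sup>2 * \<Phi> c (w x))"
proof
  define C1 where "C1 = C * (1 + W)"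
  \<comment> \<open>The first summand comes from moving the base point, the second from the transfer
    sum.\<close>
  define K3 where "K3 = 4 * C * W * C1\<^sup>2 + 2 * (real e)\<^sup>2 * (real (card A.T))\<^sup>2 * C1 ^ 3"
  have C1: "0 \<le> C1" using C_nonneg W_ge_1 by (simp add: C1_def)
  have K3: "0 \<le> K3" using C_nonneg W_ge_1 C1 by (simp add: K3_def)
  show "0 \<le> C1\<^sup>2 + K3" using K3 by simp
  fix c h x assume h: "P.smooth3 S c h" and c: "0 \<le> c" and x: "x \<in> carrier G"
  define n1 n2 n where "n1 = real (card A.T)" and "n2 = real (card B.T)" and "n = real (card P.T)"
  have n: "n = n1 * n2" "0 \<le> n1" "0 \<le> n2" unfolding n1_def n2_def n_def T_prod by (auto simp: card_cartesian_product)
  have n2: "1 \<le> n2" unfolding n2_def using B.finite_rep B.T_nonempty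
    by (metis One_nat_def Suc_leI card_gt_0_iff of_nat_1 of_nat_le_iff)
  obtain x1 x2 where xx: "x = (x1, x2)" "x1 \<in> carrier G1" "x2 \<in> carrier G2" using x by auto
  define u where "u = w x"
  have u: "1 \<le> u" unfolding u_def by (rule w_ge_1[OF x])
  define b where "b = C1 * u"
  have b0: "0 \<le> b" using C1 u by (simp add: b_def)
  let ?a1 = "\<lambda>t. (A.npart (t \<otimes>\<^bsub>G1\<^esub> x1), \<one>\<^bsub>G2\<^esub>)" and ?a2 = "\<lambda>t. (\<one>\<^bsub>G1\<^esub>, B.npart (t \<otimes>\<^bsub>G2\<^esub> x2))"
  let ?w = "\<lambda>t1 t2. (rep1 (t1 \<otimes>\<^bsub>G1\<^esub> x1), rep2 (t2 \<otimes>\<^bsub>G2\<^esub> x2))"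
  have sh: "P.short S b (?a1 t1)" "P.short S b (?a2 t2)" if t: "t1 \<in> A.T" "t2 \<in> B.T" for t1 t2
  proof -
    have T: "(t1, t2) \<in> P.T" using t unfolding T_prod by blast
    have cl: "(t1, t2) \<otimes>\<^bsub>G\<^esub> x \<in> carrier G" by (rule P.m_closed[OF P.T_closed[OF T] x])
    have le: "C * w ((t1, t2) \<otimes>\<^bsub>G\<^esub> x) \<le> b"
      using mult_left_mono[OF w_mult_T(1)[OF x T] C_nonneg] by (simp add: b_def C1_def u_def mult.assoc)
    show "P.short S b (?a1 t1)" "P.short S b (?a2 t2)"
      using P.short_mono[OF short_npart1[OF cl] le] P.short_mono[OF short_npart2[OF cl] le] by (auto simp: xx)
  qed
  have cl: "?w t1 t2 \<in> P.T" "?w t1 t2 \<in> carrier G" "?a1 t1 \<in> carrier G" "?a2 t2 \<in> carrier G"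
    if t: "t1 \<in> A.T" "t2 \<in> B.T" for t1 t2
  proof -
    have "t1 \<otimes>\<^bsub>G1\<^esub> x1 \<in> carrier G1" "t2 \<otimes>\<^bsub>G2\<^esub> x2 \<in> carrier G2"
      using A.T_closed[OF t(1)] B.T_closed[OF t(2)] xx by auto
    then show "?w t1 t2 \<in> P.T" unfolding T_prod by blast
    then show "?w t1 t2 \<in> carrier G" by (rule P.T_closed)
    show "?a1 t1 \<in> carrier G" "?a2 t2 \<in> carrier G"
      using P.short_closed[OF sh(1)[OF t] S_carrier] P.short_closed[OF sh(2)[OF t] S_carrier] .
  qed
  have DS: "DS h x = (\<Sum>t1\<in>A.T. \<Sum>t2\<in>B.T. \<Sum>t\<in>P.T. P.diffop (?a1 t1) (P.diffop (?a2 t2) h) (?w t1 t2 \<otimes>\<^bsub>G\<^esub> t))"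
    unfolding xx(1) DS_eq[OF xx(2,3)] by (intro sum.cong refl diffop_HS cl)
  have bd2: "\<bar>DS h x\<bar> \<le> n\<^sup>2 * (C1\<^sup>2 * u\<^sup>2 * c\<^sup>2)"
  proof -
    have "\<bar>DS h x\<bar> \<le> (\<Sum>t1\<in>A.T. \<Sum>t2\<in>B.T. \<Sum>t\<in>P.T. b * b * c\<^sup>2)"
      unfolding DS
    proof (rule order_trans[OF sum_abs], rule sum_mono, rule order_trans[OF sum_abs], rule sum_mono,
        rule order_trans[OF sum_abs], rule sum_mono)
      fix t1 t2 t assume t: "t1 \<in> A.T" "t2 \<in> B.T" "t \<in> P.T"
      have "?w t1 t2 \<otimes>\<^bsub>G\<^esub> t \<in> carrier G" by (rule P.m_closed[OF cl(2)[OF t(1,2)] P.T_closed[OF t(3)]])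
      then show "\<bar>P.diffop (?a1 t1) (P.diffop (?a2 t2) h) (?w t1 t2 \<otimes>\<^bsub>G\<^esub> t)\<bar> \<le> b * b * c\<^sup>2"
        using h sh[OF t(1,2)] unfolding P.smooth3_def by blast
    qed
    also have "\<dots> = n1 * (n2 * (n * (b * b * c\<^sup>2)))"
      by (simp only: sum_constant n1_def n2_def n_def)
    also have "\<dots> = n\<^sup>2 * (C1\<^sup>2 * u\<^sup>2 * c\<^sup>2)"
      by (simp add: n b_def power2_eq_square)
    finally show ?thesis .
  qed
  have bd3: "\<bar>DS h x\<bar> \<le> n\<^sup>2 * (K3 * u ^ 3 * c ^ 3)"
  proof -
    \<comment> \<open>The right representative \<open>t\<close> runs over all cosets, so the factor
      in front of it can be removed by \<open>coset_sum_shift\<close>.\<close>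
    define E where "E = (\<Sum>t1\<in>A.T. \<Sum>t2\<in>B.T. \<Sum>t\<in>P.T. P.diffop (?a1 t1) (P.diffop (?a2 t2) h) t)"
    have 1: "\<bar>DS h x - E\<bar> \<le> (\<Sum>t1\<in>A.T. \<Sum>t2\<in>B.T. n * (4 * C * W * (b * b * c ^ 3)))"
      unfolding DS E_def sum_subtractf[symmetric]
    proof (rule order_trans[OF sum_abs], rule sum_mono, rule order_trans[OF sum_abs], rule sum_mono)
      fix t1 t2 assume t: "t1 \<in> A.T" "t2 \<in> B.T"
      show "\<bar>(\<Sum>t\<in>P.T. P.diffop (?a1 t1) (P.diffop (?a2 t2) h) (?w t1 t2 \<otimes>\<^bsub>G\<^esub> t) -
           P.diffop (?a1 t1) (P.diffop (?a2 t2) h) t)\<bar> \<le> n * (4 * C * W * (b * b * c ^ 3))"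
        unfolding sum_subtractf n_def
      proof (rule P.coset_sum_shift[OF _ cl(2)[OF t]])
        fix a b' y assume a: "P.short S b' a" "y \<in> carrier G"
        have "\<bar>P.diffop a (P.diffop (?a1 t1) (P.diffop (?a2 t2) h)) y\<bar> \<le> b' * b * b * c ^ 3"
          using h sh[OF t] a unfolding P.smooth3_def by blast
        then show "\<bar>P.diffop (?a1 t1) (P.diffop (?a2 t2) h) (a \<otimes>\<^bsub>G\<^esub> y) - P.diffop (?a1 t1) (P.diffop (?a2 t2) h) y\<bar>
            \<le> b' * (b * b * c ^ 3)"
          by (simp add: P.diffop_def[of a] mult.assoc)
      next
        fix t' assume t': "t' \<in> P.T"
        have "?w t1 t2 \<otimes>\<^bsub>G\<^esub> t' \<in> carrier G" by (rule P.m_closed[OF cl(2)[OF t] P.T_closed[OF t']])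
        from short_npart[OF this] show "P.short S (4 * C * W) (P.npart (?w t1 t2 \<otimes>\<^bsub>G\<^esub> t'))"
        proof (rule P.short_mono)
          \<comment> \<open>A product of two representatives weighs at most \<open>2 * W\<close>,
            and \<open>short_npart\<close> contributes \<open>2 * C\<close>; this is the origin of
            \<open>4 * C * W\<close>.\<close>
          have "w (?w t1 t2 \<otimes>\<^bsub>G\<^esub> t') \<le> 2 * W"
            using w_mult[OF cl(2)[OF t] P.T_closed[OF t']] w_le_W[OF t'] w_le_W[OF cl(1)[OF t]] by linarith
          then have "2 * C * w (?w t1 t2 \<otimes>\<^bsub>G\<^esub> t') \<le> 2 * C * (2 * W)"
            using C_nonneg by (intro mult_left_mono) auto
          then show "2 * C * w (?w t1 t2 \<otimes>\<^bsub>G\<^esub> t') \<le> 4 * C * W" by simp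
        qed
      qed
    qed
    \<comment> \<open>\<open>t1\<close> now occurs only in the direction of a difference, so its sum
      moves innermost and \<open>sum_transfer_diffop\<close> applies.\<close>
    have "E = (\<Sum>t2\<in>B.T. \<Sum>t\<in>P.T. \<Sum>t1\<in>A.T. P.diffop (?a1 t1) (P.diffop (?a2 t2) h) t)"
    proof -
      have "E = (\<Sum>t2\<in>B.T. \<Sum>t1\<in>A.T. \<Sum>t\<in>P.T. P.diffop (?a1 t1) (P.diffop (?a2 t2) h) t)"
        unfolding E_def by (rule sum.swap)
      also have "\<dots> = (\<Sum>t2\<in>B.T. \<Sum>t\<in>P.T. \<Sum>t1\<in>A.T. P.diffop (?a1 t1) (P.diffop (?a2 t2) h) t)"
        by (intro sum.cong refl, rule sum.swap)
      finally show ?thesis .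
    qed
    also have "\<bar>\<dots>\<bar> \<le> (\<Sum>t2\<in>B.T. \<Sum>t\<in>P.T. 2 * (real e * n1 * b)\<^sup>2 * (b * c ^ 3))"
    proof (rule order_trans[OF sum_abs], rule sum_mono, rule order_trans[OF sum_abs], rule sum_mono)
      fix t2 t assume t: "t2 \<in> B.T" "t \<in> P.T"
      have tc: "t \<in> carrier G" by (rule P.T_closed[OF t(2)])
      show "\<bar>\<Sum>t1\<in>A.T. P.diffop (?a1 t1) (P.diffop (?a2 t2) h) t\<bar> \<le> 2 * (real e * n1 * b)\<^sup>2 * (b * c ^ 3)"
        unfolding n1_def
      proof (rule sum_transfer_diffop[OF xx(2) tc _ sh(1)[OF _ t(1)]])
        show "0 \<le> b * c ^ 3" using b0 c by simp
        fix b1 a1 b2 a2 assume s: "P.short S b1 a1" "P.short S b2 a2"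
        obtain t1 where "t1 \<in> A.T" using A.T_nonempty by blast
        then have "P.short S b (?a2 t2)" using sh(2) t(1) by blast
        then have "\<bar>P.diffop a1 (P.diffop a2 (P.diffop (?a2 t2) h)) t\<bar> \<le> b1 * b2 * b * c ^ 3"
          using h s tc unfolding P.smooth3_def by blast
        then show "\<bar>P.diffop a1 (P.diffop a2 (P.diffop (?a2 t2) h)) t\<bar> \<le> b1 * b2 * (b * c ^ 3)"
          by (simp add: mult.assoc)
      qed
    qed
    finally have 2: "\<bar>E\<bar> \<le> n2 * (n * (2 * (real e * n1 * b)\<^sup>2 * (b * c ^ 3)))"
      by (simp add: n2_def n_def)
    have "\<bar>DS h x\<bar> \<le> n1 * (n2 * (n * (4 * C * W * (b * b * c ^ 3)))) + n2 * (n * (2 * (real e * n1 * b)\<^sup>2 * (b * c ^ 3)))"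
      using 1 2 by (simp add: n1_def[symmetric] n2_def[symmetric])
    also have "\<dots> = n\<^sup>2 * (4 * C * W * C1\<^sup>2 * u\<^sup>2 * c ^ 3) + n\<^sup>2 * (2 * (real e)\<^sup>2 * n1 * C1 ^ 3 * u ^ 3 * c ^ 3)"
      unfolding n(1) b_def by (simp add: power2_eq_square power3_eq_cube algebra_simps)
    also have "\<dots> \<le> n\<^sup>2 * (4 * C * W * C1\<^sup>2 * u ^ 3 * c ^ 3) + n\<^sup>2 * (2 * (real e)\<^sup>2 * n1\<^sup>2 * C1 ^ 3 * u ^ 3 * c ^ 3)"
    proof (intro add_mono mult_left_mono mult_right_mono)
      show "u\<^sup>2 \<le> u ^ 3" using u by (intro power_increasing) auto
      show "n1 \<le> n1\<^sup>2" unfolding n1_def by (simp add: power2_nat_le_imp_le self_le_power[of "card A.T" 2] flip: of_nat_power)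
    qed (use C_nonneg W_ge_1 C1 u c in auto)
    also have "\<dots> = n\<^sup>2 * (K3 * u ^ 3 * c ^ 3)"
      by (simp add: K3_def n1_def algebra_simps)
    finally show ?thesis .
  qed
  show "\<bar>DS h x\<bar> \<le> (real (card P.T))\<^sup>2 * ((C1\<^sup>2 + K3) * c\<^sup>2 * \<Phi> c (w x))"
    unfolding n_def[symmetric]
  \<comment> \<open>The point where the minimum in \<open>\<Phi>\<close> switches from the
    second-order to the third-order bound.\<close>
  proof (cases "1 \<le> c * u")
    case True
    have "C1\<^sup>2 * u\<^sup>2 * c\<^sup>2 \<le> (C1\<^sup>2 + K3) * (u\<^sup>2 * c\<^sup>2)"
      unfolding mult.assoc using K3 by (intro mult_right_mono) auto
    then have "n\<^sup>2 * (C1\<^sup>2 * u\<^sup>2 * c\<^sup>2) \<le> n\<^sup>2 * ((C1\<^sup>2 + K3) * (u\<^sup>2 * c\<^sup>2))"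
      by (intro mult_left_mono) auto
    with bd2 True show "\<bar>DS h x\<bar> \<le> n\<^sup>2 * ((C1\<^sup>2 + K3) * c\<^sup>2 * \<Phi> c (w x))" by (simp add: \<Phi>_def u_def[symmetric] mult_ac)
  next
    case False
    have "K3 * u ^ 3 * c ^ 3 \<le> (C1\<^sup>2 + K3) * (u ^ 3 * c ^ 3)"
      unfolding mult.assoc using u c by (intro mult_right_mono) auto
    then have "n\<^sup>2 * (K3 * u ^ 3 * c ^ 3) \<le> n\<^sup>2 * ((C1\<^sup>2 + K3) * (u ^ 3 * c ^ 3))"
      by (intro mult_left_mono) auto
    with bd3 False show "\<bar>DS h x\<bar> \<le> n\<^sup>2 * ((C1\<^sup>2 + K3) * c\<^sup>2 * \<Phi> c (w x))"
      by (simp add: \<Phi>_def u_def[symmetric] power2_eq_square power3_eq_cube mult_ac)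
  qed
qed

end

section \<open>Replacing the factors one at a time\<close>

context group
begin

text \<open>The first \<open>\<kappa>\<close> in \<open>p' ^\<star> R\<close> comes after
  \<open>j\<close> factors \<open>\<eta>'\<close> with probability
  \<open>\<epsilon> * (1 - \<epsilon>) ^ j\<close>. If the first \<open>J\<close> factors contain
  none, the trivial bound 2 is used.\<close>

lemma tv_le_expand_right:
  assumes "supp_on X" "supp_on X'" "supp_on \<kappa>" "supp_on \<eta>'" "0 < \<epsilon>" "\<epsilon> < 1" "J \<le> R"
    and p': "p' = mix_pmf \<epsilon> \<kappa> \<eta>'"
    and "\<And>j. j < J \<Longrightarrow> tv_le (X \<star> \<eta>' ^\<star> j \<star> \<kappa> \<star> p' ^\<star> (R - 1 - j)) (X' \<star> \<eta>' ^\<star> j \<star> \<kappa> \<star> p' ^\<star> (R - 1 - j)) (b j)"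
  shows "tv_le (X \<star> p' ^\<star> R) (X' \<star> p' ^\<star> R) ((\<Sum>j<J. \<epsilon> * (1 - \<epsilon>) ^ j * b j) + 2 * (1 - \<epsilon>) ^ J)"
  using assms(1,2,7,9)
proof (induction J arbitrary: X X' R b)
  case 0
  then show ?case using tv_le_two by simp
next
  case (Suc J)
  have supp: "supp_on p'" using assms(3-6) p' by (auto simp: supp_on_def set_mix)
  obtain R0 where R: "R = Suc R0" using Suc.prems(3) by (cases R) auto
  have split: "Z \<star> p' ^\<star> R = mix_pmf \<epsilon> (Z \<star> \<kappa> \<star> p' ^\<star> R0) ((Z \<star> \<eta>') \<star> p' ^\<star> R0)" if "supp_on Z" for Z
  proof -
    have "Z \<star> p' ^\<star> R = Z \<star> (p' \<star> p' ^\<star> R0)" unfolding R by (simp only: cpow_Suc_left[OF supp])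
    also have "p' \<star> p' ^\<star> R0 = mix_pmf \<epsilon> (\<kappa> \<star> p' ^\<star> R0) (\<eta>' \<star> p' ^\<star> R0)"
      by (subst (1) p') (rule conv_mix_left)
    finally show ?thesis using that assms(4) supp by (simp add: conv_mix_right conv_assoc)
  qed
  have 0: "tv_le (X \<star> \<kappa> \<star> p' ^\<star> R0) (X' \<star> \<kappa> \<star> p' ^\<star> R0) (b 0)"
    using Suc.prems(4)[of 0] Suc.prems(1,2) assms(3) supp by (simp add: R conv_assoc)
  have "tv_le ((X \<star> \<eta>') \<star> p' ^\<star> R0) ((X' \<star> \<eta>') \<star> p' ^\<star> R0)
      ((\<Sum>j<J. \<epsilon> * (1 - \<epsilon>) ^ j * b (Suc j)) + 2 * (1 - \<epsilon>) ^ J)"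
  proof (rule Suc.IH)
    fix j assume j: "j < J"
    have e: "(Z \<star> \<eta>') \<star> \<eta>' ^\<star> j \<star> \<kappa> \<star> p' ^\<star> (R0 - 1 - j) = Z \<star> \<eta>' ^\<star> Suc j \<star> \<kappa> \<star> p' ^\<star> (R - 1 - Suc j)"
      if "supp_on Z" for Z
      unfolding cpow_Suc_left[OF assms(4)] using that assms(3,4) supp by (simp add: R conv_assoc)
    show "tv_le ((X \<star> \<eta>') \<star> \<eta>' ^\<star> j \<star> \<kappa> \<star> p' ^\<star> (R0 - 1 - j)) ((X' \<star> \<eta>') \<star> \<eta>' ^\<star> j \<star> \<kappa> \<star> p' ^\<star> (R0 - 1 - j)) (b (Suc j))"
      unfolding e[OF Suc.prems(1)] e[OF Suc.prems(2)] by (rule Suc.prems(4)) (use j in simp)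
  qed (use Suc.prems(1-3) assms(4) R in auto)
  from tv_le_mix[OF _ _ 0 this, of \<epsilon>] have
    "tv_le (X \<star> p' ^\<star> R) (X' \<star> p' ^\<star> R)
      (\<epsilon> * b 0 + (1 - \<epsilon>) * ((\<Sum>j<J. \<epsilon> * (1 - \<epsilon>) ^ j * b (Suc j)) + 2 * (1 - \<epsilon>) ^ J))"
    unfolding split[OF Suc.prems(1)] split[OF Suc.prems(2)] using assms(5,6) by simp
  then show ?case
    unfolding sum.lessThan_Suc_shift by (simp add: sum_distrib_left distrib_left mult_ac add.assoc)
qed

text \<open>The last \<open>\<kappa>\<close> in \<open>p ^\<star> k\<close> is followed by
  \<open>i\<close> factors \<open>\<eta>\<close>, and what precedes it is dropped as a contraction.
  There is no truncation: the case without \<open>\<kappa>\<close> gets its own bound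
  \<open>b'\<close>.\<close>

lemma tv_le_expand_left:
  assumes "supp_on Y" "supp_on Y'" "supp_on \<kappa>" "supp_on \<eta>" "0 < \<epsilon>" "\<epsilon> < 1"
    and p: "p = mix_pmf \<epsilon> \<kappa> \<eta>"
    and "\<And>i. i < k \<Longrightarrow> tv_le (\<kappa> \<star> \<eta> ^\<star> i \<star> Y) (\<kappa> \<star> \<eta> ^\<star> i \<star> Y') (b i)"
    and "tv_le (\<eta> ^\<star> k \<star> Y) (\<eta> ^\<star> k \<star> Y') b'"
  shows "tv_le (p ^\<star> k \<star> Y) (p ^\<star> k \<star> Y') ((\<Sum>i<k. \<epsilon> * (1 - \<epsilon>) ^ i * b i) + (1 - \<epsilon>) ^ k * b')"
  using assms(1,2,8,9)
proof (induction k arbitrary: Y Y' b)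
  case 0
  then show ?case by simp
next
  case (Suc k)
  have supp: "supp_on p" using assms(3-6) p by (auto simp: supp_on_def set_mix)
  have split: "p ^\<star> Suc k \<star> Z = mix_pmf \<epsilon> (p ^\<star> k \<star> \<kappa> \<star> Z) (p ^\<star> k \<star> \<eta> \<star> Z)" if "supp_on Z" for Z
  proof -
    have "p ^\<star> Suc k \<star> Z = p ^\<star> k \<star> (p \<star> Z)" using that supp by (simp add: conv_assoc)
    also have "p \<star> Z = mix_pmf \<epsilon> (\<kappa> \<star> Z) (\<eta> \<star> Z)" unfolding p by (rule conv_mix_left)
    finally show ?thesis by (simp add: conv_mix_right)
  qed
  have 0: "tv_le (p ^\<star> k \<star> \<kappa> \<star> Y) (p ^\<star> k \<star> \<kappa> \<star> Y') (b 0)"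
    using tv_le_conv_left[OF Suc.prems(3)[of 0], of "p ^\<star> k"] Suc.prems(1,2) by simp
  have e: "Z' \<star> \<eta> ^\<star> i \<star> \<eta> \<star> Z = Z' \<star> \<eta> ^\<star> Suc i \<star> Z" if "supp_on Z" for Z Z' i
    using that assms(4) by (simp add: conv_assoc)
  have e': "\<eta> ^\<star> k \<star> \<eta> \<star> Z = \<eta> ^\<star> Suc k \<star> Z" if "supp_on Z" for Z
    using that assms(4) by (simp add: conv_assoc)
  have "tv_le (p ^\<star> k \<star> \<eta> \<star> Y) (p ^\<star> k \<star> \<eta> \<star> Y') ((\<Sum>i<k. \<epsilon> * (1 - \<epsilon>) ^ i * b (Suc i)) + (1 - \<epsilon>) ^ k * b')"
  proof (rule Suc.IH)
    show "tv_le (\<kappa> \<star> \<eta> ^\<star> i \<star> \<eta> \<star> Y) (\<kappa> \<star> \<eta> ^\<star> i \<star> \<eta> \<star> Y') (b (Suc i))" if "i < k" for i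
      unfolding e[OF Suc.prems(1)] e[OF Suc.prems(2)] by (rule Suc.prems(3)) (use that in simp)
    show "tv_le (\<eta> ^\<star> k \<star> \<eta> \<star> Y) (\<eta> ^\<star> k \<star> \<eta> \<star> Y') b'"
      unfolding e'[OF Suc.prems(1)] e'[OF Suc.prems(2)] by (rule Suc.prems(4))
  qed (use Suc.prems(1,2) assms(4) in auto)
  from tv_le_mix[OF _ _ 0 this, of \<epsilon>] have
    "tv_le (p ^\<star> Suc k \<star> Y) (p ^\<star> Suc k \<star> Y')
      (\<epsilon> * b 0 + (1 - \<epsilon>) * ((\<Sum>i<k. \<epsilon> * (1 - \<epsilon>) ^ i * b (Suc i)) + (1 - \<epsilon>) ^ k * b'))"
    unfolding split[OF Suc.prems(1)] split[OF Suc.prems(2)] using assms(5,6) by simp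
  then show ?case
    unfolding sum.lessThan_Suc_shift by (simp add: sum_distrib_left distrib_left mult_ac add.assoc)
qed

text \<open>The hybrids have \<open>p\<close> to the left and \<open>p'\<close> to the right of the
  exchanged position, so at least \<open>M\<close> factors \<open>p'\<close> always remain behind it
  for smoothing.\<close>

lemma tv_le_telescope:
  assumes "supp_on p" "supp_on p'"
    and "\<And>k. k < N \<Longrightarrow> tv_le (p ^\<star> k \<star> p \<star> p' ^\<star> (N - 1 - k + M)) (p ^\<star> k \<star> p' \<star> p' ^\<star> (N - 1 - k + M)) (\<tau> k)"
  shows "tv_le (p ^\<star> N \<star> p' ^\<star> M) (p' ^\<star> N \<star> p' ^\<star> M) (\<Sum>k<N. \<tau> k)"
proof -
  have "n \<le> N \<Longrightarrow> tv_le (p ^\<star> n \<star> p' ^\<star> (N - n + M)) (p' ^\<star> (N + M)) (\<Sum>k<n. \<tau> k)" for n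
  proof (induction n)
    case 0
    then show ?case using assms(2) by (simp add: tv_le_refl)
  next
    case (Suc n)
    define m where "m = N - 1 - n + M"
    have N: "N - n + M = Suc m" "N - Suc n + M = m" using Suc.prems by (auto simp: m_def)
    have "tv_le (p ^\<star> n \<star> p \<star> p' ^\<star> m) (p ^\<star> n \<star> p' \<star> p' ^\<star> m) (\<tau> n)"
      unfolding m_def by (rule assms(3)) (use Suc.prems in simp)
    then have 1: "tv_le (p ^\<star> Suc n \<star> p' ^\<star> m) (p ^\<star> n \<star> p' ^\<star> Suc m) (\<tau> n)"
      unfolding cpow_Suc_left[OF assms(2)] using assms(1,2) by (simp add: conv_assoc)
    have 2: "tv_le (p ^\<star> n \<star> p' ^\<star> Suc m) (p' ^\<star> (N + M)) (\<Sum>k<n. \<tau> k)"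
      using Suc.IH Suc.prems unfolding N(1) by simp
    show ?case using tv_le_trans[OF 1 2] unfolding N(2) by (simp add: add.commute)
  qed
  from this[of N] show ?thesis using assms(2) by (simp add: cpow_add)
qed

text \<open>The component \<open>\<kappa>\<close> is common, so exchanging the mixtures amounts to
  exchanging the remainders.\<close>

lemma tv_le_mix_diff:
  assumes "supp_on X" "supp_on Y" "supp_on \<kappa>" "supp_on \<eta>" "supp_on \<eta>'" "0 < \<epsilon>" "\<epsilon> < 1"
    and "tv_le (X \<star> \<eta> \<star> Y) (X \<star> \<eta>' \<star> Y) c"
  shows "tv_le (X \<star> mix_pmf \<epsilon> \<kappa> \<eta> \<star> Y) (X \<star> mix_pmf \<epsilon> \<kappa> \<eta>' \<star> Y) c"
proof -
  have c: "0 \<le> c" by (rule tv_le_nonneg[OF assms(8)])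
  have "tv_le (mix_pmf \<epsilon> (X \<star> \<kappa> \<star> Y) (X \<star> \<eta> \<star> Y)) (mix_pmf \<epsilon> (X \<star> \<kappa> \<star> Y) (X \<star> \<eta>' \<star> Y)) (\<epsilon> * 0 + (1 - \<epsilon>) * c)"
    by (rule tv_le_mix[OF _ _ tv_le_refl assms(8)]) (use assms(6,7) in auto)
  then show ?thesis
    unfolding conv_mix_left conv_mix_right
    by (rule tv_le_mono) (use mult_right_mono[of "1 - \<epsilon>" 1 c] c assms(6) in simp)
qed

lemma smooth3_cong:
  assumes "smooth3 S c h" "S \<subseteq> carrier G" "\<And>x. x \<in> carrier G \<Longrightarrow> h x = h' x"
  shows "smooth3 S c h'"
proof -
  have 1: "diffop a h y = diffop a h' y" if "a \<in> carrier G" "y \<in> carrier G" for a y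
    using that assms(3) by (rule diffop_cong[rotated])
  have 2: "diffop a (diffop b h) y = diffop a (diffop b h') y"
    if "a \<in> carrier G" "b \<in> carrier G" "y \<in> carrier G" for a b y
    by (rule diffop_cong[OF 1]) (use that in auto)
  have 3: "diffop a (diffop b (diffop d h)) y = diffop a (diffop b (diffop d h')) y"
    if "a \<in> carrier G" "b \<in> carrier G" "d \<in> carrier G" "y \<in> carrier G" for a b d y
    by (rule diffop_cong[OF 2]) (use that in auto)
  note cl = short_closed[OF _ assms(2)]
  show ?thesis
    unfolding smooth3_def
  proof (intro conjI allI impI ballI)
    fix b1 a1 y assume s: "short S b1 a1" and y: "y \<in> carrier G"
    show "\<bar>diffop a1 h' y\<bar> \<le> b1 * c"
      using assms(1) s y unfolding smooth3_def 1[OF cl[OF s] y, symmetric] by blast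
  next
    fix b1 a1 b2 a2 y assume s: "short S b1 a1" "short S b2 a2" and y: "y \<in> carrier G"
    show "\<bar>diffop a1 (diffop a2 h') y\<bar> \<le> b1 * b2 * c ^ 2"
      using assms(1) s y unfolding smooth3_def 2[OF cl[OF s(1)] cl[OF s(2)] y, symmetric] by blast
  next
    fix b1 a1 b2 a2 b3 a3 y assume s: "short S b1 a1" "short S b2 a2" "short S b3 a3" and y: "y \<in> carrier G"
    show "\<bar>diffop a1 (diffop a2 (diffop a3 h')) y\<bar> \<le> b1 * b2 * b3 * c ^ 3"
      using assms(1) s y unfolding smooth3_def 3[OF cl[OF s(1)] cl[OF s(2)] cl[OF s(3)] y, symmetric] by blast
  qed
qed

text \<open>Three leading blocks of length \<open>r\<close> absorb the differences; the other
  factors are averaged into the test function.\<close>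

lemma smooth3_cpow:
  assumes S: "S \<subseteq> carrier G" and conj: "\<And>y s. y \<in> carrier G \<Longrightarrow> s \<in> S \<Longrightarrow> y \<otimes> s \<otimes> inv y \<in> S"
    and p: "supp_on p" and tv: "\<And>s. s \<in> S \<Longrightarrow> tv_le (return_pmf s \<star> p ^\<star> r) (p ^\<star> r) c"
    and f: "\<And>x. \<bar>f x\<bar> \<le> 1" and c: "0 \<le> c" and R: "3 * r \<le> R"
  shows "smooth3 S c (avop (p ^\<star> R) f)"
proof (rule smooth3_cong[OF _ S])
  let ?q = "p ^\<star> r"
  let ?f = "avop (p ^\<star> (R - 3 * r)) f"
  have q: "supp_on ?q" "supp_on (p ^\<star> (R - 3 * r))" using p by auto
  have b0: "\<bar>?f x\<bar> \<le> 1" if "x \<in> carrier G" for x by (rule avop_bounded[OF q(2) that f])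
  show "smooth3 S c (avop ?q (avop ?q (avop ?q ?f)))"
    by (rule smooth3_avop[OF S conj q(1) tv b0 c])
  fix x assume x: "x \<in> carrier G"
  have e: "?q \<star> ?q \<star> ?q \<star> p ^\<star> (R - 3 * r) = p ^\<star> R"
  proof -
    have "R = r + (r + (r + (R - 3 * r)))" using R by simp
    then show ?thesis using p by (metis cpow_add)
  qed
  have s2: "supp_on (?q \<star> p ^\<star> (R - 3 * r))" "supp_on (?q \<star> ?q \<star> p ^\<star> (R - 3 * r))" using q by auto
  have "avop ?q (avop ?q (avop ?q ?f)) x = avop ?q (avop ?q (avop (?q \<star> p ^\<star> (R - 3 * r)) f)) x"
  proof (rule avop_restrict[OF q(1) x], rule avop_restrict[OF q(1)])
    show "avop ?q ?f z = avop (?q \<star> p ^\<star> (R - 3 * r)) f z" if "z \<in> carrier G" for z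
      by (rule avop_conv[OF q that f])
  qed
  also have "\<dots> = avop ?q (avop (?q \<star> ?q \<star> p ^\<star> (R - 3 * r)) f) x"
    by (rule avop_restrict[OF q(1) x], rule avop_conv[OF q(1) s2(1) _ f])
  also have "\<dots> = avop (?q \<star> ?q \<star> ?q \<star> p ^\<star> (R - 3 * r)) f x"
    by (rule avop_conv[OF q(1) s2(2) x f])
  also note e
  finally show "avop ?q (avop ?q (avop ?q ?f)) x = avop (p ^\<star> R) f x" .
qed

end

section \<open>Exchanging a segment next to one or two copies of \<open>\<kappa>\<close>\<close>

context two_transversals
begin

abbreviation pconv :: "('a \<times> 'b) pmf \<Rightarrow> ('a \<times> 'b) pmf \<Rightarrow> ('a \<times> 'b) pmf" (infixr "\<odot>" 75) where
  "p \<odot> q \<equiv> convolution G p q"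

abbreviation ppow :: "('a \<times> 'b) pmf \<Rightarrow> nat \<Rightarrow> ('a \<times> 'b) pmf" (infixr "^\<odot>" 80) where
  "p ^\<odot> n \<equiv> conv_power G p n"

definition \<kappa> :: "('a \<times> 'b) pmf" where "\<kappa> = pmf_of_set P.T"

definition nT :: real where "nT = real (card P.T)"

lemma set_\<kappa>: "set_pmf \<kappa> = P.T"
  unfolding \<kappa>_def by (rule set_pmf_of_set[OF P.T_nonempty P.finite_rep])

lemma supp_on_\<kappa>: "P.supp_on \<kappa>"
  unfolding P.supp_on_def set_\<kappa> by (rule subsetI) (rule P.T_closed)

lemma nT_pos: "0 < nT"
  unfolding nT_def using P.finite_rep P.T_nonempty by (simp only: of_nat_0_less_iff card_gt_0_iff) blast

lemma expect_\<kappa>: "expect \<kappa> f = (\<Sum>t\<in>P.T. f t) / nT"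
  unfolding \<kappa>_def nT_def by (rule integral_pmf_of_set[OF P.T_nonempty P.finite_rep])

lemma expect_\<kappa>_conv:
  assumes "P.supp_on q" "y \<in> carrier G" "\<And>x. \<bar>f x\<bar> \<le> 1"
  shows "expect (\<kappa> \<odot> q) (\<lambda>z. f (y \<otimes>\<^bsub>G\<^esub> z)) = HS (P.avop q f) y / nT"
proof -
  have "expect (\<kappa> \<odot> q) (\<lambda>z. f (y \<otimes>\<^bsub>G\<^esub> z)) = (\<Sum>t\<in>P.T. expect q (\<lambda>z. f (y \<otimes>\<^bsub>G\<^esub> (t \<otimes>\<^bsub>G\<^esub> z)))) / nT"
    using assms(3) by (subst P.expect_conv[where M = 1]) (auto simp: expect_\<kappa>)
  also have "(\<Sum>t\<in>P.T. expect q (\<lambda>z. f (y \<otimes>\<^bsub>G\<^esub> (t \<otimes>\<^bsub>G\<^esub> z)))) = HS (P.avop q f) y"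
    unfolding HS_def P.avop_def
  proof (intro sum.cong refl expect_cong)
    fix t z assume "t \<in> P.T" "z \<in> set_pmf q"
    then have "t \<in> carrier G" "z \<in> carrier G" using P.T_closed P.supp_onD[OF assms(1)] by blast+
    then show "f (y \<otimes>\<^bsub>G\<^esub> (t \<otimes>\<^bsub>G\<^esub> z)) = f (y \<otimes>\<^bsub>G\<^esub> t \<otimes>\<^bsub>G\<^esub> z)"
      using assms(2) by (simp only: P.m_assoc)
  qed
  finally show ?thesis .
qed

lemma HS_bounded: "(\<And>x. \<bar>h x\<bar> \<le> 1) \<Longrightarrow> \<bar>HS h y\<bar> \<le> nT"
  unfolding HS_def nT_def
  by (rule order_trans[OF sum_abs], rule order_trans[OF sum_mono[where g = "\<lambda>_. 1"]])
     (simp_all only: sum_constant mult_1_right order_refl)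

lemma JS_bounded:
  assumes "\<And>x. \<bar>h x\<bar> \<le> 1"
  shows "\<bar>JS h y\<bar> \<le> nT * nT"
proof -
  have "\<bar>JS h y\<bar> \<le> (\<Sum>t\<in>P.T. \<bar>HS h (t \<otimes>\<^bsub>G\<^esub> y)\<bar>)" unfolding JS_def by (rule sum_abs)
  also have "\<dots> \<le> (\<Sum>t\<in>P.T. nT)" by (rule sum_mono) (rule HS_bounded[OF assms])
  also have "\<dots> = nT * nT" by (simp only: sum_constant nT_def)
  finally show ?thesis .
qed

lemma avop_bounded_total: "(\<And>x. \<bar>f x\<bar> \<le> 1) \<Longrightarrow> \<bar>P.avop q f y\<bar> \<le> 1"
  unfolding P.avop_def by (rule abs_expect_le) auto

lemma expect_sandwich:
  assumes "P.supp_on \<zeta>" "P.supp_on q" "\<And>x. \<bar>f x\<bar> \<le> 1"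
  shows "expect (\<kappa> \<odot> \<zeta> \<odot> \<kappa> \<odot> q) f = expect \<zeta> (JS (P.avop q f)) / (nT * nT)"
proof -
  let ?h = "P.avop q f"
  have h: "\<bar>?h x\<bar> \<le> 1" for x by (rule avop_bounded_total[OF assms(3)])
  have "expect (\<kappa> \<odot> \<zeta> \<odot> \<kappa> \<odot> q) f = (\<Sum>t\<in>P.T. expect (\<zeta> \<odot> \<kappa> \<odot> q) (\<lambda>x. f (t \<otimes>\<^bsub>G\<^esub> x))) / nT"
    by (subst P.expect_conv[where M = 1]) (auto simp: expect_\<kappa> assms(3))
  also have "(\<Sum>t\<in>P.T. expect (\<zeta> \<odot> \<kappa> \<odot> q) (\<lambda>x. f (t \<otimes>\<^bsub>G\<^esub> x))) = (\<Sum>t\<in>P.T. expect \<zeta> (\<lambda>x. HS ?h (t \<otimes>\<^bsub>G\<^esub> x) / nT))"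
  proof (intro sum.cong refl)
    fix t assume "t \<in> P.T"
    then have t: "t \<in> carrier G" by (rule P.T_closed)
    have "expect (\<zeta> \<odot> \<kappa> \<odot> q) (\<lambda>x. f (t \<otimes>\<^bsub>G\<^esub> x)) = expect \<zeta> (\<lambda>x. expect (\<kappa> \<odot> q) (\<lambda>z. f (t \<otimes>\<^bsub>G\<^esub> (x \<otimes>\<^bsub>G\<^esub> z))))"
      by (subst P.expect_conv[where M = 1]) (auto simp: assms(3))
    also have "\<dots> = expect \<zeta> (\<lambda>x. HS ?h (t \<otimes>\<^bsub>G\<^esub> x) / nT)"
    proof (rule expect_cong)
      fix x assume "x \<in> set_pmf \<zeta>"
      then have x: "x \<in> carrier G" by (rule P.supp_onD[OF assms(1)])
      have "expect (\<kappa> \<odot> q) (\<lambda>z. f (t \<otimes>\<^bsub>G\<^esub> (x \<otimes>\<^bsub>G\<^esub> z))) = expect (\<kappa> \<odot> q) (\<lambda>z. f ((t \<otimes>\<^bsub>G\<^esub> x) \<otimes>\<^bsub>G\<^esub> z))"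
      proof (rule expect_cong)
        fix z assume "z \<in> set_pmf (\<kappa> \<odot> q)"
        then have "z \<in> carrier G" by (rule P.supp_onD[OF P.supp_on_conv[OF supp_on_\<kappa> assms(2)]])
        then show "f (t \<otimes>\<^bsub>G\<^esub> (x \<otimes>\<^bsub>G\<^esub> z)) = f ((t \<otimes>\<^bsub>G\<^esub> x) \<otimes>\<^bsub>G\<^esub> z)" using t x by (simp only: P.m_assoc)
      qed
      also have "\<dots> = HS ?h (t \<otimes>\<^bsub>G\<^esub> x) / nT"
        by (rule expect_\<kappa>_conv[OF assms(2) P.m_closed[OF t x] assms(3)])
      finally show "expect (\<kappa> \<odot> q) (\<lambda>z. f (t \<otimes>\<^bsub>G\<^esub> (x \<otimes>\<^bsub>G\<^esub> z))) = HS ?h (t \<otimes>\<^bsub>G\<^esub> x) / nT" .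
    qed
    finally show "expect (\<zeta> \<odot> \<kappa> \<odot> q) (\<lambda>x. f (t \<otimes>\<^bsub>G\<^esub> x)) = expect \<zeta> (\<lambda>x. HS ?h (t \<otimes>\<^bsub>G\<^esub> x) / nT)" .
  qed
  also have "\<dots> = expect \<zeta> (JS ?h) / nT"
  proof -
    have "integrable (measure_pmf \<zeta>) (\<lambda>x. HS ?h (t \<otimes>\<^bsub>G\<^esub> x))" for t
      by (rule integrable_pmf_bounded) (rule HS_bounded[OF h])
    then show ?thesis
      unfolding JS_def by (simp only: integral_divide_zero sum_divide_distrib[symmetric] Bochner_Integration.integral_sum)
  qed
  finally show ?thesis by simp
qed

text \<open>Both laws are compared with the value of \<open>HS\<close> at the identity, so their
  first moments enter additively.\<close>

lemma tv_le_first_order: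
  assumes "P.supp_on \<zeta>" "P.supp_on \<zeta>'" "P.supp_on q" "0 \<le> c" "0 \<le> B" "0 \<le> B'"
    and sm: "\<And>f. (\<And>x. \<bar>f x\<bar> \<le> 1) \<Longrightarrow> P.smooth3 S c (P.avop q f)"
    and B: "(\<integral>\<^sup>+x. ennreal (w x) \<partial>\<zeta>) \<le> ennreal B" "(\<integral>\<^sup>+x. ennreal (w x) \<partial>\<zeta>') \<le> ennreal B'"
  shows "tv_le (\<zeta> \<odot> \<kappa> \<odot> q) (\<zeta>' \<odot> \<kappa> \<odot> q) (2 * C * (1 + W) * c * (B + B'))"
  unfolding tv_le_def
proof (intro allI impI)
  fix f :: "'a \<times> 'b \<Rightarrow> real" assume "\<forall>x. \<bar>f x\<bar> \<le> 1"
  then have f: "\<bar>f x\<bar> \<le> 1" for x by blast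
  let ?h = "P.avop q f"
  let ?k = "2 * C * (1 + W) * c"
  have h: "\<bar>?h x\<bar> \<le> 1" for x by (rule avop_bounded_total[OF f])
  have k: "0 \<le> ?k" using C_nonneg W_ge_1 assms(4) by simp
  have "\<bar>expect (\<mu> \<odot> \<kappa> \<odot> q) f - HS ?h \<one>\<^bsub>G\<^esub> / nT\<bar> \<le> ?k * Bm"
    if \<mu>: "P.supp_on \<mu>" "0 \<le> Bm" "(\<integral>\<^sup>+x. ennreal (w x) \<partial>\<mu>) \<le> ennreal Bm" for \<mu> Bm
  proof -
    have int: "integrable (measure_pmf \<mu>) (\<lambda>x. HS ?h x / nT)"
      by (rule integrable_pmf_bounded[where M = "nT / nT"])
         (use nT_pos HS_bounded[OF h] in \<open>simp add: divide_right_mono\<close>)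
    have "expect (\<mu> \<odot> \<kappa> \<odot> q) f = expect \<mu> (\<lambda>x. expect (\<kappa> \<odot> q) (\<lambda>z. f (x \<otimes>\<^bsub>G\<^esub> z)))"
      by (rule P.expect_conv) (rule f)
    also have "\<dots> = expect \<mu> (\<lambda>x. HS ?h x / nT)"
      by (intro expect_cong expect_\<kappa>_conv[OF assms(3) _ f] P.supp_onD[OF \<mu>(1)])
    finally have "expect (\<mu> \<odot> \<kappa> \<odot> q) f - HS ?h \<one>\<^bsub>G\<^esub> / nT = expect \<mu> (\<lambda>x. HS ?h x / nT - HS ?h \<one>\<^bsub>G\<^esub> / nT)"
      using int by simp
    also have "\<bar>\<dots>\<bar> \<le> ?k * Bm"
    proof (rule abs_expect_le_nn_integral[OF _ k \<mu>(2,3)])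
      fix x assume "x \<in> set_pmf \<mu>"
      then have x: "x \<in> carrier G" by (rule P.supp_onD[OF \<mu>(1)])
      have "\<bar>HS ?h x - HS ?h \<one>\<^bsub>G\<^esub>\<bar> \<le> nT * (2 * C * (1 + W) * w x * c)"
        unfolding nT_def by (rule HS_first_order[OF sm[OF f] x assms(4)])
      then have "\<bar>HS ?h x - HS ?h \<one>\<^bsub>G\<^esub>\<bar> / nT \<le> 2 * C * (1 + W) * w x * c"
        using nT_pos by (simp add: field_simps)
      then show "\<bar>HS ?h x / nT - HS ?h \<one>\<^bsub>G\<^esub> / nT\<bar> \<le> ?k * w x"
        using nT_pos by (simp add: diff_divide_distrib[symmetric] abs_divide mult_ac)
    qed
    finally show ?thesis .
  qed
  from this[OF assms(1,5) B(1)] this[OF assms(2,6) B(2)]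
  show "\<bar>expect (\<zeta> \<odot> \<kappa> \<odot> q) f - expect (\<zeta>' \<odot> \<kappa> \<odot> q) f\<bar> \<le> ?k * (B + B')"
    unfolding distrib_left by linarith
qed

text \<open>Equal marginals allow \<open>JS\<close> to be replaced by \<open>DS\<close> in the
  difference of expectations; the two expectations of \<open>DS\<close> are then bounded
  separately.\<close>

lemma tv_le_sandwich:
  obtains K where "0 \<le> K" "\<And>\<zeta> \<zeta>' q c B B'. \<lbrakk>P.supp_on \<zeta>; P.supp_on \<zeta>'; P.supp_on q; 0 \<le> c; 0 \<le> B; 0 \<le> B';
      map_pmf fst \<zeta> = map_pmf fst \<zeta>'; map_pmf snd \<zeta> = map_pmf snd \<zeta>';
      \<And>f. (\<And>x. \<bar>f x\<bar> \<le> 1) \<Longrightarrow> P.smooth3 S c (P.avop q f);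
      (\<integral>\<^sup>+x. ennreal (\<Phi> c (w x)) \<partial>\<zeta>) \<le> ennreal B; (\<integral>\<^sup>+x. ennreal (\<Phi> c (w x)) \<partial>\<zeta>') \<le> ennreal B'\<rbrakk>
    \<Longrightarrow> tv_le (\<kappa> \<odot> \<zeta> \<odot> \<kappa> \<odot> q) (\<kappa> \<odot> \<zeta>' \<odot> \<kappa> \<odot> q) (K * c\<^sup>2 * (B + B'))"
proof -
  obtain K where K: "0 \<le> K" "\<And>c h x. \<lbrakk>P.smooth3 S c h; 0 \<le> c; x \<in> carrier G\<rbrakk>
    \<Longrightarrow> \<bar>DS h x\<bar> \<le> (real (card P.T))\<^sup>2 * (K * c\<^sup>2 * \<Phi> c (w x))"
    using DS_bound by blast
  have "tv_le (\<kappa> \<odot> \<zeta> \<odot> \<kappa> \<odot> q) (\<kappa> \<odot> \<zeta>' \<odot> \<kappa> \<odot> q) (K * c\<^sup>2 * (B + B'))"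
    if supp: "P.supp_on \<zeta>" "P.supp_on \<zeta>'" "P.supp_on q" and c: "0 \<le> c" and B0: "0 \<le> B" "0 \<le> B'"
      and mar: "map_pmf fst \<zeta> = map_pmf fst \<zeta>'" "map_pmf snd \<zeta> = map_pmf snd \<zeta>'"
      and sm: "\<And>f. (\<And>x. \<bar>f x\<bar> \<le> 1) \<Longrightarrow> P.smooth3 S c (P.avop q f)"
      and B: "(\<integral>\<^sup>+x. ennreal (\<Phi> c (w x)) \<partial>\<zeta>) \<le> ennreal B" "(\<integral>\<^sup>+x. ennreal (\<Phi> c (w x)) \<partial>\<zeta>') \<le> ennreal B'"
    for \<zeta> \<zeta>' q c B B'
    unfolding tv_le_def
  proof (intro allI impI)
    fix f :: "'a \<times> 'b \<Rightarrow> real" assume "\<forall>x. \<bar>f x\<bar> \<le> 1"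
    then have f: "\<bar>f x\<bar> \<le> 1" for x by blast
    let ?h = "P.avop q f"
    have h: "\<bar>?h x\<bar> \<le> 1" for x by (rule avop_bounded_total[OF f])
    let ?D = "\<lambda>\<mu>. expect \<mu> (DS ?h)"
    have J: "expect \<mu> (JS ?h) = ?D \<mu> + expect (map_pmf fst \<mu>) (\<lambda>y. JS ?h (y, \<one>\<^bsub>G2\<^esub>))
        + expect (map_pmf snd \<mu>) (\<lambda>y. JS ?h (\<one>\<^bsub>G1\<^esub>, y)) - JS ?h \<one>\<^bsub>G\<^esub>" for \<mu>
    proof -
      have int: "integrable (measure_pmf \<mu>) (\<lambda>x. JS ?h (u x))" for u
        by (rule integrable_pmf_bounded) (rule JS_bounded[OF h])
      have "?D \<mu> = expect \<mu> (JS ?h) - expect \<mu> (\<lambda>x. JS ?h (fst x, \<one>\<^bsub>G2\<^esub>)) - expect \<mu> (\<lambda>x. JS ?h (\<one>\<^bsub>G1\<^esub>, snd x)) + JS ?h \<one>\<^bsub>G\<^esub>"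
        unfolding DS_def using int[of "\<lambda>x. x"] int by simp
      then show ?thesis by simp
    qed
    have D: "\<bar>?D \<mu>\<bar> \<le> nT * nT * (K * c\<^sup>2) * Bm"
      if \<mu>: "P.supp_on \<mu>" "0 \<le> Bm" "(\<integral>\<^sup>+x. ennreal (\<Phi> c (w x)) \<partial>\<mu>) \<le> ennreal Bm" for \<mu> Bm
    proof (rule abs_expect_le_nn_integral[OF _ _ \<mu>(2,3)])
      fix x assume "x \<in> set_pmf \<mu>"
      then have x: "x \<in> carrier G" by (rule P.supp_onD[OF \<mu>(1)])
      show "\<bar>DS ?h x\<bar> \<le> nT * nT * (K * c\<^sup>2) * \<Phi> c (w x)"
        using K(2)[OF sm[OF f] c x] unfolding nT_def[symmetric] by (simp add: power2_eq_square[of nT] mult_ac)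
    next
      show "0 \<le> nT * nT * (K * c\<^sup>2)" using K(1) by simp
    qed
    have "expect (\<kappa> \<odot> \<zeta> \<odot> \<kappa> \<odot> q) f - expect (\<kappa> \<odot> \<zeta>' \<odot> \<kappa> \<odot> q) f = (?D \<zeta> - ?D \<zeta>') / (nT * nT)"
      unfolding expect_sandwich[OF supp(1,3) f] expect_sandwich[OF supp(2,3) f] J mar
      by (simp add: diff_divide_distrib[symmetric])
    also have "\<bar>\<dots>\<bar> \<le> (nT * nT * (K * c\<^sup>2) * B + nT * nT * (K * c\<^sup>2) * B') / (nT * nT)"
      unfolding abs_divide using D[OF supp(1) B0(1) B(1)] D[OF supp(2) B0(2) B(2)] nT_pos
      by (simp add: divide_right_mono)
    also have "\<dots> = K * c\<^sup>2 * (B + B')" using nT_pos by (simp add: field_simps)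
    finally show "\<bar>expect (\<kappa> \<odot> \<zeta> \<odot> \<kappa> \<odot> q) f - expect (\<kappa> \<odot> \<zeta>' \<odot> \<kappa> \<odot> q) f\<bar> \<le> K * c\<^sup>2 * (B + B')" .
  qed
  with K(1) that show ?thesis by blast
qed

end

section \<open>Geometric weights against polynomial growth\<close>

lemma summable_geometric_poly:
  fixes x :: real
  assumes "0 < x" "x < 1"
  shows "summable (\<lambda>k. x ^ k * (real k + 1) ^ 4)"
proof (rule summable_comparison_test_bigo)
  \<comment> \<open>Half of the geometric decay pays for the polynomial.\<close>
  define y where "y = sqrt x"
  have y: "0 < y" "y < 1" "x = y * y" using assms by (auto simp: y_def)
  show "summable (\<lambda>k. norm (y ^ k))" using y by (simp add: summable_geometric)
  have "(\<lambda>k. y ^ k * (y ^ k * (real k + 1) ^ 4)) \<in> O(\<lambda>k. y ^ k * 1)"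
  proof (rule landau_o.big.mult)
    show "(\<lambda>k. y ^ k * (real k + 1) ^ 4) \<in> O(\<lambda>_. 1)" using y(1,2) by real_asymp
  qed simp
  then show "(\<lambda>k. x ^ k * (real k + 1) ^ 4) \<in> O(\<lambda>k. y ^ k)"
    by (simp add: y(3) power_mult_distrib mult.assoc)
qed

text \<open>\<open>k + j + 1 \<le> (k + 1) * (j + 1)\<close> separates the parts of a segment on
  either side of the exchanged factor, so that the double series over both lengths factors.\<close>

lemma sum_geometric_poly_le:
  fixes x :: real
  assumes "0 < x" "x < 1"
  shows "(\<Sum>j<n. x ^ j * (real (k + j + 1)) ^ 4) \<le> (real k + 1) ^ 4 * (\<Sum>j. x ^ j * (real j + 1) ^ 4)"
proof -
  have "(\<Sum>j<n. x ^ j * (real (k + j + 1)) ^ 4) \<le> (\<Sum>j<n. (real k + 1) ^ 4 * (x ^ j * (real j + 1) ^ 4))"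
  proof (rule sum_mono)
    fix j
    have "real (k + j + 1) \<le> (real k + 1) * (real j + 1)" by (simp add: algebra_simps)
    then have "(real (k + j + 1)) ^ 4 \<le> ((real k + 1) * (real j + 1)) ^ 4" by (rule power_mono) simp
    then have "x ^ j * (real (k + j + 1)) ^ 4 \<le> x ^ j * ((real k + 1) * (real j + 1)) ^ 4"
      using assms by (intro mult_left_mono) auto
    then show "x ^ j * (real (k + j + 1)) ^ 4 \<le> (real k + 1) ^ 4 * (x ^ j * (real j + 1) ^ 4)"
      by (simp add: power_mult_distrib mult_ac)
  qed
  also have "\<dots> = (real k + 1) ^ 4 * (\<Sum>j<n. x ^ j * (real j + 1) ^ 4)" by (simp add: sum_distrib_left)
  also have "\<dots> \<le> (real k + 1) ^ 4 * (\<Sum>j. x ^ j * (real j + 1) ^ 4)"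
    using assms by (intro mult_left_mono sum_le_suminf summable_geometric_poly) auto
  finally show ?thesis .
qed

lemma filterlim_div_at_top:
  assumes "0 < (k::nat)"
  shows "filterlim (\<lambda>n. n div k) at_top at_top"
  unfolding filterlim_at_top eventually_sequentially
proof
  fix Z
  show "\<exists>N. \<forall>n\<ge>N. Z \<le> n div k"
    using assms by (intro exI[of _ "Z * k"]) (auto simp: less_eq_div_iff_mult_less_eq)
qed

section \<open>Truncated second moments along the walk\<close>

context two_transversals
begin

lemma \<Phi>_nonneg: "0 \<le> c \<Longrightarrow> 0 \<le> u \<Longrightarrow> 0 \<le> \<Phi> c u"
  by (simp add: \<Phi>_def)

lemma \<Phi>_mono: "0 \<le> c \<Longrightarrow> 0 \<le> u \<Longrightarrow> u \<le> v \<Longrightarrow> \<Phi> c u \<le> \<Phi> c v"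
  unfolding \<Phi>_def by (intro mult_mono power_mono min.mono mult_left_mono) auto

lemma \<Phi>_scale:
  assumes "0 \<le> c" "0 \<le> u" "1 \<le> l"
  shows "\<Phi> c (l * u) \<le> l ^ 3 * \<Phi> c u"
proof -
  have "min 1 (c * (l * u)) \<le> l * min 1 (c * u)"
  proof (cases "c * u \<le> 1")
    case True
    then show ?thesis by (simp add: min_def mult_ac)
  next
    case False
    then have "min 1 (c * u) = 1" by simp
    then show ?thesis using assms(3) min.cobounded1[of 1 "c * (l * u)"] by simp
  qed
  then have "(l * u)\<^sup>2 * min 1 (c * (l * u)) \<le> (l * u)\<^sup>2 * (l * min 1 (c * u))"
    by (rule mult_left_mono) simp
  then show ?thesis by (simp add: \<Phi>_def power_mult_distrib power2_eq_square power3_eq_cube mult_ac)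
qed

text \<open>Either \<open>v\<close> is at most the fraction \<open>1 / n\<close> of
  \<open>u\<close>, or \<open>u\<close> is less than \<open>n * v\<close>. The parameter
  \<open>n\<close> will be the number of earlier factors.\<close>

lemma \<Phi>_add:
  assumes "0 \<le> c" "0 \<le> u" "0 \<le> v" "1 \<le> n"
  shows "\<Phi> c (u + v) \<le> ((n + 1) / n) ^ 3 * \<Phi> c u + (n + 1) ^ 3 * \<Phi> c v"
proof (cases "n * v \<le> u")
  case True
  then have "u + v \<le> (n + 1) / n * u" using assms by (simp add: field_simps)
  then have "\<Phi> c (u + v) \<le> \<Phi> c ((n + 1) / n * u)" using assms by (intro \<Phi>_mono) auto
  also have "\<dots> \<le> ((n + 1) / n) ^ 3 * \<Phi> c u" using assms by (intro \<Phi>_scale) auto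
  finally show ?thesis using \<Phi>_nonneg[of c v] assms by (simp add: add_increasing2)
next
  case False
  then have "u + v \<le> (n + 1) * v" by (simp add: algebra_simps)
  then have "\<Phi> c (u + v) \<le> \<Phi> c ((n + 1) * v)" using assms by (intro \<Phi>_mono) auto
  also have "\<dots> \<le> (n + 1) ^ 3 * \<Phi> c v" using assms by (intro \<Phi>_scale) auto
  finally show ?thesis using \<Phi>_nonneg[of c u] assms by (simp add: add_increasing)
qed

text \<open>The fourth power makes the moments of convolution powers grow polynomially, which the geometric
  weights of the expansions absorb.\<close>

lemma moment_step:
  assumes supp: "P.supp_on \<mu>" "P.supp_on q" and c: "0 \<le> c" and n: "1 \<le> (n::nat)" and \<delta>: "0 \<le> \<delta>"
    and \<mu>: "(\<integral>\<^sup>+x. ennreal (\<Phi> c (w x)) \<partial>\<mu>) \<le> ennreal (real n ^ 4 * \<delta>)"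
    and q: "(\<integral>\<^sup>+x. ennreal (\<Phi> c (w x)) \<partial>q) \<le> ennreal \<delta>"
  shows "(\<integral>\<^sup>+x. ennreal (\<Phi> c (w x)) \<partial>(\<mu> \<odot> q)) \<le> ennreal (real (Suc n) ^ 4 * \<delta>)"
proof -
  let ?a = "((real n + 1) / real n) ^ 3" and ?b = "(real n + 1) ^ 3"
  have ab: "0 \<le> ?a" "0 \<le> ?b" by auto
  have "(\<integral>\<^sup>+x. ennreal (\<Phi> c (w x)) \<partial>(\<mu> \<odot> q)) = (\<integral>\<^sup>+x. \<integral>\<^sup>+y. ennreal (\<Phi> c (w (x \<otimes>\<^bsub>G\<^esub> y))) \<partial>q \<partial>\<mu>)"
    by (rule P.nn_integral_conv)
  also have "\<dots> \<le> (\<integral>\<^sup>+x. \<integral>\<^sup>+y. ennreal ?a * ennreal (\<Phi> c (w x)) + ennreal ?b * ennreal (\<Phi> c (w y)) \<partial>q \<partial>\<mu>)"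
  proof (rule nn_integral_mono_AE, unfold AE_measure_pmf_iff, rule ballI,
      rule nn_integral_mono_AE, unfold AE_measure_pmf_iff, rule ballI)
    fix x y assume "x \<in> set_pmf \<mu>" "y \<in> set_pmf q"
    then have xy: "x \<in> carrier G" "y \<in> carrier G" using supp by (auto dest: P.supp_onD)
    have w0: "0 \<le> w x" "0 \<le> w y" using w_ge_1[OF xy(1)] w_ge_1[OF xy(2)] by auto
    have w1: "0 \<le> w (x \<otimes>\<^bsub>G\<^esub> y)" using w_ge_1[OF P.m_closed[OF xy]] by simp
    have "\<Phi> c (w (x \<otimes>\<^bsub>G\<^esub> y)) \<le> \<Phi> c (w x + w y)" by (rule \<Phi>_mono[OF c w1 w_mult[OF xy]])
    also have "\<dots> \<le> ?a * \<Phi> c (w x) + ?b * \<Phi> c (w y)" by (rule \<Phi>_add[OF c w0]) (use n in simp)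
    finally have "ennreal (\<Phi> c (w (x \<otimes>\<^bsub>G\<^esub> y))) \<le> ennreal (?a * \<Phi> c (w x) + ?b * \<Phi> c (w y))"
      by (rule ennreal_leI)
    then show "ennreal (\<Phi> c (w (x \<otimes>\<^bsub>G\<^esub> y))) \<le> ennreal ?a * ennreal (\<Phi> c (w x)) + ennreal ?b * ennreal (\<Phi> c (w y))"
      using \<Phi>_nonneg[OF c w0(1)] \<Phi>_nonneg[OF c w0(2)] ab by (simp add: ennreal_mult[symmetric] ennreal_plus[symmetric] del: ennreal_plus)
  qed
  also have "\<dots> = ennreal ?a * (\<integral>\<^sup>+x. ennreal (\<Phi> c (w x)) \<partial>\<mu>) + ennreal ?b * (\<integral>\<^sup>+x. ennreal (\<Phi> c (w x)) \<partial>q)"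
    by (simp add: nn_integral_add nn_integral_cmult)
  also have "\<dots> \<le> ennreal ?a * ennreal (real n ^ 4 * \<delta>) + ennreal ?b * ennreal \<delta>"
    by (intro add_mono mult_left_mono \<mu> q) auto
  also have "\<dots> = ennreal (?a * (real n ^ 4 * \<delta>) + ?b * \<delta>)"
    using ab \<delta> by (simp add: ennreal_mult[symmetric] ennreal_plus[symmetric] del: ennreal_plus)
  \<comment> \<open>The choice of the parameter pays off:
    \<open>((n + 1) / n) ^ 3 * n ^ 4 + (n + 1) ^ 3 = (n + 1) ^ 4\<close>.\<close>
  also have "?a * (real n ^ 4 * \<delta>) + ?b * \<delta> = real (Suc n) ^ 4 * \<delta>"
  proof -
    have "?a * real n ^ 4 = (real n + 1) ^ 3 * real n"
      using n by (simp add: power_divide power_Suc numeral_eq_Suc)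
    then have "?a * (real n ^ 4 * \<delta>) = (real n + 1) ^ 3 * real n * \<delta>" by (simp add: mult.assoc[symmetric])
    then show ?thesis by (simp add: algebra_simps numeral_eq_Suc)
  qed
  finally show ?thesis .
qed

lemma moment_pow:
  assumes "P.supp_on q" "0 \<le> c" "0 \<le> \<delta>" "(\<integral>\<^sup>+x. ennreal (\<Phi> c (w x)) \<partial>q) \<le> ennreal \<delta>"
  shows "(\<integral>\<^sup>+x. ennreal (\<Phi> c (w x)) \<partial>(q ^\<odot> Suc n)) \<le> ennreal (real (Suc n) ^ 4 * \<delta>)"
proof (induction n)
  case 0
  have "q ^\<odot> Suc 0 = q" by (rule P.cpow_one[OF assms(1)])
  then show ?case using assms(4) by (simp only: power_one mult_1 of_nat_1 One_nat_def[symmetric])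
next
  case (Suc n)
  show ?case
    unfolding conv_power.simps(2)[of G q "Suc n"]
    by (rule moment_step[OF P.supp_on_cpow[OF assms(1)] assms(1,2) _ assms(3) Suc assms(4)]) simp
qed

text \<open>The case \<open>a = 0\<close> is separate: the empty power sits at the identity, whose
  weight is at least 1 and not controlled by \<open>\<delta>\<close>.\<close>

lemma moment_two_pow:
  assumes "P.supp_on q" "P.supp_on q'" "0 \<le> c" "0 \<le> \<delta>"
    "(\<integral>\<^sup>+x. ennreal (\<Phi> c (w x)) \<partial>q) \<le> ennreal \<delta>" "(\<integral>\<^sup>+x. ennreal (\<Phi> c (w x)) \<partial>q') \<le> ennreal \<delta>"
    and "1 \<le> a + b"
  shows "(\<integral>\<^sup>+x. ennreal (\<Phi> c (w x)) \<partial>(q ^\<odot> a \<odot> q' ^\<odot> b)) \<le> ennreal (real (a + b) ^ 4 * \<delta>)"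
proof (cases a)
  case 0
  then obtain b0 where b: "b = Suc b0" using assms(7) by (cases b) auto
  have "q ^\<odot> a \<odot> q' ^\<odot> b = q' ^\<odot> b"
    unfolding 0 conv_power.simps(1) by (rule P.conv_one_left[OF P.supp_on_cpow[OF assms(2)]])
  then show ?thesis using moment_pow[OF assms(2-4,6), of b0] by (simp only: 0 b add_0)
next
  case (Suc a0)
  show ?thesis
  proof (induction b)
    case 0
    have "q ^\<odot> a \<odot> q' ^\<odot> 0 = q ^\<odot> a"
      unfolding conv_power.simps(1) by (rule P.conv_one_right[OF P.supp_on_cpow[OF assms(1)]])
    then show ?case using moment_pow[OF assms(1,3-5), of a0] by (simp only: Suc add_0_right)
  next
    case (Suc b)
    have e: "q ^\<odot> a \<odot> q' ^\<odot> Suc b = (q ^\<odot> a \<odot> q' ^\<odot> b) \<odot> q'"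
      unfolding conv_power.simps(2) by (rule P.conv_assoc[symmetric]) (use assms(1,2) in auto)
    have s: "P.supp_on (q ^\<odot> a \<odot> q' ^\<odot> b)"
      by (rule P.supp_on_conv[OF P.supp_on_cpow[OF assms(1)] P.supp_on_cpow[OF assms(2)]])
    show ?case
      unfolding e add_Suc_right
      by (rule moment_step[OF s assms(2,3) _ assms(4) Suc assms(6)]) (use \<open>a = Suc a0\<close> in simp)
  qed
qed

lemma map_fst_pconv: "map_pmf fst (p \<odot> q) = convolution G1 (map_pmf fst p) (map_pmf fst q)"
  by (simp add: P.conv_bind A.conv_bind map_bind_pmf bind_map_pmf mult_DirProd')

lemma map_snd_pconv: "map_pmf snd (p \<odot> q) = convolution G2 (map_pmf snd p) (map_pmf snd q)"
  by (simp add: P.conv_bind B.conv_bind map_bind_pmf bind_map_pmf mult_DirProd')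

lemma expect_\<Phi>:
  assumes "P.supp_on q" "(\<integral>\<^sup>+x. ennreal ((w x)\<^sup>2) \<partial>q) < \<infinity>" "0 \<le> c"
  shows "(\<integral>\<^sup>+x. ennreal (\<Phi> c (w x)) \<partial>q) = ennreal (expect q (\<lambda>x. \<Phi> c (w x)))"
    and "0 \<le> expect q (\<lambda>x. \<Phi> c (w x))"
proof -
  have int2: "integrable (measure_pmf q) (\<lambda>x. (w x)\<^sup>2)"
    by (rule integrableI_bounded) (use assms(2) in auto)
  have nn: "0 \<le> \<Phi> c (w x)" "\<bar>\<Phi> c (w x)\<bar> \<le> (w x)\<^sup>2" if "x \<in> set_pmf q" for x
  proof -
    have "1 \<le> w x" by (rule w_ge_1) (rule P.supp_onD[OF assms(1) that])
    then have m: "0 \<le> min 1 (c * w x)" "min 1 (c * w x) \<le> 1" using assms(3) by auto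
    then show "0 \<le> \<Phi> c (w x)" by (simp add: \<Phi>_def)
    moreover have "\<Phi> c (w x) \<le> (w x)\<^sup>2 * 1" unfolding \<Phi>_def by (rule mult_left_mono[OF m(2)]) simp
    ultimately show "\<bar>\<Phi> c (w x)\<bar> \<le> (w x)\<^sup>2" by simp
  qed
  have int: "integrable (measure_pmf q) (\<lambda>x. \<Phi> c (w x))"
    by (rule Bochner_Integration.integrable_bound[OF int2]) (use nn in \<open>auto simp: AE_measure_pmf_iff\<close>)
  have ae: "AE x in measure_pmf q. 0 \<le> \<Phi> c (w x)" using nn by (simp add: AE_measure_pmf_iff)
  show "(\<integral>\<^sup>+x. ennreal (\<Phi> c (w x)) \<partial>q) = ennreal (expect q (\<lambda>x. \<Phi> c (w x)))"
    by (rule nn_integral_eq_integral[OF int ae])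
  show "0 \<le> expect q (\<lambda>x. \<Phi> c (w x))" by (rule integral_nonneg_AE[OF ae])
qed

text \<open>Dominated convergence with majorant \<open>(w x)\<^sup>2\<close>: here the finite second
  moment gains the little-o.\<close>

lemma expect_\<Phi>_tendsto:
  assumes "P.supp_on q" "(\<integral>\<^sup>+x. ennreal ((w x)\<^sup>2) \<partial>q) < \<infinity>" "\<And>n. 0 \<le> c n" "c \<longlonglongrightarrow> 0"
  shows "(\<lambda>n. expect q (\<lambda>x. \<Phi> (c n) (w x))) \<longlonglongrightarrow> 0"
proof -
  have int2: "integrable (measure_pmf q) (\<lambda>x. (w x)\<^sup>2)"
    by (rule integrableI_bounded) (use assms(2) in auto)
  have "(\<lambda>n. expect q (\<lambda>x. \<Phi> (c n) (w x))) \<longlonglongrightarrow> expect q (\<lambda>x. 0)"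
  proof (rule integral_dominated_convergence[where w = "\<lambda>x. (w x)\<^sup>2"])
    show "AE x in measure_pmf q. (\<lambda>n. \<Phi> (c n) (w x)) \<longlonglongrightarrow> 0"
    proof (rule AE_I2)
      fix x
      have "(\<lambda>n. (w x)\<^sup>2 * min 1 (c n * w x)) \<longlonglongrightarrow> (w x)\<^sup>2 * min 1 (0 * w x)"
        by (intro tendsto_intros assms(4))
      then show "(\<lambda>n. \<Phi> (c n) (w x)) \<longlonglongrightarrow> 0" by (simp add: \<Phi>_def)
    qed
    fix n
    show "AE x in measure_pmf q. norm (\<Phi> (c n) (w x)) \<le> (w x)\<^sup>2"
      unfolding AE_measure_pmf_iff
    proof
      fix x assume "x \<in> set_pmf q"
      then have "1 \<le> w x" by (intro w_ge_1 P.supp_onD[OF assms(1)])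
      then have m: "0 \<le> min 1 (c n * w x)" "min 1 (c n * w x) \<le> 1" using assms(3)[of n] by auto
      have "\<Phi> (c n) (w x) \<le> (w x)\<^sup>2 * 1" unfolding \<Phi>_def by (rule mult_left_mono[OF m(2)]) simp
      then show "norm (\<Phi> (c n) (w x)) \<le> (w x)\<^sup>2" using m(1) by (simp add: \<Phi>_def)
    qed
  qed (use int2 in auto)
  then show ?thesis by simp
qed

text \<open>Since \<open>w\<close> is at least 1, \<open>\<Phi> 1 (w x)\<close> is the square of the
  weight, so the moment bounds for \<open>\<Phi>\<close> also serve for first moments.\<close>

lemma first_moment_le:
  assumes "P.supp_on q"
  shows "(\<integral>\<^sup>+x. ennreal (w x) \<partial>q) \<le> (\<integral>\<^sup>+x. ennreal (\<Phi> 1 (w x)) \<partial>q)"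
proof (rule nn_integral_mono_AE, unfold AE_measure_pmf_iff, rule ballI)
  fix x assume "x \<in> set_pmf q"
  then have w1: "1 \<le> w x" by (intro w_ge_1 P.supp_onD[OF assms(1)])
  then have "w x * 1 \<le> w x * w x" by (intro mult_left_mono) auto
  then show "ennreal (w x) \<le> ennreal (\<Phi> 1 (w x))"
    using w1 by (intro ennreal_leI) (simp add: \<Phi>_def min_def power2_eq_square)
qed

end

context two_transversals
begin

text \<open>Telescoping replaces the factors of \<open>p ^\<odot> N\<close> one at a time. The power to the left of the
  replaced factor is expanded at its last \<open>\<kappa>\<close>, the power to the right at its first \<open>\<kappa>\<close>; the
  replaced segment is then sandwiched between two copies of \<open>\<kappa>\<close>, which costs \<open>o(1 / M)\<close>. The
  expansion without a \<open>\<kappa>\<close> on the left is a boundary term of total weight \<open>O(1)\<close>, for which the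
  first-order estimate suffices.\<close>

lemma half_swap:
  assumes \<epsilon>: "0 < \<epsilon>" "\<epsilon> < 1" and supp: "P.supp_on \<eta>" "P.supp_on \<eta>'"
    and mar: "map_pmf fst \<eta> = map_pmf fst \<eta>'" "map_pmf snd \<eta> = map_pmf snd \<eta>'"
    and p: "p = mix_pmf \<epsilon> \<kappa> \<eta>" and p': "p' = mix_pmf \<epsilon> \<kappa> \<eta>'"
    and conj: "\<And>y s. y \<in> carrier G \<Longrightarrow> s \<in> S \<Longrightarrow> y \<otimes>\<^bsub>G\<^esub> s \<otimes>\<^bsub>G\<^esub> inv\<^bsub>G\<^esub> y \<in> S"
    and C0: "0 \<le> C0"
    and tv: "\<And>s r. s \<in> S \<Longrightarrow> tv_le (return_pmf s \<odot> p' ^\<odot> r) (p' ^\<odot> r) (C0 * sqrt (1 / real (Suc r)))"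
    and m2: "(\<integral>\<^sup>+x. ennreal ((w x)\<^sup>2) \<partial>\<eta>) < \<infinity>" "(\<integral>\<^sup>+x. ennreal ((w x)\<^sup>2) \<partial>\<eta>') < \<infinity>"
  shows "\<exists>B. B \<longlonglongrightarrow> 0 \<and> (\<forall>N M. N \<le> 2 * M \<longrightarrow> tv_le (p ^\<odot> N \<odot> p' ^\<odot> M) (p' ^\<odot> N \<odot> p' ^\<odot> M) (B M))"
proof -
  obtain K where K: "0 \<le> K" "\<And>\<zeta> \<zeta>' q c B B'. \<lbrakk>P.supp_on \<zeta>; P.supp_on \<zeta>'; P.supp_on q; 0 \<le> c; 0 \<le> B; 0 \<le> B';
      map_pmf fst \<zeta> = map_pmf fst \<zeta>'; map_pmf snd \<zeta> = map_pmf snd \<zeta>';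
      \<And>f. (\<And>x. \<bar>f x\<bar> \<le> 1) \<Longrightarrow> P.smooth3 S c (P.avop q f);
      (\<integral>\<^sup>+x. ennreal (\<Phi> c (w x)) \<partial>\<zeta>) \<le> ennreal B; (\<integral>\<^sup>+x. ennreal (\<Phi> c (w x)) \<partial>\<zeta>') \<le> ennreal B'\<rbrakk>
    \<Longrightarrow> tv_le (\<kappa> \<odot> \<zeta> \<odot> \<kappa> \<odot> q) (\<kappa> \<odot> \<zeta>' \<odot> \<kappa> \<odot> q) (K * c\<^sup>2 * (B + B'))"
    using tv_le_sandwich by blast
  define x where "x = 1 - \<epsilon>"
  have x: "0 < x" "x < 1" using \<epsilon> by (auto simp: x_def)
  define SS where "SS = (\<Sum>k. x ^ k * (real k + 1) ^ 4)"
  have SS0: "0 \<le> SS" unfolding SS_def using x by (intro suminf_nonneg summable_geometric_poly) auto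
  have SS: "(\<Sum>j<n. x ^ j * (real (k + j + 1)) ^ 4) \<le> (real k + 1) ^ 4 * SS" for n k
    unfolding SS_def by (rule sum_geometric_poly_le[OF x])
  have SS': "(\<Sum>k<n. x ^ k * (real k + 1) ^ 4) \<le> SS" for n
    using SS[where k = 0 and n = n] by (simp add: add.commute)
  define K1 where "K1 = 2 * C * (1 + W)"
  have K1: "0 \<le> K1" using C_nonneg W_ge_1 by (simp add: K1_def)
  define cc where "cc r = C0 * sqrt (1 / real (Suc r))" for r :: nat
  have cc0: "0 \<le> cc r" for r using C0 by (simp add: cc_def)
  have cc_lim: "cc \<longlonglongrightarrow> 0" unfolding cc_def by real_asymp
  define \<delta> where "\<delta> c = expect \<eta> (\<lambda>x. \<Phi> c (w x)) + expect \<eta>' (\<lambda>x. \<Phi> c (w x))" for c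
  have \<delta>0: "0 \<le> \<delta> c" and \<delta>\<eta>: "(\<integral>\<^sup>+x. ennreal (\<Phi> c (w x)) \<partial>\<eta>) \<le> ennreal (\<delta> c)"
    "(\<integral>\<^sup>+x. ennreal (\<Phi> c (w x)) \<partial>\<eta>') \<le> ennreal (\<delta> c)" if "0 \<le> c" for c
    using expect_\<Phi>[OF supp(1) m2(1) that] expect_\<Phi>[OF supp(2) m2(2) that]
    by (auto simp: \<delta>_def intro!: ennreal_leI)
  have supp\<kappa>: "P.supp_on \<kappa>" by (rule supp_on_\<kappa>)
  have supp_p: "P.supp_on p" "P.supp_on p'"
    using supp supp\<kappa> \<epsilon> unfolding p p' P.supp_on_def by (auto simp: set_mix)
  note supps = supp supp\<kappa> supp_p
  \<comment> \<open>The segment between the nearest \<open>\<kappa>\<close> on either side, with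
    \<open>i\<close> factors before and \<open>j\<close> factors after the exchanged one. Since
    \<open>\<eta>\<close> and \<open>\<eta>'\<close> have equal marginals, so have both
    segments.\<close>
  define \<zeta> \<zeta>' where "\<zeta> i j = \<eta> ^\<odot> i \<odot> \<eta> \<odot> \<eta>' ^\<odot> j" and "\<zeta>' i j = \<eta> ^\<odot> i \<odot> \<eta>' \<odot> \<eta>' ^\<odot> j" for i j
  have \<zeta>_supp: "P.supp_on (\<zeta> i j)" "P.supp_on (\<zeta>' i j)" for i j
    unfolding \<zeta>_def \<zeta>'_def by (intro P.supp_on_conv P.supp_on_cpow supp)+
  have \<zeta>_alt: "\<zeta> i j = \<eta> ^\<odot> Suc i \<odot> \<eta>' ^\<odot> j" for i j
    unfolding \<zeta>_def conv_power.simps(2) by (rule P.conv_assoc[symmetric]) (intro P.supp_on_cpow supp)+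
  have \<zeta>'_alt: "\<zeta>' i j = \<eta> ^\<odot> i \<odot> \<eta>' ^\<odot> Suc j" for i j
    unfolding \<zeta>'_def P.cpow_Suc_left[OF supp(2)] ..
  have \<zeta>_mar: "map_pmf fst (\<zeta> i j) = map_pmf fst (\<zeta>' i j)" "map_pmf snd (\<zeta> i j) = map_pmf snd (\<zeta>' i j)" for i j
    unfolding \<zeta>_def \<zeta>'_def map_fst_pconv map_snd_pconv mar by (rule refl)+
  have \<zeta>_mom: "(\<integral>\<^sup>+x. ennreal (\<Phi> c (w x)) \<partial>\<zeta> i j) \<le> ennreal (real (i + j + 1) ^ 4 * \<delta> c)"
    "(\<integral>\<^sup>+x. ennreal (\<Phi> c (w x)) \<partial>\<zeta>' i j) \<le> ennreal (real (i + j + 1) ^ 4 * \<delta> c)" if c: "0 \<le> c" for c i j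
    using moment_two_pow[OF supp c \<delta>0[OF c] \<delta>\<eta>[OF c], of "Suc i" j]
      moment_two_pow[OF supp c \<delta>0[OF c] \<delta>\<eta>[OF c], of i "Suc j"]
    unfolding \<zeta>_alt \<zeta>'_alt by (simp_all only: add_Suc add_Suc_right Suc_eq_plus1 add.commute le_add1 add.left_commute)
  \<comment> \<open>Three sources: at most \<open>2 * M\<close> sandwiched exchanges, where
    \<open>M * c\<^sup>2 \<le> 6 * C0\<^sup>2\<close> accounts for \<open>24 = 2 * 2 * 6\<close>;
    truncations of the right expansion; boundary terms, whose geometric weights are summed by
    \<open>SS\<close>.\<close>
  define B where "B M = 24 * K * C0\<^sup>2 * SS\<^sup>2 * \<delta> (cc (M div 6)) + 8 * (real M * x ^ (M div 2))
    + 2 * K1 * SS\<^sup>2 * \<delta> 1 * cc (M div 6)" for M :: nat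
  have "B \<longlonglongrightarrow> 0"
  proof -
    have lim6: "(\<lambda>M. cc (M div 6)) \<longlonglongrightarrow> 0"
      by (rule filterlim_compose[OF cc_lim filterlim_div_at_top]) simp
    have d: "(\<lambda>M. \<delta> (cc (M div 6))) \<longlonglongrightarrow> 0 + 0"
      unfolding \<delta>_def by (intro tendsto_add expect_\<Phi>_tendsto supp m2 cc0 lim6)
    have "(\<lambda>q. (2 * real q + 1) * x ^ q) \<longlonglongrightarrow> 0" using x by real_asymp
    then have u: "(\<lambda>M. (2 * real (M div 2) + 1) * x ^ (M div 2)) \<longlonglongrightarrow> 0"
      by (rule filterlim_compose[OF _ filterlim_div_at_top]) simp
    have xM: "(\<lambda>M. real M * x ^ (M div 2)) \<longlonglongrightarrow> 0"
    proof (rule tendsto_sandwich[OF _ _ tendsto_const u])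
      show "\<forall>\<^sub>F M in sequentially. 0 \<le> real M * x ^ (M div 2)" using x by simp
      have "real M * x ^ (M div 2) \<le> (2 * real (M div 2) + 1) * x ^ (M div 2)" for M
      proof (rule mult_right_mono)
        have "M \<le> 2 * (M div 2) + 1" by presburger
        then show "real M \<le> 2 * real (M div 2) + 1" by linarith
      qed (use x in simp)
      then show "\<forall>\<^sub>F M in sequentially. real M * x ^ (M div 2) \<le> (2 * real (M div 2) + 1) * x ^ (M div 2)"
        by simp
    qed
    have "B \<longlonglongrightarrow> 24 * K * C0\<^sup>2 * SS\<^sup>2 * (0 + 0) + 8 * 0 + 2 * K1 * SS\<^sup>2 * \<delta> 1 * 0"
      unfolding B_def by (intro tendsto_intros d xM lim6)
    then show ?thesis by simp
  qed
  moreover have "tv_le (p ^\<odot> N \<odot> p' ^\<odot> M) (p' ^\<odot> N \<odot> p' ^\<odot> M) (B M)" if NM: "N \<le> 2 * M" for N M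
  proof -
    \<comment> \<open>When the first \<open>\<kappa>\<close> occurs among the first \<open>J\<close>
      factors on the right, at least half of the last \<open>M\<close> factors remain behind it,
      enough for three blocks of length \<open>r\<close>.\<close>
    define J r where "J = M div 2" and "r = M div 6"
    define c where "c = cc r"
    have c: "0 \<le> c" unfolding c_def by (rule cc0)
    define d where "d = \<delta> c"
    have d0: "0 \<le> d" unfolding d_def by (rule \<delta>0[OF c])
    define d1 where "d1 = \<delta> 1"
    have d10: "0 \<le> d1" unfolding d1_def by (rule \<delta>0) simp
    have sm: "P.smooth3 S c (P.avop (p' ^\<odot> R) f)" if "3 * r \<le> R" "\<And>y. \<bar>f y\<bar> \<le> 1" for R f
      by (rule P.smooth3_cpow[OF S_carrier conj supp_p(2) _ that(2) c that(1)])
         (use tv in \<open>auto simp: c_def cc_def\<close>)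
    define \<tau> where "\<tau> k = 2 * K * c\<^sup>2 * d * SS\<^sup>2 + 4 * x ^ J + 2 * K1 * c * d1 * SS * (x ^ k * (real k + 1) ^ 4)" for k :: nat
    have step: "tv_le (p ^\<odot> k \<odot> p \<odot> p' ^\<odot> R) (p ^\<odot> k \<odot> p' \<odot> p' ^\<odot> R) (\<tau> k)" if R: "M \<le> R" for k R
    proof -
      have J_le: "J \<le> R" using R unfolding J_def by presburger
      have r_le: "3 * r \<le> R - 1 - j" if "j < J" for j
        using R that unfolding J_def r_def by presburger
      define X X' where "X i = \<kappa> \<odot> \<eta> ^\<odot> i \<odot> \<eta>" and "X' i = \<kappa> \<odot> \<eta> ^\<odot> i \<odot> \<eta>'" for i
      have X_supp: "P.supp_on (X i)" "P.supp_on (X' i)" for i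
        unfolding X_def X'_def by (intro P.supp_on_conv P.supp_on_cpow supps)+
      have inner: "tv_le (X i \<odot> p' ^\<odot> R) (X' i \<odot> p' ^\<odot> R) (2 * K * c\<^sup>2 * d * SS * (real i + 1) ^ 4 + 2 * x ^ J)" for i
      proof (rule tv_le_mono)
        show "tv_le (X i \<odot> p' ^\<odot> R) (X' i \<odot> p' ^\<odot> R)
          ((\<Sum>j<J. \<epsilon> * (1 - \<epsilon>) ^ j * (K * c\<^sup>2 * (real (i + j + 1) ^ 4 * d + real (i + j + 1) ^ 4 * d))) + 2 * (1 - \<epsilon>) ^ J)"
        proof (rule P.tv_le_expand_right[OF X_supp supp\<kappa> supp(2) \<epsilon> J_le p'])
          fix j assume j: "j < J"
          have e: "(\<kappa> \<odot> \<eta> ^\<odot> i \<odot> Z) \<odot> \<eta>' ^\<odot> j \<odot> \<kappa> \<odot> p' ^\<odot> (R - 1 - j) = \<kappa> \<odot> (\<eta> ^\<odot> i \<odot> Z \<odot> \<eta>' ^\<odot> j) \<odot> \<kappa> \<odot> p' ^\<odot> (R - 1 - j)"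
            if "P.supp_on Z" for Z
            using that supps by (simp only: P.conv_assoc P.supp_on_conv P.supp_on_cpow)
          show "tv_le (X i \<odot> \<eta>' ^\<odot> j \<odot> \<kappa> \<odot> p' ^\<odot> (R - 1 - j)) (X' i \<odot> \<eta>' ^\<odot> j \<odot> \<kappa> \<odot> p' ^\<odot> (R - 1 - j))
              (K * c\<^sup>2 * (real (i + j + 1) ^ 4 * d + real (i + j + 1) ^ 4 * d))"
            unfolding X_def X'_def e[OF supp(1)] e[OF supp(2)] \<zeta>_def[symmetric] \<zeta>'_def[symmetric]
            by (rule K(2)[OF \<zeta>_supp _ c _ _ \<zeta>_mar sm[OF r_le[OF j]]])
               (use d0 \<zeta>_mom[OF c] in \<open>auto simp: d_def intro: P.supp_on_cpow[OF supp_p(2)]\<close>)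
        qed
        have "(\<Sum>j<J. \<epsilon> * (1 - \<epsilon>) ^ j * (K * c\<^sup>2 * (real (i + j + 1) ^ 4 * d + real (i + j + 1) ^ 4 * d)))
            \<le> (\<Sum>j<J. 2 * K * c\<^sup>2 * d * (x ^ j * real (i + j + 1) ^ 4))"
        proof (rule sum_mono)
          fix j
          have nn: "0 \<le> x ^ j * (K * c\<^sup>2 * (real (i + j + 1) ^ 4 * d + real (i + j + 1) ^ 4 * d))"
            using x K(1) d0 by simp
          have "\<epsilon> * (x ^ j * (K * c\<^sup>2 * (real (i + j + 1) ^ 4 * d + real (i + j + 1) ^ 4 * d)))
              \<le> 1 * (x ^ j * (K * c\<^sup>2 * (real (i + j + 1) ^ 4 * d + real (i + j + 1) ^ 4 * d)))"
            using \<epsilon> by (intro mult_right_mono[OF _ nn]) simp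
          then show "\<epsilon> * (1 - \<epsilon>) ^ j * (K * c\<^sup>2 * (real (i + j + 1) ^ 4 * d + real (i + j + 1) ^ 4 * d))
              \<le> 2 * K * c\<^sup>2 * d * (x ^ j * real (i + j + 1) ^ 4)"
            unfolding x_def by (simp add: mult_ac)
        qed
        also have "\<dots> = 2 * K * c\<^sup>2 * d * (\<Sum>j<J. x ^ j * real (i + j + 1) ^ 4)" by (simp add: sum_distrib_left)
        also have "\<dots> \<le> 2 * K * c\<^sup>2 * d * ((real i + 1) ^ 4 * SS)"
          using K(1) d0 by (intro mult_left_mono SS) auto
        finally show "(\<Sum>j<J. \<epsilon> * (1 - \<epsilon>) ^ j * (K * c\<^sup>2 * (real (i + j + 1) ^ 4 * d + real (i + j + 1) ^ 4 * d))) + 2 * (1 - \<epsilon>) ^ J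
            \<le> 2 * K * c\<^sup>2 * d * SS * (real i + 1) ^ 4 + 2 * x ^ J"
          unfolding x_def by (simp add: mult_ac)
      qed
      define Z Z' where "Z = \<eta> ^\<odot> k \<odot> \<eta>" and "Z' = \<eta> ^\<odot> k \<odot> \<eta>'"
      have Z_supp: "P.supp_on Z" "P.supp_on Z'"
        unfolding Z_def Z'_def by (intro P.supp_on_conv P.supp_on_cpow supps)+
      \<comment> \<open>No \<open>\<kappa>\<close> among the \<open>k\<close> factors on the left:
        the segment reaches the start of the walk and only the first-order gain is used. The weight
        \<open>x ^ k\<close> of this case is summable in \<open>k\<close>.\<close>
      have bdry: "tv_le (Z \<odot> p' ^\<odot> R) (Z' \<odot> p' ^\<odot> R) (2 * K1 * c * d1 * SS * (real k + 1) ^ 4 + 2 * x ^ J)"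
      proof (rule tv_le_mono)
        show "tv_le (Z \<odot> p' ^\<odot> R) (Z' \<odot> p' ^\<odot> R)
          ((\<Sum>j<J. \<epsilon> * (1 - \<epsilon>) ^ j * (K1 * c * (real (k + j + 1) ^ 4 * d1 + real (k + j + 1) ^ 4 * d1))) + 2 * (1 - \<epsilon>) ^ J)"
        proof (rule P.tv_le_expand_right[OF Z_supp supp\<kappa> supp(2) \<epsilon> J_le p'])
          fix j assume j: "j < J"
          have e: "(\<eta> ^\<odot> k \<odot> Y) \<odot> \<eta>' ^\<odot> j \<odot> \<kappa> \<odot> p' ^\<odot> (R - 1 - j) = (\<eta> ^\<odot> k \<odot> Y \<odot> \<eta>' ^\<odot> j) \<odot> \<kappa> \<odot> p' ^\<odot> (R - 1 - j)"
            if "P.supp_on Y" for Y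
            using that supps by (simp only: P.conv_assoc P.supp_on_conv P.supp_on_cpow)
          show "tv_le (Z \<odot> \<eta>' ^\<odot> j \<odot> \<kappa> \<odot> p' ^\<odot> (R - 1 - j)) (Z' \<odot> \<eta>' ^\<odot> j \<odot> \<kappa> \<odot> p' ^\<odot> (R - 1 - j))
              (K1 * c * (real (k + j + 1) ^ 4 * d1 + real (k + j + 1) ^ 4 * d1))"
            unfolding Z_def Z'_def e[OF supp(1)] e[OF supp(2)] \<zeta>_def[symmetric] \<zeta>'_def[symmetric] K1_def
          proof (rule tv_le_first_order[OF \<zeta>_supp P.supp_on_cpow[OF supp_p(2)] c _ _ sm[OF r_le[OF j]]])
            show "(\<integral>\<^sup>+x. ennreal (w x) \<partial>\<zeta> k j) \<le> ennreal (real (k + j + 1) ^ 4 * d1)"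
              unfolding d1_def by (rule order_trans[OF first_moment_le[OF \<zeta>_supp(1)] \<zeta>_mom(1)]) simp
            show "(\<integral>\<^sup>+x. ennreal (w x) \<partial>\<zeta>' k j) \<le> ennreal (real (k + j + 1) ^ 4 * d1)"
              unfolding d1_def by (rule order_trans[OF first_moment_le[OF \<zeta>_supp(2)] \<zeta>_mom(2)]) simp
          qed (use d10 in auto)
        qed
        have "(\<Sum>j<J. \<epsilon> * (1 - \<epsilon>) ^ j * (K1 * c * (real (k + j + 1) ^ 4 * d1 + real (k + j + 1) ^ 4 * d1)))
            \<le> (\<Sum>j<J. 2 * K1 * c * d1 * (x ^ j * real (k + j + 1) ^ 4))"
        proof (rule sum_mono)
          fix j
          have nn: "0 \<le> x ^ j * (K1 * c * (real (k + j + 1) ^ 4 * d1 + real (k + j + 1) ^ 4 * d1))"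
            using x K1 c d10 by simp
          have "\<epsilon> * (x ^ j * (K1 * c * (real (k + j + 1) ^ 4 * d1 + real (k + j + 1) ^ 4 * d1)))
              \<le> 1 * (x ^ j * (K1 * c * (real (k + j + 1) ^ 4 * d1 + real (k + j + 1) ^ 4 * d1)))"
            using \<epsilon> by (intro mult_right_mono[OF _ nn]) simp
          then show "\<epsilon> * (1 - \<epsilon>) ^ j * (K1 * c * (real (k + j + 1) ^ 4 * d1 + real (k + j + 1) ^ 4 * d1))
              \<le> 2 * K1 * c * d1 * (x ^ j * real (k + j + 1) ^ 4)"
            unfolding x_def by (simp add: mult_ac)
        qed
        also have "\<dots> = 2 * K1 * c * d1 * (\<Sum>j<J. x ^ j * real (k + j + 1) ^ 4)" by (simp add: sum_distrib_left)
        also have "\<dots> \<le> 2 * K1 * c * d1 * ((real k + 1) ^ 4 * SS)"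
          using K1 c d10 by (intro mult_left_mono SS) auto
        finally show "(\<Sum>j<J. \<epsilon> * (1 - \<epsilon>) ^ j * (K1 * c * (real (k + j + 1) ^ 4 * d1 + real (k + j + 1) ^ 4 * d1))) + 2 * (1 - \<epsilon>) ^ J
            \<le> 2 * K1 * c * d1 * SS * (real k + 1) ^ 4 + 2 * x ^ J"
          unfolding x_def by (simp add: mult_ac)
      qed
      have pR: "P.supp_on (p' ^\<odot> R)" by (rule P.supp_on_cpow[OF supp_p(2)])
      have "tv_le (p ^\<odot> k \<odot> \<eta> \<odot> p' ^\<odot> R) (p ^\<odot> k \<odot> \<eta>' \<odot> p' ^\<odot> R)
         ((\<Sum>i<k. \<epsilon> * (1 - \<epsilon>) ^ i * (2 * K * c\<^sup>2 * d * SS * (real i + 1) ^ 4 + 2 * x ^ J))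
           + (1 - \<epsilon>) ^ k * (2 * K1 * c * d1 * SS * (real k + 1) ^ 4 + 2 * x ^ J))"
      proof (rule P.tv_le_expand_left[OF _ _ supp\<kappa> supp(1) \<epsilon> p])
        fix i
        have e: "\<kappa> \<odot> \<eta> ^\<odot> i \<odot> Y \<odot> p' ^\<odot> R = (\<kappa> \<odot> \<eta> ^\<odot> i \<odot> Y) \<odot> p' ^\<odot> R" if "P.supp_on Y" for Y
          using that supps by (simp only: P.conv_assoc P.supp_on_conv P.supp_on_cpow)
        show "tv_le (\<kappa> \<odot> \<eta> ^\<odot> i \<odot> \<eta> \<odot> p' ^\<odot> R) (\<kappa> \<odot> \<eta> ^\<odot> i \<odot> \<eta>' \<odot> p' ^\<odot> R)
            (2 * K * c\<^sup>2 * d * SS * (real i + 1) ^ 4 + 2 * x ^ J)"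
          using inner[of i] unfolding X_def X'_def e[OF supp(1)] e[OF supp(2)] .
      next
        have e: "\<eta> ^\<odot> k \<odot> Y \<odot> p' ^\<odot> R = (\<eta> ^\<odot> k \<odot> Y) \<odot> p' ^\<odot> R" if "P.supp_on Y" for Y
          using that supps by (simp only: P.conv_assoc P.supp_on_conv P.supp_on_cpow)
        show "tv_le (\<eta> ^\<odot> k \<odot> \<eta> \<odot> p' ^\<odot> R) (\<eta> ^\<odot> k \<odot> \<eta>' \<odot> p' ^\<odot> R)
            (2 * K1 * c * d1 * SS * (real k + 1) ^ 4 + 2 * x ^ J)"
          using bdry unfolding Z_def Z'_def e[OF supp(1)] e[OF supp(2)] .
      qed (intro P.supp_on_conv pR supp)+
      from P.tv_le_mix_diff[OF P.supp_on_cpow[OF supp_p(1)] pR supp\<kappa> supp \<epsilon> this]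
      have "tv_le (p ^\<odot> k \<odot> p \<odot> p' ^\<odot> R) (p ^\<odot> k \<odot> p' \<odot> p' ^\<odot> R)
         ((\<Sum>i<k. \<epsilon> * x ^ i * (2 * K * c\<^sup>2 * d * SS * (real i + 1) ^ 4 + 2 * x ^ J))
           + x ^ k * (2 * K1 * c * d1 * SS * (real k + 1) ^ 4 + 2 * x ^ J))"
        unfolding p[symmetric] p'[symmetric] x_def[symmetric] .
      then show ?thesis
      proof (rule tv_le_mono)
        let ?A = "2 * K * c\<^sup>2 * d * SS"
        have A0: "0 \<le> ?A" using K(1) d0 SS0 by simp
        have "(\<Sum>i<k. \<epsilon> * x ^ i * (?A * (real i + 1) ^ 4 + 2 * x ^ J))
            = \<epsilon> * (?A * (\<Sum>i<k. x ^ i * (real i + 1) ^ 4)) + 2 * x ^ J * (\<epsilon> * (\<Sum>i<k. x ^ i))"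
          by (simp add: sum.distrib sum_distrib_left algebra_simps)
        \<comment> \<open>The left weights sum to at most 1, so the truncations contribute at most
          \<open>2 * x ^ J\<close>; the boundary case adds at most as much, hence
          \<open>4 * x ^ J\<close> in \<open>\<tau>\<close>.\<close>
        also have "\<epsilon> * (\<Sum>i<k. x ^ i) = 1 - x ^ k"
          using sum_gp_strict[of x k] x \<epsilon> by (simp add: x_def)
        also have "2 * x ^ J * (1 - x ^ k) \<le> 2 * x ^ J * 1"
          using x by (intro mult_left_mono) auto
        also have "\<epsilon> * (?A * (\<Sum>i<k. x ^ i * (real i + 1) ^ 4)) \<le> 1 * (?A * SS)"
        proof (rule mult_mono)
          show "?A * (\<Sum>i<k. x ^ i * (real i + 1) ^ 4) \<le> ?A * SS" by (rule mult_left_mono[OF SS' A0])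
          have "0 \<le> (\<Sum>i<k. x ^ i * (real i + 1) ^ 4)" using x by (intro sum_nonneg) simp
          then show "0 \<le> ?A * (\<Sum>i<k. x ^ i * (real i + 1) ^ 4)" by (rule mult_nonneg_nonneg[OF A0])
        qed (use \<epsilon> in auto)
        finally have 1: "(\<Sum>i<k. \<epsilon> * x ^ i * (?A * (real i + 1) ^ 4 + 2 * x ^ J)) \<le> ?A * SS + 2 * x ^ J" by simp
        have "x ^ k * (2 * x ^ J) \<le> 1 * (2 * x ^ J)"
          using x by (intro mult_right_mono) (auto simp: power_le_one)
        then have 2: "x ^ k * (2 * K1 * c * d1 * SS * (real k + 1) ^ 4 + 2 * x ^ J)
            \<le> 2 * K1 * c * d1 * SS * (x ^ k * (real k + 1) ^ 4) + 2 * x ^ J"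
          by (simp add: distrib_left mult_ac)
        show "(\<Sum>i<k. \<epsilon> * x ^ i * (?A * (real i + 1) ^ 4 + 2 * x ^ J))
           + x ^ k * (2 * K1 * c * d1 * SS * (real k + 1) ^ 4 + 2 * x ^ J) \<le> \<tau> k"
          using 1 2 unfolding \<tau>_def power2_eq_square[of SS] mult.assoc[symmetric] by linarith
      qed
    qed
    have "tv_le (p ^\<odot> N \<odot> p' ^\<odot> M) (p' ^\<odot> N \<odot> p' ^\<odot> M) (\<Sum>k<N. \<tau> k)"
      by (rule P.tv_le_telescope[OF supp_p]) (rule step, simp)
    then show ?thesis
    proof (rule tv_le_mono)
      have "(\<Sum>k<N. \<alpha> + \<beta> + \<gamma> * g k) = real N * (\<alpha> + \<beta>) + \<gamma> * (\<Sum>k<N. g k)" for \<alpha> \<beta> \<gamma> :: real and g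
        by (simp add: sum.distrib sum_distrib_left distrib_left)
      then have "(\<Sum>k<N. \<tau> k) = real N * (2 * K * c\<^sup>2 * d * SS\<^sup>2 + 4 * x ^ J) + 2 * K1 * c * d1 * SS * (\<Sum>k<N. x ^ k * (real k + 1) ^ 4)"
        unfolding \<tau>_def .
      also have "\<dots> \<le> real (2 * M) * (2 * K * c\<^sup>2 * d * SS\<^sup>2 + 4 * x ^ J) + 2 * K1 * c * d1 * SS * SS"
      proof (rule add_mono)
        have "0 \<le> 2 * K * c\<^sup>2 * d * SS\<^sup>2 + 4 * x ^ J" using K(1) d0 x by simp
        then show "real N * (2 * K * c\<^sup>2 * d * SS\<^sup>2 + 4 * x ^ J) \<le> real (2 * M) * (2 * K * c\<^sup>2 * d * SS\<^sup>2 + 4 * x ^ J)"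
          using NM by (intro mult_right_mono) linarith
        have "0 \<le> 2 * K1 * c * d1 * SS" using K1 c d10 SS0 by simp
        then show "2 * K1 * c * d1 * SS * (\<Sum>k<N. x ^ k * (real k + 1) ^ 4) \<le> 2 * K1 * c * d1 * SS * SS"
          by (rule mult_left_mono[OF SS'])
      qed
      also have "\<dots> \<le> B M"
      proof -
        have "M \<le> 6 * Suc r" unfolding r_def by presburger
        then have "real M \<le> 6 * real (Suc r)" by linarith
        then have "C0\<^sup>2 * (real M / real (Suc r)) \<le> C0\<^sup>2 * 6"
          by (intro mult_left_mono) (auto simp: divide_le_eq)
        then have "real M * c\<^sup>2 \<le> 6 * C0\<^sup>2"
          unfolding c_def cc_def by (simp add: power_mult_distrib field_simps)
        then have "4 * K * d * SS\<^sup>2 * (real M * c\<^sup>2) \<le> 4 * K * d * SS\<^sup>2 * (6 * C0\<^sup>2)"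
          using K(1) d0 by (intro mult_left_mono) auto
        moreover have "2 * m * (2 * K * u * d * s + 4 * v) = 4 * K * d * s * (m * u) + 8 * (m * v)" for m u s v :: real
          by (simp add: algebra_simps)
        then have "real (2 * M) * (2 * K * c\<^sup>2 * d * SS\<^sup>2 + 4 * x ^ J) = 4 * K * d * SS\<^sup>2 * (real M * c\<^sup>2) + 8 * (real M * x ^ J)"
          by (simp only: of_nat_mult of_nat_numeral)
        moreover have "4 * K * d * SS\<^sup>2 * (6 * C0\<^sup>2) = 24 * K * C0\<^sup>2 * SS\<^sup>2 * d" by (simp add: mult_ac)
        moreover have "2 * K1 * c * d1 * SS * SS = 2 * K1 * SS\<^sup>2 * d1 * c" by (simp add: power2_eq_square mult_ac)
        ultimately show ?thesis
          unfolding B_def r_def[symmetric] c_def[symmetric] d_def[symmetric] d1_def[symmetric] J_def[symmetric]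
          by linarith
      qed
      finally show "(\<Sum>k<N. \<tau> k) \<le> B M" .
    qed
  qed
  ultimately show ?thesis by blast
qed

end

section \<open>Supports, inversion and the two halves of the walk\<close>

text \<open>The least positive difference \<open>d\<close> of two elements of \<open>D\<close> with
  0 adjoined divides every element, because a nonzero remainder modulo \<open>d\<close> would be a
  smaller such difference. So \<open>d = 1\<close>, and two consecutive elements generate all large
  numbers.\<close>

lemma additive_set_eventually:
  fixes D :: "nat set"
  assumes add: "\<And>a b. a \<in> D \<Longrightarrow> b \<in> D \<Longrightarrow> a + b \<in> D" and gcd: "Gcd D = 1"
  shows "\<exists>n0. \<forall>n\<ge>n0. n \<in> D"
proof -
  let ?D = "insert 0 D"
  have add0: "a + b \<in> ?D" if "a \<in> ?D" "b \<in> ?D" for a b using that add by auto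
  have mult: "q * a \<in> ?D" if "a \<in> ?D" for q a
  proof (induction q)
    case (Suc q)
    then show ?case using add0[OF that Suc] by (simp only: mult_Suc)
  qed simp
  define P where "P d \<longleftrightarrow> 0 < d \<and> (\<exists>a\<in>?D. \<exists>b\<in>?D. a = b + d)" for d
  have "\<exists>x\<in>D. 0 < x"
  proof (rule ccontr)
    assume "\<not> ?thesis"
    then have "D \<subseteq> {0}" by auto
    then have "Gcd D = 0" by (simp add: Gcd_0_iff)
    then show False using gcd by simp
  qed
  then have "\<exists>d. P d" unfolding P_def by fastforce
  then have P: "P (LEAST d. P d)" by (rule LeastI_ex)
  define d where "d = (LEAST d. P d)"
  have "P d" unfolding d_def by (rule P)
  then obtain a b where d: "0 < d" "a \<in> ?D" "b \<in> ?D" "a = b + d" unfolding P_def by blast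
  have "d dvd x" if x: "x \<in> D" for x
  proof -
    define q r where "q = x div d" and "r = x mod d"
    have "x + q * b = q * a + r" by (simp add: d(4) q_def r_def distrib_left)
    moreover have "x + q * b \<in> ?D" using x by (intro add0 mult d) auto
    moreover have "q * a \<in> ?D" by (intro mult d)
    ultimately have "P r" if "0 < r" using that unfolding P_def by metis
    moreover have "r < d" using d(1) by (simp add: r_def)
    then have "\<not> P r" unfolding d_def by (rule not_less_Least)
    ultimately have "r = 0" by blast
    then show ?thesis by (simp add: r_def dvd_eq_mod_eq_0)
  qed
  then have "d dvd Gcd D" by (rule Gcd_greatest)
  then have ab: "a = b + 1" using gcd d(4) by simp
  have "n \<in> D" if n: "n \<ge> b * b + b + 1" for n
  proof -
    have "n \<in> ?D"
    proof (cases "b = 0")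
      case True
      then show ?thesis using mult[OF d(2), of n] ab by simp
    next
      case False
      define q r where "q = n div b" and "r = n mod b"
      have "b \<le> q" unfolding q_def using n False by (simp add: less_eq_div_iff_mult_less_eq)
      moreover have "r < b" using False by (simp add: r_def)
      ultimately have le: "r \<le> q" by simp
      have "n = q * b + r" by (simp add: q_def r_def)
      also have "\<dots> = (q - r) * b + r * a" using le by (simp add: ab algebra_simps diff_mult_distrib)
      finally show ?thesis using add0[OF mult[OF d(3), of "q - r"] mult[OF d(2), of r]] by (simp only:)
    qed
    then show ?thesis using n by auto
  qed
  then show ?thesis by blast
qed

context group
begin

lemma set_cpow_add:
  assumes "supp_on p" "x \<in> set_pmf (p ^\<star> m)" "y \<in> set_pmf (p ^\<star> n)"
  shows "x \<otimes> y \<in> set_pmf (p ^\<star> (m + n))"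
  unfolding cpow_add[OF assms(1)] set_conv using assms(2,3) by force

text \<open>Aperiodicity puts \<open>\<one>\<close> into the support of all large powers; padding a
  product that equals \<open>g\<close> with such a return reaches \<open>g\<close> in every large
  power.\<close>

lemma eventually_in_set_cpow:
  assumes p: "supp_on p" and ap: "aperiodic G p" and gen: "semigroup_generated G (set_pmf p) = carrier G"
    and Q: "finite Q" "Q \<subseteq> carrier G"
  shows "\<exists>n0. \<forall>n\<ge>n0. Q \<subseteq> set_pmf (p ^\<star> n)"
proof -
  define D where "D = {n. n \<ge> 1 \<and> pmf (p ^\<star> n) \<one> > 0}"
  have "\<exists>n0. \<forall>n\<ge>n0. n \<in> D"
  proof (rule additive_set_eventually)
    show "Gcd D = 1" using ap by (simp add: aperiodic_def D_def)
    fix a b assume "a \<in> D" "b \<in> D"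
    then show "a + b \<in> D" using set_cpow_add[OF p, of \<one> a \<one> b] by (simp add: D_def pmf_positive_iff)
  qed
  then obtain k where k: "\<And>n. n \<ge> k \<Longrightarrow> \<one> \<in> set_pmf (p ^\<star> n)" by (auto simp: D_def pmf_positive_iff)
  have ex: "\<exists>n. g \<in> set_pmf (p ^\<star> n)" if "g \<in> semigroup_generated G (set_pmf p)" for g
    using that
  proof induction
    case (incl x)
    then have "x \<in> set_pmf (p ^\<star> 1)" using p by simp
    then show ?case ..
  next
    case (mult x y)
    then obtain n m where "x \<in> set_pmf (p ^\<star> n)" "y \<in> set_pmf (p ^\<star> m)" by auto
    from set_cpow_add[OF p this] show ?case ..
  qed
  have ev: "\<exists>n0. \<forall>n\<ge>n0. g \<in> set_pmf (p ^\<star> n)" if g: "g \<in> Q" for g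
  proof -
    have gc: "g \<in> carrier G" using g Q by auto
    then obtain m where m: "g \<in> set_pmf (p ^\<star> m)" using ex gen by blast
    have "g \<in> set_pmf (p ^\<star> n)" if "n \<ge> m + k" for n
      using set_cpow_add[OF p m k[of "n - m"]] that gc by simp
    then show ?thesis by blast
  qed
  show ?thesis
    using Q(1) ev
  proof (induction Q)
    case (insert g Q)
    then obtain a where a: "\<forall>n\<ge>a. Q \<subseteq> set_pmf (p ^\<star> n)" by auto
    obtain b where b: "\<forall>n\<ge>b. g \<in> set_pmf (p ^\<star> n)" using insert(4)[of g] by auto
    show ?case using a b by (intro exI[of _ "max a b"]) auto
  qed auto
qed

definition inv_pmf :: "'a pmf \<Rightarrow> 'a pmf" where "inv_pmf p = map_pmf (\<lambda>x. inv x) p"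

lemma supp_on_inv_pmf [simp]: "supp_on p \<Longrightarrow> supp_on (inv_pmf p)"
  by (auto simp: supp_on_def inv_pmf_def)

lemma inv_pmf_inv_pmf: "supp_on p \<Longrightarrow> inv_pmf (inv_pmf p) = p"
  unfolding inv_pmf_def pmf.map_comp by (rule map_pmf_idI) (auto simp: supp_on_def)

lemma inv_pmf_conv:
  assumes "supp_on p" "supp_on q"
  shows "inv_pmf (p \<star> q) = inv_pmf q \<star> inv_pmf p"
proof -
  have "inv_pmf (p \<star> q) = bind_pmf p (\<lambda>x. bind_pmf q (\<lambda>y. return_pmf (inv y \<otimes> inv x)))"
    unfolding inv_pmf_def conv_bind map_bind_pmf map_return_pmf
    by (intro bind_pmf_cong refl) (use assms in \<open>auto simp: supp_on_def inv_mult_group subset_iff\<close>)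
  also have "\<dots> = inv_pmf q \<star> inv_pmf p"
    unfolding conv_bind inv_pmf_def bind_map_pmf by (rule bind_commute_pmf)
  finally show ?thesis .
qed

lemma inv_pmf_cpow:
  assumes "supp_on p"
  shows "inv_pmf (p ^\<star> n) = inv_pmf p ^\<star> n"
proof (induction n)
  case 0
  show ?case by (simp add: inv_pmf_def)
next
  case (Suc n)
  have "inv_pmf (p ^\<star> Suc n) = inv_pmf p \<star> inv_pmf p ^\<star> n"
    using assms Suc by (simp add: inv_pmf_conv)
  also have "\<dots> = inv_pmf p ^\<star> Suc n" using cpow_Suc_left[of "inv_pmf p" n] assms by simp
  finally show ?case .
qed

end

context two_transversals
begin

text \<open>A weight \<open>\<epsilon>\<close> small enough for both laws splits off
  \<open>\<kappa>\<close> equally from each, so the remainders inherit equal marginals.\<close>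

lemma half_swap_of_support:
  assumes supp: "P.supp_on p" "P.supp_on p'"
    and mar: "map_pmf fst p = map_pmf fst p'" "map_pmf snd p = map_pmf snd p'"
    and Q: "P.T \<union> insert \<one>\<^bsub>G\<^esub> S \<subseteq> set_pmf p" "P.T \<union> insert \<one>\<^bsub>G\<^esub> S \<subseteq> set_pmf p'"
    and conj: "\<And>y s. y \<in> carrier G \<Longrightarrow> s \<in> S \<Longrightarrow> y \<otimes>\<^bsub>G\<^esub> s \<otimes>\<^bsub>G\<^esub> inv\<^bsub>G\<^esub> y \<in> S"
    and fin: "finite S"
    and m2: "(\<integral>\<^sup>+x. ennreal ((w x)\<^sup>2) \<partial>p) < \<infinity>" "(\<integral>\<^sup>+x. ennreal ((w x)\<^sup>2) \<partial>p') < \<infinity>"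
  shows "\<exists>B. B \<longlonglongrightarrow> 0 \<and> (\<forall>N M. N \<le> 2 * M \<longrightarrow> tv_le (p ^\<odot> N \<odot> p' ^\<odot> M) (p' ^\<odot> N \<odot> p' ^\<odot> M) (B M))"
proof -
  have f\<kappa>: "finite (set_pmf \<kappa>)" unfolding set_\<kappa> by (rule P.finite_rep)
  have T: "set_pmf \<kappa> \<subseteq> set_pmf p" "set_pmf \<kappa> \<subseteq> set_pmf p'" unfolding set_\<kappa> using Q by blast+
  obtain \<epsilon>1 where e1: "\<epsilon>1 > 0" "\<forall>\<epsilon>. 0 < \<epsilon> \<longrightarrow> \<epsilon> < \<epsilon>1 \<longrightarrow> (\<exists>\<eta>. p = mix_pmf \<epsilon> \<kappa> \<eta>)"
    using ex_mix_finite[OF f\<kappa> T(1)] by blast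
  obtain \<epsilon>2 where e2: "\<epsilon>2 > 0" "\<forall>\<epsilon>. 0 < \<epsilon> \<longrightarrow> \<epsilon> < \<epsilon>2 \<longrightarrow> (\<exists>\<eta>. p' = mix_pmf \<epsilon> \<kappa> \<eta>)"
    using ex_mix_finite[OF f\<kappa> T(2)] by blast
  define \<epsilon> where "\<epsilon> = min 1 (min \<epsilon>1 \<epsilon>2) / 2"
  have \<epsilon>: "0 < \<epsilon>" "\<epsilon> < 1" "\<epsilon> < \<epsilon>1" "\<epsilon> < \<epsilon>2" using e1(1) e2(1) by (auto simp: \<epsilon>_def)
  obtain \<eta> \<eta>' where \<eta>: "p = mix_pmf \<epsilon> \<kappa> \<eta>" "p' = mix_pmf \<epsilon> \<kappa> \<eta>'"
    using e1(2) e2(2) \<epsilon> by blast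
  have s\<eta>: "P.supp_on \<eta>" "P.supp_on \<eta>'"
    using P.supp_on_mixD[OF \<epsilon>(1,2), of \<kappa> \<eta>] P.supp_on_mixD[OF \<epsilon>(1,2), of \<kappa> \<eta>'] supp unfolding \<eta> by blast+
  have "map_pmf fst \<eta> = map_pmf fst \<eta>'" "map_pmf snd \<eta> = map_pmf snd \<eta>'"
    using mar mix_pmf_cancel[OF \<epsilon>(1,2)] unfolding \<eta> map_mix by blast+
  moreover have "(\<integral>\<^sup>+x. ennreal ((w x)\<^sup>2) \<partial>\<mu>) < \<infinity>" if "(\<integral>\<^sup>+x. ennreal ((w x)\<^sup>2) \<partial>mix_pmf \<epsilon> \<kappa> \<mu>) < \<infinity>" for \<mu>
    using that \<epsilon>(1,2) unfolding nn_integral_mix[OF less_imp_le[OF \<epsilon>(1)] less_imp_le[OF \<epsilon>(2)]]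
    by (auto simp: ennreal_mult_less_top top_unique less_top)
  then have "(\<integral>\<^sup>+x. ennreal ((w x)\<^sup>2) \<partial>\<eta>) < \<infinity>" "(\<integral>\<^sup>+x. ennreal ((w x)\<^sup>2) \<partial>\<eta>') < \<infinity>"
    using m2 unfolding \<eta> by blast+
  moreover have "\<exists>C0\<ge>0. \<forall>s\<in>S. \<forall>r. tv_le (return_pmf s \<odot> p' ^\<odot> r) (p' ^\<odot> r) (C0 * sqrt (1 / real (Suc r)))"
  proof (rule P.tv_le_smooth[OF fin S_carrier conj _ supp(2)])
    show "s \<otimes>\<^bsub>G\<^esub> t = t \<otimes>\<^bsub>G\<^esub> s" if "s \<in> S" "t \<in> S" for s t
      using P.comm_N[of s t] that S_N by blast
    show "insert \<one>\<^bsub>G\<^esub> S \<subseteq> set_pmf p'" using Q(2) by blast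
  qed
  then obtain C0 where "0 \<le> C0"
    "\<And>s r. s \<in> S \<Longrightarrow> tv_le (return_pmf s \<odot> p' ^\<odot> r) (p' ^\<odot> r) (C0 * sqrt (1 / real (Suc r)))" by blast
  ultimately show ?thesis using half_swap[OF \<epsilon>(1,2) s\<eta> _ _ \<eta> conj] by blast
qed

text \<open>Smoothness is only available to the right of the replaced factor. Inversion reverses the order of
  the factors and interchanges the roles of \<open>p\<close> and \<open>p'\<close>, which takes care of the other half.\<close>

lemma full_swap:
  assumes supp: "P.supp_on p" "P.supp_on p'"
    and mar: "map_pmf fst p = map_pmf fst p'" "map_pmf snd p = map_pmf snd p'"
    and Q: "Q = P.T \<union> insert \<one>\<^bsub>G\<^esub> S" "Q \<union> (\<lambda>x. inv\<^bsub>G\<^esub> x) ` Q \<subseteq> set_pmf p" "Q \<union> (\<lambda>x. inv\<^bsub>G\<^esub> x) ` Q \<subseteq> set_pmf p'"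
    and conj: "\<And>y s. y \<in> carrier G \<Longrightarrow> s \<in> S \<Longrightarrow> y \<otimes>\<^bsub>G\<^esub> s \<otimes>\<^bsub>G\<^esub> inv\<^bsub>G\<^esub> y \<in> S"
    and fin: "finite S"
    and m2: "(\<integral>\<^sup>+x. ennreal ((w x)\<^sup>2) \<partial>p) < \<infinity>" "(\<integral>\<^sup>+x. ennreal ((w x)\<^sup>2) \<partial>p') < \<infinity>"
    and w_inv: "\<And>x. x \<in> carrier G \<Longrightarrow> w (inv\<^bsub>G\<^esub> x) \<le> w x"
    and \<delta>: "0 < \<delta>"
  shows "\<exists>n0. \<forall>n\<ge>n0. tv_le (p ^\<odot> n) (p' ^\<odot> n) \<delta>"
proof -
  have Q_carrier: "Q \<subseteq> carrier G" unfolding Q(1) using P.T_closed P.one_closed S_carrier by blast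
  \<comment> \<open>Symmetrising \<open>Q\<close> makes the support condition available for the
    inverted laws as well.\<close>
  have Qi: "Q \<subseteq> set_pmf (P.inv_pmf q)" if "Q \<union> (\<lambda>x. inv\<^bsub>G\<^esub> x) ` Q \<subseteq> set_pmf q" for q
  proof
    fix x assume x: "x \<in> Q"
    then have "inv\<^bsub>G\<^esub> x \<in> set_pmf q" using that by blast
    moreover have "inv\<^bsub>G\<^esub> (inv\<^bsub>G\<^esub> x) = x" using x Q_carrier by (intro P.inv_inv) blast
    ultimately show "x \<in> set_pmf (P.inv_pmf q)" unfolding P.inv_pmf_def set_map_pmf by (metis image_eqI)
  qed
  have fst_inv: "map_pmf fst (P.inv_pmf q) = map_pmf (\<lambda>y. inv\<^bsub>G1\<^esub> y) (map_pmf fst q)"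
    and snd_inv: "map_pmf snd (P.inv_pmf q) = map_pmf (\<lambda>y. inv\<^bsub>G2\<^esub> y) (map_pmf snd q)" if "P.supp_on q" for q
  proof -
    have "inv\<^bsub>G\<^esub> x = (inv\<^bsub>G1\<^esub> fst x, inv\<^bsub>G2\<^esub> snd x)" if "x \<in> set_pmf q" for x
      using P.supp_onD[OF \<open>P.supp_on q\<close> that] by (cases x) (simp add: inv_DirProd[OF A.is_group B.is_group])
    then show "map_pmf fst (P.inv_pmf q) = map_pmf (\<lambda>y. inv\<^bsub>G1\<^esub> y) (map_pmf fst q)"
      "map_pmf snd (P.inv_pmf q) = map_pmf (\<lambda>y. inv\<^bsub>G2\<^esub> y) (map_pmf snd q)"
      unfolding P.inv_pmf_def pmf.map_comp by (auto intro!: map_pmf_cong)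
  qed
  have m2i: "(\<integral>\<^sup>+x. ennreal ((w x)\<^sup>2) \<partial>P.inv_pmf q) < \<infinity>"
    if "P.supp_on q" "(\<integral>\<^sup>+x. ennreal ((w x)\<^sup>2) \<partial>q) < \<infinity>" for q
  proof -
    have "(\<integral>\<^sup>+x. ennreal ((w x)\<^sup>2) \<partial>P.inv_pmf q) \<le> (\<integral>\<^sup>+x. ennreal ((w x)\<^sup>2) \<partial>q)"
      unfolding P.inv_pmf_def nn_integral_map_pmf
    proof (rule nn_integral_mono_AE, unfold AE_measure_pmf_iff, rule ballI)
      fix x assume "x \<in> set_pmf q"
      then have x: "x \<in> carrier G" by (rule P.supp_onD[OF that(1)])
      have "1 \<le> w (inv\<^bsub>G\<^esub> x)" by (rule w_ge_1[OF P.inv_closed[OF x]])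
      then have "(w (inv\<^bsub>G\<^esub> x))\<^sup>2 \<le> (w x)\<^sup>2" using w_inv[OF x] by (intro power_mono) auto
      then show "ennreal ((w (inv\<^bsub>G\<^esub> x))\<^sup>2) \<le> ennreal ((w x)\<^sup>2)" by (rule ennreal_leI)
    qed
    then show ?thesis using that(2) by (rule le_less_trans)
  qed
  obtain B where B: "B \<longlonglongrightarrow> 0"
    "\<And>N M. N \<le> 2 * M \<Longrightarrow> tv_le (p ^\<odot> N \<odot> p' ^\<odot> M) (p' ^\<odot> N \<odot> p' ^\<odot> M) (B M)"
    using half_swap_of_support[OF supp mar _ _ conj fin m2] Q by blast
  have "\<exists>B. B \<longlonglongrightarrow> 0 \<and> (\<forall>N M. N \<le> 2 * M \<longrightarrow> tv_le (P.inv_pmf p' ^\<odot> N \<odot> P.inv_pmf p ^\<odot> M)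
      (P.inv_pmf p ^\<odot> N \<odot> P.inv_pmf p ^\<odot> M) (B M))"
    by (rule half_swap_of_support[OF _ _ _ _ _ _ conj fin])
      (use supp mar Qi[OF Q(2)] Qi[OF Q(3)] m2i[OF supp(1) m2(1)] m2i[OF supp(2) m2(2)] fst_inv snd_inv
        in \<open>simp_all only: P.supp_on_inv_pmf Q(1)[symmetric]\<close>)
  then obtain B' where B': "B' \<longlonglongrightarrow> 0" and B'_tv: "\<And>N M. N \<le> 2 * M \<Longrightarrow>
      tv_le (P.inv_pmf p' ^\<odot> N \<odot> P.inv_pmf p ^\<odot> M) (P.inv_pmf p ^\<odot> N \<odot> P.inv_pmf p ^\<odot> M) (B' M)" by blast
  have B2: "tv_le (p ^\<odot> M \<odot> p' ^\<odot> N) (p ^\<odot> M \<odot> p ^\<odot> N) (B' M)" if NM: "N \<le> 2 * M" for N M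
  proof -
    have e: "P.inv_pmf (P.inv_pmf q ^\<odot> N \<odot> P.inv_pmf q' ^\<odot> M) = q' ^\<odot> M \<odot> q ^\<odot> N"
      if "P.supp_on q" "P.supp_on q'" for q q'
      using that by (simp only: P.inv_pmf_conv P.inv_pmf_cpow P.inv_pmf_inv_pmf P.supp_on_inv_pmf P.supp_on_cpow)
    have "tv_le (P.inv_pmf (P.inv_pmf p' ^\<odot> N \<odot> P.inv_pmf p ^\<odot> M)) (P.inv_pmf (P.inv_pmf p ^\<odot> N \<odot> P.inv_pmf p ^\<odot> M)) (B' M)"
      unfolding P.inv_pmf_def[of "_ \<odot> _"] by (rule tv_le_map[OF B'_tv[OF NM]])
    then show ?thesis unfolding e[OF supp(2,1)] e[OF supp(1,1)] .
  qed
  have \<delta>2: "0 < \<delta> / 2" using \<delta> by simp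
  have "eventually (\<lambda>M. B M < \<delta> / 2) sequentially" "eventually (\<lambda>M. B' M < \<delta> / 2) sequentially"
    by (rule order_tendstoD(2)[OF B(1) \<delta>2]) (rule order_tendstoD(2)[OF B' \<delta>2])
  then obtain k k' where k: "\<And>M. M \<ge> k \<Longrightarrow> B M < \<delta> / 2" "\<And>M. M \<ge> k' \<Longrightarrow> B' M < \<delta> / 2"
    unfolding eventually_sequentially by blast
  have "tv_le (p ^\<odot> n) (p' ^\<odot> n) \<delta>" if n: "n \<ge> 2 * k + 2 * k' + 2" for n
  proof -
    \<comment> \<open>The path from \<open>p ^\<odot> n\<close> to \<open>p' ^\<odot> n\<close> runs
      through \<open>p ^\<odot> M \<odot> p' ^\<odot> N\<close>: the last block is exchanged by the
      inverted estimate, the first by the direct one. Halving keeps each block at most twice as long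
      as the other.\<close>
    define M N where "M = n div 2" and "N = n - n div 2"
    have MN: "n = M + N" "N \<le> 2 * M" "M \<le> 2 * N" "k' \<le> M" "k \<le> N" using n unfolding M_def N_def by auto
    have "tv_le (p ^\<odot> M \<odot> p ^\<odot> N) (p' ^\<odot> M \<odot> p' ^\<odot> N) (B' M + B N)"
      by (rule tv_le_trans[OF tv_le_sym[OF B2[OF MN(2)]] B(2)[OF MN(3)]])
    then have "tv_le (p ^\<odot> M \<odot> p ^\<odot> N) (p' ^\<odot> M \<odot> p' ^\<odot> N) \<delta>"
      by (rule tv_le_mono) (use k MN in fastforce)
    then show ?thesis using P.cpow_add[OF supp(1), of M N] P.cpow_add[OF supp(2), of M N] MN(1) by simp
  qed
  then show ?thesis by blast
qed

lemma second_moment_cpow: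
  assumes q: "P.supp_on q" "(\<integral>\<^sup>+x. ennreal ((w x)\<^sup>2) \<partial>q) < \<infinity>" and "1 \<le> m"
  shows "(\<integral>\<^sup>+x. ennreal ((w x)\<^sup>2) \<partial>(q ^\<odot> m)) < \<infinity>"
proof -
  obtain n where m: "m = Suc n" using assms(3) by (cases m) auto
  have "(\<integral>\<^sup>+x. ennreal ((w x)\<^sup>2) \<partial>(q ^\<odot> m)) = (\<integral>\<^sup>+x. ennreal (\<Phi> 1 (w x)) \<partial>(q ^\<odot> m))"
  proof (rule nn_integral_cong_AE, unfold AE_measure_pmf_iff, rule ballI)
    fix x assume "x \<in> set_pmf (q ^\<odot> m)"
    then have "1 \<le> w x" by (intro w_ge_1 P.supp_onD[OF P.supp_on_cpow[OF q(1)]])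
    then show "ennreal ((w x)\<^sup>2) = ennreal (\<Phi> 1 (w x))" by (simp add: \<Phi>_def min_def)
  qed
  also have "\<dots> \<le> ennreal (real (Suc n) ^ 4 * expect q (\<lambda>x. \<Phi> 1 (w x)))"
    unfolding m by (rule moment_pow[OF q(1)]) (use expect_\<Phi>[OF q, of 1] in auto)
  also have "\<dots> < \<infinity>" by simp
  finally show ?thesis .
qed

lemma pair_pmf_pconv: "pair_pmf p q \<odot> pair_pmf p' q' = pair_pmf (convolution G1 p p') (convolution G2 q q')"
proof -
  have "pair_pmf p q \<odot> pair_pmf p' q' = bind_pmf p (\<lambda>x. bind_pmf q (\<lambda>y. bind_pmf p' (\<lambda>x'. bind_pmf q' (\<lambda>y'.
      return_pmf (x \<otimes>\<^bsub>G1\<^esub> x', y \<otimes>\<^bsub>G2\<^esub> y')))))"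
    unfolding P.conv_bind pair_pmf_def bind_assoc_pmf bind_return_pmf by simp
  also have "\<dots> = bind_pmf p (\<lambda>x. bind_pmf p' (\<lambda>x'. bind_pmf q (\<lambda>y. bind_pmf q' (\<lambda>y'.
      return_pmf (x \<otimes>\<^bsub>G1\<^esub> x', y \<otimes>\<^bsub>G2\<^esub> y')))))"
    by (intro bind_pmf_cong refl) (rule bind_commute_pmf)
  also have "\<dots> = pair_pmf (convolution G1 p p') (convolution G2 q q')"
    unfolding A.conv_bind B.conv_bind pair_pmf_def bind_assoc_pmf bind_return_pmf ..
  finally show ?thesis .
qed

lemma pair_pmf_ppow: "pair_pmf p q ^\<odot> n = pair_pmf (conv_power G1 p n) (conv_power G2 q n)"
proof (induction n)
  case 0
  show ?case by (simp add: pair_return_pmf1)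
next
  case (Suc n)
  then show ?case by (simp add: pair_pmf_pconv)
qed

lemma map_fst_ppow: "map_pmf fst (p ^\<odot> n) = conv_power G1 (map_pmf fst p) n"
  by (induction n) (simp_all add: map_fst_pconv)

lemma map_snd_ppow: "map_pmf snd (p ^\<odot> n) = conv_power G2 (map_pmf snd p) n"
  by (induction n) (simp_all add: map_snd_pconv)

text \<open>The product of the marginals is realised by recombining coordinates of two independent
  samples of \<open>q\<close>.\<close>

lemma second_moment_pair:
  assumes q: "P.supp_on q" "(\<integral>\<^sup>+x. ennreal ((w x)\<^sup>2) \<partial>q) < \<infinity>"
    and w: "\<And>x y. x \<in> carrier G \<Longrightarrow> y \<in> carrier G \<Longrightarrow> w (fst x, snd y) \<le> w x + w y"
  shows "(\<integral>\<^sup>+x. ennreal ((w x)\<^sup>2) \<partial>pair_pmf (map_pmf fst q) (map_pmf snd q)) < \<infinity>"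
proof -
  have "pair_pmf (map_pmf fst q) (map_pmf snd q) = map_pmf (\<lambda>(x, y). (fst x, snd y)) (pair_pmf q q)"
    by (rule map_pair[symmetric])
  then have "(\<integral>\<^sup>+x. ennreal ((w x)\<^sup>2) \<partial>pair_pmf (map_pmf fst q) (map_pmf snd q))
      = (\<integral>\<^sup>+x. \<integral>\<^sup>+y. ennreal ((w (fst x, snd y))\<^sup>2) \<partial>q \<partial>q)"
    by (simp add: nn_integral_pair_pmf')
  also have "\<dots> \<le> (\<integral>\<^sup>+x. \<integral>\<^sup>+y. ennreal 2 * ennreal ((w x)\<^sup>2) + ennreal 2 * ennreal ((w y)\<^sup>2) \<partial>q \<partial>q)"
  proof (rule nn_integral_mono_AE, unfold AE_measure_pmf_iff, rule ballI,
      rule nn_integral_mono_AE, unfold AE_measure_pmf_iff, rule ballI)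
    fix x y assume "x \<in> set_pmf q" "y \<in> set_pmf q"
    then have xy: "x \<in> carrier G" "y \<in> carrier G" using P.supp_onD[OF q(1)] by blast+
    then have "(fst x, snd y) \<in> carrier G" by auto
    then have "0 \<le> w (fst x, snd y)" using w_ge_1 by fastforce
    then have "(w (fst x, snd y))\<^sup>2 \<le> (w x + w y)\<^sup>2" by (rule power_mono[OF w[OF xy]])
    also have "\<dots> \<le> 2 * (w x)\<^sup>2 + 2 * (w y)\<^sup>2"
      using zero_le_power2[of "w x - w y"] by (simp add: power2_eq_square algebra_simps)
    finally have "ennreal ((w (fst x, snd y))\<^sup>2) \<le> ennreal (2 * (w x)\<^sup>2 + 2 * (w y)\<^sup>2)" by (rule ennreal_leI)
    then show "ennreal ((w (fst x, snd y))\<^sup>2) \<le> ennreal 2 * ennreal ((w x)\<^sup>2) + ennreal 2 * ennreal ((w y)\<^sup>2)"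
      by (simp only: ennreal_mult[symmetric] ennreal_plus[symmetric] zero_le_numeral zero_le_power2 mult_nonneg_nonneg)
  qed
  also have "\<dots> = ennreal 2 * (\<integral>\<^sup>+x. ennreal ((w x)\<^sup>2) \<partial>q) + ennreal 2 * (\<integral>\<^sup>+x. ennreal ((w x)\<^sup>2) \<partial>q)"
    by (simp add: nn_integral_add nn_integral_cmult)
  also have "\<dots> < \<infinity>" using q(2) by (simp add: ennreal_mult_less_top ennreal_add_less_top del: ennreal_numeral)
  finally show ?thesis .
qed

end

section \<open>Asymptotic independence\<close>

lemma generate_image_hom:
  assumes "group G" "group H" "h \<in> hom G H" "S \<subseteq> carrier G" "g \<in> generate G S"
  shows "h g \<in> generate H (h ` S)"
proof -
  interpret group_hom G H h
    using assms by (intro group_hom.intro group_hom_axioms.intro)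
  show ?thesis
    using assms(5)
  proof induction
    case one
    show ?case by (simp add: generate.one)
  next
    case (incl s)
    then show ?case by (simp add: generate.incl)
  next
    case (inv s)
    then have "s \<in> carrier G" using assms(4) by auto
    then show ?case using inv by (simp add: generate.inv)
  next
    case (eng a b)
    then have "a \<in> carrier G" "b \<in> carrier G" using G.generate_in_carrier[OF assms(4)] by auto
    then show ?case using eng by (simp add: generate.eng)
  qed
qed

lemma generate_hom_surj:
  assumes "group G" "group H" "h \<in> hom G H" "h ` carrier G = carrier H" "S \<subseteq> carrier G" "generate G S = carrier G"
  shows "generate H (h ` S) = carrier H"
proof
  interpret H: group H by fact
  have "h ` S \<subseteq> carrier H" using assms(4,5) by auto
  then show "generate H (h ` S) \<subseteq> carrier H" by (rule H.generate_incl)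
  show "carrier H \<subseteq> generate H (h ` S)"
    unfolding assms(4)[symmetric]
    by (intro image_subsetI generate_image_hom[OF assms(1-3,5)]) (simp only: assms(6))
qed

text \<open>Homomorphisms carry words to words. Applied to both projections, this bounds
  \<open>w\<close> by the word length on the product.\<close>

lemma word_length_hom:
  assumes "group G" "group H" "h \<in> hom G H" "S \<subseteq> carrier G" "generate G S = carrier G" "g \<in> carrier G"
  shows "word_length H (h ` S) (h g) \<le> word_length G S g"
proof -
  interpret group_hom G H h
    using assms by (intro group_hom.intro group_hom_axioms.intro)
  have "word G (G.sym_set S) (word_length G S g) g"
    by (rule G.word_word_length) (use assms in auto)
  then have "word H (H.sym_set (h ` S)) (word_length G S g) (h g) \<and> g \<in> carrier G"
  proof (rule word_map)
    show "h ` G.sym_set S \<subseteq> H.sym_set (h ` S)"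
    proof
      fix y assume "y \<in> h ` G.sym_set S"
      then obtain s where s: "s \<in> S" "y = h s \<or> y = h (inv\<^bsub>G\<^esub> s)" by auto
      then have "s \<in> carrier G" using assms(4) by auto
      then show "y \<in> H.sym_set (h ` S)" using s by auto
    qed
    show "G.sym_set S \<subseteq> carrier G" using assms(4) by auto
  qed auto
  then show ?thesis by (intro H.word_length_le) simp
qed

lemma finite_second_moment_nn_integral:
  assumes "(\<lambda>g. (f g)\<^sup>2 * pmf p g) summable_on A" "set_pmf p \<subseteq> A"
  shows "(\<integral>\<^sup>+x. ennreal ((f x)\<^sup>2) \<partial>p) < \<infinity>"
proof -
  let ?g = "\<lambda>x. (f x)\<^sup>2 * pmf p x"
  have "?g summable_on UNIV \<longleftrightarrow> ?g summable_on A"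
    by (rule summable_on_cong_neutral) (use assms(2) in \<open>auto simp: set_pmf_iff\<close>)
  then have "?g summable_on UNIV" using assms(1) by simp
  then have "Infinite_Sum.abs_summable_on ?g UNIV" by (rule iffD1[OF summable_on_iff_abs_summable_on_real])
  then have "Infinite_Set_Sum.abs_summable_on ?g UNIV" by (rule iffD1[OF abs_summable_equivalent])
  then have "integrable (count_space UNIV) ?g" by (simp only: abs_summable_on_def)
  then have "(\<integral>\<^sup>+x. ennreal (norm (?g x)) \<partial>count_space UNIV) < \<infinity>" by (simp add: integrable_iff_bounded)
  moreover have "(\<integral>\<^sup>+x. ennreal ((f x)\<^sup>2) \<partial>p) = (\<integral>\<^sup>+x. ennreal (norm (?g x)) \<partial>count_space UNIV)"
    unfolding nn_integral_measure_pmf by (intro nn_integral_cong) (simp add: ennreal_mult'[symmetric] mult.commute abs_mult)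
  ultimately show ?thesis by simp
qed

theorem theorem1p3:
  fixes G1 :: "('a, 'm) monoid_scheme" and G2 :: "('b, 'n) monoid_scheme"
    and \<nu> :: "('a \<times> 'b) pmf" and \<mu>1 :: "'a pmf" and \<mu>2 :: "'b pmf"
  assumes "finitely_generated_group G1" and "virtually_abelian G1"
    and "finitely_generated_group G2" and "virtually_abelian G2"
    and "set_pmf \<nu> \<subseteq> carrier (G1 \<times>\<times> G2)"
    and "aperiodic (G1 \<times>\<times> G2) \<nu>"
    and "finite_second_moment (G1 \<times>\<times> G2) \<nu>"
    and "semigroup_generated (G1 \<times>\<times> G2) (set_pmf \<nu>) = carrier (G1 \<times>\<times> G2)"
    and "\<mu>1 = map_pmf fst \<nu>" and "\<mu>2 = map_pmf snd \<nu>"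
    and "\<not> (\<exists>h. h \<in> epi G1 integer_group)"
  shows "(\<lambda>n. tv_dist (conv_power (G1 \<times>\<times> G2) \<nu> n)
                      (pair_pmf (conv_power G1 \<mu>1 n) (conv_power G2 \<mu>2 n)))
         \<longlonglongrightarrow> 0"
proof -
  let ?G = "G1 \<times>\<times> G2"
  obtain N1 rep1 where t1: "transversal G1 N1 rep1" using virtually_abelian_transversal[OF assms(2)] by blast
  obtain N2 rep2 where t2: "transversal G2 N2 rep2" using virtually_abelian_transversal[OF assms(4)] by blast
  interpret A: transversal G1 N1 rep1 by (rule t1)
  interpret B: transversal G2 N2 rep2 by (rule t2)
  interpret Gr: group ?G by (rule DirProd_group[OF A.is_group B.is_group])
  obtain X where X: "finite X" "X \<subseteq> carrier ?G" "generate ?G X = carrier ?G"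
    and sm: "(\<lambda>g. (real (word_length ?G X g))\<^sup>2 * pmf \<nu> g) summable_on carrier ?G"
    using assms(7) unfolding finite_second_moment_def by blast
  \<comment> \<open>Projections of the generating set from the moment hypothesis, so that
    \<open>w\<close> below is dominated by its word length.\<close>
  define X1 X2 where "X1 = fst ` X" and "X2 = snd ` X"
  have hom1: "fst \<in> hom ?G G1" and hom2: "snd \<in> hom ?G G2"
    by (auto simp: hom_def mult_DirProd')
  have im: "fst ` carrier ?G = carrier G1" "snd ` carrier ?G = carrier G2"
    using A.one_closed B.one_closed by (auto simp: fst_image_times snd_image_times)
  have X1: "finite X1" "X1 \<subseteq> carrier G1" "generate G1 X1 = carrier G1"
    using X generate_hom_surj[OF Gr.is_group A.is_group hom1 im(1) X(2,3)] unfolding X1_def by auto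
  have X2: "finite X2" "X2 \<subseteq> carrier G2" "generate G2 X2 = carrier G2"
    using X generate_hom_surj[OF Gr.is_group B.is_group hom2 im(2) X(2,3)] unfolding X2_def by auto
  let ?l1 = "word_length G1 X1" and ?l2 = "word_length G2 X2"
  obtain S1 C1 where S1': "finite S1 \<and> S1 \<subseteq> N1 \<and> (\<forall>y\<in>carrier G1. \<forall>s\<in>S1. y \<otimes>\<^bsub>G1\<^esub> s \<otimes>\<^bsub>G1\<^esub> inv\<^bsub>G1\<^esub> y \<in> S1) \<and>
    (\<forall>x\<in>carrier G1. \<exists>n \<le> C1 + ?l1 x. word G1 S1 n (A.npart x))"
    using A.ex_conj_closed_generators[OF X1] by (elim exE)
  have S1: "finite S1" "S1 \<subseteq> N1" "\<And>y s. y \<in> carrier G1 \<Longrightarrow> s \<in> S1 \<Longrightarrow> y \<otimes>\<^bsub>G1\<^esub> s \<otimes>\<^bsub>G1\<^esub> inv\<^bsub>G1\<^esub> y \<in> S1"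
    "\<And>x. x \<in> carrier G1 \<Longrightarrow> \<exists>n \<le> C1 + ?l1 x. word G1 S1 n (A.npart x)"
    using S1' by simp_all
  obtain S2 C2 where S2': "finite S2 \<and> S2 \<subseteq> N2 \<and> (\<forall>y\<in>carrier G2. \<forall>s\<in>S2. y \<otimes>\<^bsub>G2\<^esub> s \<otimes>\<^bsub>G2\<^esub> inv\<^bsub>G2\<^esub> y \<in> S2) \<and>
    (\<forall>x\<in>carrier G2. \<exists>n \<le> C2 + ?l2 x. word G2 S2 n (B.npart x))"
    using B.ex_conj_closed_generators[OF X2] by (elim exE)
  have S2: "finite S2" "S2 \<subseteq> N2" "\<And>y s. y \<in> carrier G2 \<Longrightarrow> s \<in> S2 \<Longrightarrow> y \<otimes>\<^bsub>G2\<^esub> s \<otimes>\<^bsub>G2\<^esub> inv\<^bsub>G2\<^esub> y \<in> S2"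
    "\<And>x. x \<in> carrier G2 \<Longrightarrow> \<exists>n \<le> C2 + ?l2 x. word G2 S2 n (B.npart x)"
    using S2' by simp_all
  \<comment> \<open>Each generator lies in a single factor, so displacements in \<open>N1\<close>
    and in \<open>N2\<close> can be treated separately.\<close>
  define S where "S = (\<lambda>s. (s, \<one>\<^bsub>G2\<^esub>)) ` S1 \<union> (\<lambda>s. (\<one>\<^bsub>G1\<^esub>, s)) ` S2"
  define w where "w x = 1 + real (?l1 (fst x)) + real (?l2 (snd x))" for x
  \<comment> \<open>\<open>C1\<close> and \<open>C2\<close> cover the additive constants, since
    \<open>w\<close> is at least 1; the summand 1 covers the word length itself.\<close>
  define C where "C = real (C1 + C2 + 1)"
  have Cw: "real n \<le> C * w x" if "n \<le> C1 + ?l1 (fst x) \<or> n \<le> C2 + ?l2 (snd x)" for n x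
  proof -
    have w1: "1 \<le> w x" by (simp add: w_def)
    have "real C1 * 1 \<le> real C1 * w x" "real C2 * 1 \<le> real C2 * w x"
      by (rule mult_left_mono[OF w1], simp)+
    moreover have "C * w x = w x + real C1 * w x + real C2 * w x" by (simp add: C_def distrib_right)
    moreover have "real n \<le> real C1 + w x \<or> real n \<le> real C2 + w x"
      using that unfolding w_def by linarith
    moreover have "0 \<le> real C1" "0 \<le> real C2" by simp_all
    ultimately show ?thesis by linarith
  qed
  obtain e where e: "0 < e" "\<And>x. x \<in> carrier G1 \<Longrightarrow> A.transfer x [^]\<^bsub>A.NG\<^esub> (e::nat) = \<one>\<^bsub>G1\<^esub>"
    using A.transfer_torsion[OF assms(1,11)] by blast
  interpret two_transversals G1 N1 rep1 G2 N2 rep2 S w C e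
  proof (intro two_transversals.intro two_transversals_axioms.intro t1 t2)
    show "S \<subseteq> N1 \<times> N2" using S1(2) S2(2) by (auto simp: S_def)
    show "0 < e" by (rule e)
    show "A.transfer z [^]\<^bsub>A.NG\<^esub> e = \<one>\<^bsub>G1\<^esub>" if "z \<in> carrier G1" for z by (rule e(2)[OF that])
    fix x assume x: "x \<in> carrier ?G"
    then have x12: "fst x \<in> carrier G1" "snd x \<in> carrier G2" by auto
    show "1 \<le> w x" by (simp add: w_def)
    obtain n where n: "n \<le> C1 + ?l1 (fst x)" "word G1 S1 n (A.npart (fst x))" using S1(4)[OF x12(1)] by blast
    have "word ?G S n (A.npart (fst x), \<one>\<^bsub>G2\<^esub>) \<and> A.npart (fst x) \<in> carrier G1"
      by (rule word_map[OF n(2), where f = "\<lambda>s. (s, \<one>\<^bsub>G2\<^esub>)" and K = "carrier G1"])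
         (use S1(2) in \<open>auto simp: S_def\<close>)
    then show "Gr.short S (C * w x) (A.npart (fst x), \<one>\<^bsub>G2\<^esub>)"
      unfolding Gr.short_def using Cw[of n x] n(1) by blast
    obtain m where m: "m \<le> C2 + ?l2 (snd x)" "word G2 S2 m (B.npart (snd x))" using S2(4)[OF x12(2)] by blast
    have "word ?G S m (\<one>\<^bsub>G1\<^esub>, B.npart (snd x)) \<and> B.npart (snd x) \<in> carrier G2"
      by (rule word_map[OF m(2), where f = "\<lambda>s. (\<one>\<^bsub>G1\<^esub>, s)" and K = "carrier G2"])
         (use S2(2) in \<open>auto simp: S_def\<close>)
    then show "Gr.short S (C * w x) (\<one>\<^bsub>G1\<^esub>, B.npart (snd x))"
      unfolding Gr.short_def using Cw[of m x] m(1) by blast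
    fix y assume y: "y \<in> carrier ?G"
    then have y12: "fst y \<in> carrier G1" "snd y \<in> carrier G2" by auto
    have "?l1 (fst x \<otimes>\<^bsub>G1\<^esub> fst y) \<le> ?l1 (fst x) + ?l1 (fst y)" "?l2 (snd x \<otimes>\<^bsub>G2\<^esub> snd y) \<le> ?l2 (snd x) + ?l2 (snd y)"
      by (rule A.word_length_mult[OF X1(2,3) x12(1) y12(1)], rule B.word_length_mult[OF X2(2,3) x12(2) y12(2)])
    then show "w (x \<otimes>\<^bsub>?G\<^esub> y) \<le> w x + w y" by (simp add: w_def mult_DirProd')
  qed
  have supp: "Gr.supp_on \<nu>" using assms(5) by (simp only: Gr.supp_on_def)
  define \<nu>' where "\<nu>' = pair_pmf \<mu>1 \<mu>2"
  have supp': "Gr.supp_on \<nu>'"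
    using assms(5) by (auto simp: Gr.supp_on_def \<nu>'_def assms(9,10))
  have S_conj: "y \<otimes>\<^bsub>?G\<^esub> s \<otimes>\<^bsub>?G\<^esub> inv\<^bsub>?G\<^esub> y \<in> S" if "y \<in> carrier ?G" "s \<in> S" for y s
    using that S1(3) S2(3) by (auto simp: S_def inv_DirProd[OF A.is_group B.is_group])
  have fin_S: "finite S" using S1(1) S2(1) by (simp add: S_def)
  have w_inv: "w (inv\<^bsub>?G\<^esub> x) \<le> w x" if "x \<in> carrier ?G" for x
    using that A.word_length_inv[OF X1(2,3), of "fst x"] B.word_length_inv[OF X2(2,3), of "snd x"]
    by (auto simp: w_def inv_DirProd[OF A.is_group B.is_group])
  have m\<nu>: "(\<integral>\<^sup>+x. ennreal ((w x)\<^sup>2) \<partial>\<nu>) < \<infinity>"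
  proof -
    have "(\<integral>\<^sup>+x. ennreal ((w x)\<^sup>2) \<partial>\<nu>) \<le> (\<integral>\<^sup>+x. 2 + 8 * ennreal ((real (word_length ?G X x))\<^sup>2) \<partial>\<nu>)"
    proof (rule nn_integral_mono_AE, unfold AE_measure_pmf_iff, rule ballI)
      fix x assume "x \<in> set_pmf \<nu>"
      then have x: "x \<in> carrier ?G" using assms(5) by blast
      let ?l = "real (word_length ?G X x)"
      have "w x \<le> 1 + 2 * ?l"
        using word_length_hom[OF Gr.is_group A.is_group hom1 X(2,3) x] word_length_hom[OF Gr.is_group B.is_group hom2 X(2,3) x]
        by (simp add: w_def X1_def X2_def)
      then have "(w x)\<^sup>2 \<le> (1 + 2 * ?l)\<^sup>2" by (rule power_mono) (simp add: w_def)
      also have "\<dots> \<le> 2 + 8 * ?l\<^sup>2"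
        using zero_le_power2[of "1 - 2 * ?l"] by (simp add: power2_eq_square algebra_simps)
      finally have "ennreal ((w x)\<^sup>2) \<le> ennreal (2 + 8 * ?l\<^sup>2)" by (rule ennreal_leI)
      then show "ennreal ((w x)\<^sup>2) \<le> 2 + 8 * ennreal (?l\<^sup>2)"
        by (simp add: ennreal_plus ennreal_mult)
    qed
    also have "\<dots> = 2 + 8 * (\<integral>\<^sup>+x. ennreal ((real (word_length ?G X x))\<^sup>2) \<partial>\<nu>)"
      by (simp add: nn_integral_add nn_integral_cmult)
    also have "\<dots> < \<infinity>"
      using finite_second_moment_nn_integral[OF sm assms(5)] by (simp add: ennreal_add_less_top ennreal_mult_less_top)
    finally show ?thesis .
  qed
  have m\<nu>': "(\<integral>\<^sup>+x. ennreal ((w x)\<^sup>2) \<partial>\<nu>') < \<infinity>"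
    unfolding \<nu>'_def assms(9,10) by (rule second_moment_pair[OF supp m\<nu>]) (simp add: w_def)
  \<comment> \<open>What the supports must contain: the representatives for \<open>\<kappa>\<close>,
    and the identity with \<open>S\<close> for the central lazy step.\<close>
  define Q where "Q = P.T \<union> insert \<one>\<^bsub>?G\<^esub> S"
  define Qs where "Qs = Q \<union> (\<lambda>x. inv\<^bsub>?G\<^esub> x) ` Q"
  have Q: "finite Q" "Q \<subseteq> carrier ?G"
  proof -
    show "finite Q" unfolding Q_def by (simp only: finite_Un finite_insert P.finite_rep fin_S)
    show "Q \<subseteq> carrier ?G"
      unfolding Q_def by (intro Un_least insert_subsetI Gr.one_closed S_carrier subsetI[OF P.T_closed])
  qed
  have Qs: "finite Qs" "Qs \<subseteq> carrier ?G"
  proof -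
    show "finite Qs" unfolding Qs_def by (intro finite_UnI finite_imageI Q(1))
    show "Qs \<subseteq> carrier ?G"
      unfolding Qs_def by (intro Un_least Q(2) image_subsetI Gr.inv_closed subsetD[OF Q(2)])
  qed
  obtain m0 where m0: "\<And>m. m \<ge> m0 \<Longrightarrow> Qs \<subseteq> set_pmf (\<nu> ^\<odot> m)"
    using Gr.eventually_in_set_cpow[OF supp assms(6,8) Qs] by blast
  have mar: "map_pmf fst \<nu>' = map_pmf fst \<nu>" "map_pmf snd \<nu>' = map_pmf snd \<nu>"
    by (simp_all add: \<nu>'_def assms(9,10) map_fst_pair_pmf map_snd_pair_pmf)
  have block: "\<exists>n0. \<forall>n\<ge>n0. tv_le (\<nu> ^\<odot> (m * n)) (\<nu>' ^\<odot> (m * n)) \<delta>" if m: "m \<ge> max m0 1" and \<delta>: "0 < \<delta>" for m \<delta>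
  proof -
    have Q1: "Q \<union> (\<lambda>x. inv\<^bsub>?G\<^esub> x) ` Q \<subseteq> set_pmf (\<nu> ^\<odot> m)" using m0[of m] m unfolding Qs_def by simp
    \<comment> \<open>The product law has the larger support, so it suffices to arrange the support
      condition for \<open>\<nu>\<close>.\<close>
    have "set_pmf (\<nu> ^\<odot> m) \<subseteq> set_pmf (\<nu>' ^\<odot> m)"
    proof
      fix x assume x: "x \<in> set_pmf (\<nu> ^\<odot> m)"
      then have "fst x \<in> set_pmf (map_pmf fst (\<nu> ^\<odot> m))" "snd x \<in> set_pmf (map_pmf snd (\<nu> ^\<odot> m))" by auto
      then show "x \<in> set_pmf (\<nu>' ^\<odot> m)"
        unfolding \<nu>'_def pair_pmf_ppow map_fst_ppow map_snd_ppow assms(9,10)[symmetric] by (cases x) simp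
    qed
    then have Q2: "Q \<union> (\<lambda>x. inv\<^bsub>?G\<^esub> x) ` Q \<subseteq> set_pmf (\<nu>' ^\<odot> m)" using Q1 by blast
    have m1: "1 \<le> m" using m by simp
    have "\<exists>n0. \<forall>n\<ge>n0. tv_le ((\<nu> ^\<odot> m) ^\<odot> n) ((\<nu>' ^\<odot> m) ^\<odot> n) \<delta>"
    proof (rule full_swap[OF _ _ _ _ Q_def Q1 Q2 S_conj fin_S _ _ w_inv \<delta>])
      show "Gr.supp_on (\<nu> ^\<odot> m)" "Gr.supp_on (\<nu>' ^\<odot> m)" by (rule Gr.supp_on_cpow[OF supp], rule Gr.supp_on_cpow[OF supp'])
      show "map_pmf fst (\<nu> ^\<odot> m) = map_pmf fst (\<nu>' ^\<odot> m)" "map_pmf snd (\<nu> ^\<odot> m) = map_pmf snd (\<nu>' ^\<odot> m)"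
        unfolding map_fst_ppow map_snd_ppow mar by (rule refl)+
      show "(\<integral>\<^sup>+x. ennreal ((w x)\<^sup>2) \<partial>(\<nu> ^\<odot> m)) < \<infinity>" by (rule second_moment_cpow[OF supp m\<nu> m1])
      show "(\<integral>\<^sup>+x. ennreal ((w x)\<^sup>2) \<partial>(\<nu>' ^\<odot> m)) < \<infinity>" by (rule second_moment_cpow[OF supp' m\<nu>' m1])
    qed
    then show ?thesis unfolding Gr.cpow_mult[OF supp] Gr.cpow_mult[OF supp'] .
  qed
  have ev: "\<exists>n0. \<forall>n\<ge>n0. tv_le (\<nu> ^\<odot> n) (\<nu>' ^\<odot> n) \<delta>" if \<delta>: "0 < \<delta>" for \<delta>
  proof -
    \<comment> \<open>\<open>block\<close> compares only multiples of a fixed length; the coprime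
      lengths \<open>m\<close> and \<open>Suc m\<close> together reach every large
      \<open>n\<close>.\<close>
    define m where "m = max m0 1"
    have \<delta>2: "0 < \<delta> / 2" using \<delta> by simp
    obtain a0 where a0: "\<And>n. n \<ge> a0 \<Longrightarrow> tv_le (\<nu> ^\<odot> (m * n)) (\<nu>' ^\<odot> (m * n)) (\<delta> / 2)"
      using block[of m, OF _ \<delta>2] m_def by blast
    obtain b0 where b0: "\<And>n. n \<ge> b0 \<Longrightarrow> tv_le (\<nu> ^\<odot> (Suc m * n)) (\<nu>' ^\<odot> (Suc m * n)) (\<delta> / 2)"
      using block[of "Suc m", OF _ \<delta>2] m_def by fastforce
    have "tv_le (\<nu> ^\<odot> n) (\<nu>' ^\<odot> n) \<delta>" if n: "n \<ge> m * a0 + m * b0 + b0 + m * m + m" for n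
    proof -
      have m1: "1 \<le> m" by (simp add: m_def)
      \<comment> \<open>\<open>b\<close> is at least \<open>b0\<close> and congruent to
        \<open>n\<close> modulo \<open>m\<close>, so \<open>n - Suc m * b\<close> is a multiple of
        \<open>m\<close>. The threshold on \<open>n\<close> makes the quotient at least
        \<open>a0\<close>.\<close>
      define r where "r = (n - b0) mod m"
      define b where "b = b0 + r"
      have r: "r < m" using m1 by (simp add: r_def)
      have "Suc m * b \<le> m * b0 + b0 + m * m + m"
      proof -
        have "m * r \<le> m * m" using r by simp
        moreover have "Suc m * b = m * b0 + b0 + m * r + r" by (simp add: b_def distrib_left)
        ultimately show ?thesis using r by linarith
      qed
      then have le: "Suc m * b + m * a0 \<le> n" using n by linarith
      have "m dvd n - Suc m * b"
      proof -
        have "m dvd (n - b0) - r" unfolding r_def by (rule dvd_minus_mod)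
        moreover have "n - b = (n - b0) - r" by (simp add: b_def)
        moreover have "n - Suc m * b = (n - b) - m * b" by simp
        ultimately show ?thesis by (metis dvd_diff_nat dvd_triv_left)
      qed
      then obtain a where a: "n - Suc m * b = m * a" by (auto simp: dvd_def)
      have nn: "n = m * a + Suc m * b" using a le by linarith
      have "m * a0 \<le> m * a" using le nn by linarith
      then have "a0 \<le> a" using m1 by simp
      moreover have "b0 \<le> b" by (simp add: b_def)
      ultimately have t: "tv_le (\<nu> ^\<odot> (m * a)) (\<nu>' ^\<odot> (m * a)) (\<delta> / 2)" "tv_le (\<nu> ^\<odot> (Suc m * b)) (\<nu>' ^\<odot> (Suc m * b)) (\<delta> / 2)"
        using a0 b0 by blast+
      have "tv_le (\<nu> ^\<odot> (m * a) \<odot> \<nu> ^\<odot> (Suc m * b)) (\<nu>' ^\<odot> (m * a) \<odot> \<nu>' ^\<odot> (Suc m * b)) (\<delta> / 2 + \<delta> / 2)"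
        by (rule tv_le_trans[OF Gr.tv_le_conv_right[OF t(1)] Gr.tv_le_conv_left[OF t(2)]])
      then show ?thesis
        using Gr.cpow_add[OF supp, of "m * a" "Suc m * b"] Gr.cpow_add[OF supp', of "m * a" "Suc m * b"] by (simp add: nn)
    qed
    then show ?thesis by blast
  qed
  show ?thesis
  proof (rule LIMSEQ_I)
    fix \<delta> :: real assume \<delta>: "0 < \<delta>"
    then obtain n0 where n0: "\<And>n. n \<ge> n0 \<Longrightarrow> tv_le (\<nu> ^\<odot> n) (\<nu>' ^\<odot> n) (\<delta> / 2)"
      using ev[of "\<delta> / 2"] by auto
    have "norm (tv_dist (\<nu> ^\<odot> n) (pair_pmf (conv_power G1 \<mu>1 n) (conv_power G2 \<mu>2 n)) - 0) < \<delta>" if "n \<ge> n0" for n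
      using tv_dist_le[OF n0[OF that]] tv_dist_nonneg[of "\<nu> ^\<odot> n" "\<nu>' ^\<odot> n"] \<delta>
      unfolding \<nu>'_def pair_pmf_ppow by simp
    then show "\<exists>n0. \<forall>n\<ge>n0. norm (tv_dist (\<nu> ^\<odot> n) (pair_pmf (conv_power G1 \<mu>1 n) (conv_power G2 \<mu>2 n)) - 0) < \<delta>"
      by blast
  qed
qed

end
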